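(* Let $m,n$ be positive integers with $m\ge 2$, let $k\in\{0,1,\dotsc,n-1\}$, and let $\lambda$ be a partition of $n$. Then \[ \rho^\lambda_m/\chi^{(1^{n-k})} = \sum_{\beta\vdash k} \rho^\beta_m \boxtimes \rho^{\lambda'/\beta'}_{m-1}. \]
   Context: $\chi^\lambda$ denotes the irreducible complex character of the symmetric group $S_n$ labelled by $\lambda\vdash n$ in the standard way (so $\chi^{(n)}$ is trivial and $\chi^{(1^n)}$ is the sign character); $\lambda'$ is the conjugate partition. For partitions $\beta,\alpha$ with $|\beta|\le|\alpha|$, the skew character $\chi^{\alpha/\beta}$ of $S_{|\alpha|-|\beta|}$ is $\chi^{\alpha/\beta}=\sum_{\nu\vdash|\alpha|-|\beta|} c^\alpha_{\beta,\nu}\chi^\nu$, with $c^\alpha_{\beta,\nu}$ the Littlewood--Richardson coefficients; it is $0$ if $\beta\not\subseteq\alpha$. For a character $\phi$ of $S_n$ and a partition $\beta$, $\phi/\chi^\beta:=\sum_{\alpha\vdash n}\langle\phi,\chi^\alpha\rangle\,\chi^{\alpha/\beta}$ (a character of $S_{n-|\beta|}$, with $\chi^{\alpha/\beta}=0$ if $\beta\not\subseteq\alpha$). For characters $\phi$ of $S_a$ and $\theta$ of $S_b$, $\phi\boxtimes\theta:=(\phi\times\theta)\uparrow_{S_a\times S_b}^{S_{a+b}}$ (induction). For a skew shape $\alpha/\beta$ of size $n$, $\rho^{\alpha/\beta}_m$ is the character of $S_{mn}$ obtained by inflating $\chi^{\alpha/\beta}$ from $S_n$ to the imprimitive wreath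 product $S_m\wr S_n=S_m^{\times n}\rtimes S_n\le S_{mn}$ (via the quotient $(S_m\wr S_n)/S_m^{\times n}\cong S_n$) and then inducing to $S_{mn}$; a partition $\lambda$ is regarded as the skew shape $\lambda/\emptyset$. $\rho^{\alpha/\beta}_m=0$ if $\beta\not\subseteq\alpha$, and $\rho^\emptyset_m$ is the trivial character of $S_0$. *)

theory Defs
  imports
    "HOL-Algebra.Sym_Groups"
    "Jordan_Normal_Form.VS_Connect"
begin

section \<open>Characters of finite groups\<close>

text \<open>Class functions are compared on the carrier of the group only; their values elsewhere are
  irrelevant.\<close>

definition GL :: "nat \<Rightarrow> complex mat monoid" where
  "GL d = units_of (ring_mat TYPE(complex) d ())"

definition irreducible_rep :: "('g, 'b) monoid_scheme \<Rightarrow> nat \<Rightarrow> ('g \<Rightarrow> complex mat) \<Rightarrow> bool" where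
  "irreducible_rep G d R \<longleftrightarrow> R \<in> hom G (GL d) \<and> d > 0 \<and>
     (\<forall>W. VectorSpace.subspace class_ring W (module_vec TYPE(complex) d) \<and>
          (\<forall>g\<in>carrier G. \<forall>w\<in>W. R g *\<^sub>v w \<in> W) \<longrightarrow>
        W = {0\<^sub>v d} \<or> W = carrier_vec d)"

definition mat_trace :: "complex mat \<Rightarrow> complex" where
  "mat_trace A = sum_list (diag_mat A)"

text \<open>The restriction to the carrier makes a character unique as a function.\<close>

definition irreducible_character :: "('g, 'b) monoid_scheme \<Rightarrow> ('g \<Rightarrow> complex) \<Rightarrow> bool" where
  "irreducible_character G \<chi> \<longleftrightarrow>
     (\<exists>d R. irreducible_rep G d R \<and> \<chi> = (\<lambda>g\<in>carrier G. mat_trace (R g)))"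

definition char_inner ::
    "('g, 'b) monoid_scheme \<Rightarrow> ('g \<Rightarrow> complex) \<Rightarrow> ('g \<Rightarrow> complex) \<Rightarrow> complex" where
  "char_inner G \<phi> \<psi> = (\<Sum>g\<in>carrier G. \<phi> g * cnj (\<psi> g)) / of_nat (Coset.order G)"

definition induced ::
    "('g, 'b) monoid_scheme \<Rightarrow> 'g set \<Rightarrow> ('g \<Rightarrow> complex) \<Rightarrow> 'g \<Rightarrow> complex" where
  "induced G H \<phi> g =
     (\<Sum>x\<in>carrier G. let y = inv\<^bsub>G\<^esub> x \<otimes>\<^bsub>G\<^esub> g \<otimes>\<^bsub>G\<^esub> x in if y \<in> H then \<phi> y else 0) / of_nat (card H)"

section \<open>Partitions\<close>

definition partitions :: "nat \<Rightarrow> nat list set" where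
  "partitions n = {lam. sorted_wrt (\<ge>) lam \<and> 0 \<notin> set lam \<and> sum_list lam = n}"

text \<open>The parts of the conjugate are the column lengths of the Young diagram
  (columns numbered from 0).\<close>

definition conj_part :: "nat list \<Rightarrow> nat list" where
  "conj_part lam = map (\<lambda>j. length (filter (\<lambda>x. j < x) lam)) [0..<Max (insert 0 (set lam))]"

section \<open>Irreducible characters of symmetric groups\<close>

text \<open>The Young subgroup of a composition \<open>lam\<close> stabilises each of the consecutive intervals of
  \<open>{1..n}\<close> of lengths \<open>lam ! 0\<close>, \<open>lam ! 1\<close>, and so on, where \<open>n = sum_list lam\<close>.\<close>

definition young_block :: "nat list \<Rightarrow> nat \<Rightarrow> nat set" where
  "young_block lam i = {sum_list (take i lam) <.. sum_list (take (Suc i) lam)}"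

definition young_subgroup :: "nat list \<Rightarrow> (nat \<Rightarrow> nat) set" where
  "young_subgroup lam = {p \<in> carrier (sym_group (sum_list lam)).
     \<forall>i<length lam. p ` young_block lam i = young_block lam i}"

text \<open>The standard labelling (as in James and Kerber): the irreducible character labelled by
  \<open>lam\<close> is the unique common irreducible constituent of the trivial character induced from the
  Young subgroup of \<open>lam\<close> and of the sign character induced from the Young subgroup of the conjugate
  partition. The partition \<open>(n)\<close> gives the trivial and \<open>(1\<^sup>n)\<close> the sign character.\<close>

definition irr_sym :: "nat list \<Rightarrow> (nat \<Rightarrow> nat) \<Rightarrow> complex" where
  "irr_sym lam = (let S = sym_group (sum_list lam) in
     THE \<chi>. irreducible_character S \<chi> \<and>
       char_inner S \<chi> (induced S (young_subgroup lam) (\<lambda>_. 1)) \<noteq> 0 \<and>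
       char_inner S \<chi> (induced S (young_subgroup (conj_part lam)) (\<lambda>p. of_int (sign p))) \<noteq> 0)"

section \<open>Induction products and skew characters\<close>

text \<open>The permutation of \<open>{1..k}\<close> by which \<open>p\<close> acts on \<open>{off+1..off+k}\<close>, when \<open>p\<close> preserves that
  interval.\<close>

definition shifted_restrict :: "nat \<Rightarrow> nat \<Rightarrow> (nat \<Rightarrow> nat) \<Rightarrow> nat \<Rightarrow> nat" where
  "shifted_restrict off k p = (\<lambda>x. if x \<in> {1..k} then p (off + x) - off else x)"

definition ind_prod ::
    "nat \<Rightarrow> nat \<Rightarrow> ((nat \<Rightarrow> nat) \<Rightarrow> complex) \<Rightarrow> ((nat \<Rightarrow> nat) \<Rightarrow> complex) \<Rightarrow> (nat \<Rightarrow> nat) \<Rightarrow> complex" where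
  "ind_prod a b \<phi> \<theta> = induced (sym_group (a + b)) (young_subgroup [a, b])
     (\<lambda>p. \<phi> (shifted_restrict 0 a p) * \<theta> (shifted_restrict a b p))"

text \<open>Littlewood--Richardson coefficients, as the multiplicities of the irreducible characters in
  induction products; intended for \<open>sum_list \<alpha> = sum_list \<beta> + sum_list \<nu>\<close>.\<close>

definition lr_coeff :: "nat list \<Rightarrow> nat list \<Rightarrow> nat list \<Rightarrow> complex" where
  "lr_coeff \<alpha> \<beta> \<nu> = char_inner (sym_group (sum_list \<alpha>)) (irr_sym \<alpha>)
     (ind_prod (sum_list \<beta>) (sum_list \<nu>) (irr_sym \<beta>) (irr_sym \<nu>))"

text \<open>Intended for \<open>sum_list \<beta> \<le> sum_list \<alpha>\<close>. There is no case distinction for \<open>\<beta>\<close> not contained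
  in \<open>\<alpha>\<close>, since all the Littlewood--Richardson coefficients vanish then.\<close>

definition skew_char :: "nat list \<Rightarrow> nat list \<Rightarrow> (nat \<Rightarrow> nat) \<Rightarrow> complex" where
  "skew_char \<alpha> \<beta> g =
     (\<Sum>\<nu>\<in>partitions (sum_list \<alpha> - sum_list \<beta>). lr_coeff \<alpha> \<beta> \<nu> * irr_sym \<nu> g)"

definition char_quotient ::
    "nat \<Rightarrow> ((nat \<Rightarrow> nat) \<Rightarrow> complex) \<Rightarrow> nat list \<Rightarrow> (nat \<Rightarrow> nat) \<Rightarrow> complex" where
  "char_quotient n \<phi> \<beta> g =
     (\<Sum>\<alpha>\<in>partitions n. char_inner (sym_group n) \<phi> (irr_sym \<alpha>) * skew_char \<alpha> \<beta> g)"

section \<open>Wreath products and inflated characters\<close>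

text \<open>The imprimitive wreath product is the subgroup of the symmetric group on \<open>{1..m * n}\<close> that
  permutes the \<open>n\<close> consecutive intervals of length \<open>m\<close> among themselves; the quotient map to
  the symmetric group on \<open>{1..n}\<close> is the induced action on these intervals (for \<open>m \<ge> 1\<close>).\<close>

definition wreath_block :: "nat \<Rightarrow> nat \<Rightarrow> nat set" where
  "wreath_block m i = {m * (i - 1) <.. m * i}"

definition wreath_product :: "nat \<Rightarrow> nat \<Rightarrow> (nat \<Rightarrow> nat) set" where
  "wreath_product m n = {p \<in> carrier (sym_group (m * n)).
     \<forall>i\<in>{1..n}. \<exists>j\<in>{1..n}. p ` wreath_block m i = wreath_block m j}"

definition wreath_top :: "nat \<Rightarrow> nat \<Rightarrow> (nat \<Rightarrow> nat) \<Rightarrow> nat \<Rightarrow> nat" where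
  "wreath_top m n p = (\<lambda>i. if i \<in> {1..n}
     then THE j. j \<in> {1..n} \<and> p ` wreath_block m i = wreath_block m j else i)"

definition rho :: "nat \<Rightarrow> nat list \<Rightarrow> nat list \<Rightarrow> (nat \<Rightarrow> nat) \<Rightarrow> complex" where
  "rho m \<alpha> \<beta> = (let n = sum_list \<alpha> - sum_list \<beta> in
     induced (sym_group (m * n)) (wreath_product m n) (\<lambda>p. skew_char \<alpha> \<beta> (wreath_top m n p)))"

end

theory Submission
  imports Defs "Jordan_Normal_Form.Schur_Decomposition" "Jordan_Normal_Form.Spectral_Radius"
begin

text \<open>Expanding the induction from the wreath product, \<open>\<rho>\<close> at \<open>g\<close> is \<open>1 / n!\<close> times the sum of
  \<open>\<chi> t\<close> over all pairs of a labelling \<open>l\<close> of the points by \<open>n\<close> labels, each used \<open>m\<close> times, and a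
  permutation \<open>t\<close> of the labels with \<open>l \<circ> g = t \<circ> l\<close>. Dividing by a sign character of degree
  \<open>b = n - k\<close> averages \<open>sign x\<close> times this over the permutations \<open>x\<close> of \<open>b\<close> extra points. If two
  of these points have the same label, composing \<open>x\<close> with their transposition cancels the summands
  of \<open>l\<close>; otherwise the extra points single out \<open>b\<close> labels, and what remains is a labelling of the
  other points with \<open>k\<close> fibres of size \<open>m\<close> and \<open>b\<close> fibres of size \<open>m - 1\<close>, on whose labels \<open>g\<close> acts by
  some \<open>t\<close> on the first \<open>k\<close> and by \<open>x\<close> on the last \<open>b\<close>, with weight \<open>sign x\<close> times the value of \<open>\<chi>\<close>
  at the juxtaposition of \<open>t\<close> and \<open>x\<close>. Restricting \<open>\<chi>\<close> to the product of the two symmetric groups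
  and absorbing the sign into the conjugate partitions gives the right-hand side.

  This uses that the characters labelled by partitions are well defined and form an orthonormal basis
  of the class functions. A trivial-isotypic projection for a Young subgroup and a sign-isotypic one
  for another have product zero when sandwiched around \<open>g\<close>, unless no two points share a row of the
  first and, after moving by \<open>g\<close>, a column of the second. This leaves one double coset for conjugate
  shapes, hence existence and uniqueness, and forces dominance in general, hence distinctness.
  Completeness follows because there are at most as many cycle types as partitions.\<close>

section \<open>Linear algebra and complex representations of finite groups\<close>

section \<open>Matrices\<close>

text \<open>Because \<open>irr_sym\<close> is a definite description, none of its values is
  accessible before existence and uniqueness hold for every shape. The quotient formula then draws
  on it only through completeness, the class function property, the sign twist for conjugate shapes
  and the values for a single column. Littlewood-Richardson coefficients are never computed: as
  multiplicities in induction products they are, by Frobenius reciprocity, the coefficients of a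
  partially averaged character, and completeness sums them up again. This turns skew characters and
  quotients into finite averages. The remaining point is the normalisation. On the left, each
  labelling with distinct labels at the extra points is reached k! times when the n! permutations of
  labels are applied to those where extra point i has label k + i; this turns 1 / n! into 1 / k!,
  and averaging over the extra points adds 1 / b!. On the right, k! and b! belong to the two
  inflated characters, and the order of the Young subgroup cancels because every labelling with the
  two fibre sizes is brought to standard position by exactly that many permutations.\<close>

lemma mat_mult_entry:
  assumes "A \<in> carrier_mat a b" "B \<in> carrier_mat b c" "i < a" "j < c"
  shows "(A * B) $$ (i, j) = (\<Sum>k = 0..<b. A $$ (i, k) * B $$ (k, j))"
  using assms by (auto simp: scalar_prod_def intro!: sum.cong)

lemma mat_mult_vec_entry:
  assumes "A \<in> carrier_mat a b" "v \<in> carrier_vec b" "i < a"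
  shows "(A *\<^sub>v v) $ i = (\<Sum>k = 0..<b. A $$ (i, k) * v $ k)"
  using assms by (auto simp: scalar_prod_def intro!: sum.cong)

lemma mat_trace_eq: "A \<in> carrier_mat d d \<Longrightarrow> mat_trace A = (\<Sum>i = 0..<d. A $$ (i, i))"
  by (auto simp: mat_trace_def diag_mat_def sum_list_distinct_conv_sum_set)

lemma mat_trace_comm:
  assumes "A \<in> carrier_mat a b" "B \<in> carrier_mat b a"
  shows "mat_trace (A * B) = mat_trace (B * A)"
proof -
  have "mat_trace (A * B) = (\<Sum>i = 0..<a. \<Sum>k = 0..<b. A $$ (i, k) * B $$ (k, i))"
    using assms by (subst mat_trace_eq[of _ a]) (auto simp: mat_mult_entry[of A a b B a] simp del: index_mult_mat(1) intro!: sum.cong)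
  also have "\<dots> = (\<Sum>k = 0..<b. \<Sum>i = 0..<a. B $$ (k, i) * A $$ (i, k))"
    by (subst sum.swap) (simp add: mult.commute)
  also have "\<dots> = mat_trace (B * A)"
    using assms by (subst mat_trace_eq[of _ b]) (auto simp: mat_mult_entry[of B b a A b] simp del: index_mult_mat(1) intro!: sum.cong)
  finally show ?thesis .
qed

text \<open>The dimensions are arguments so that the empty sum, too, has a definite size.\<close>

definition msum :: "nat \<Rightarrow> nat \<Rightarrow> ('i \<Rightarrow> complex mat) \<Rightarrow> 'i set \<Rightarrow> complex mat" where
  "msum nr nc F I = mat nr nc (\<lambda>ij. \<Sum>x\<in>I. F x $$ ij)"

lemma msum_carrier [simp, intro]: "msum nr nc F I \<in> carrier_mat nr nc"
  by (simp add: msum_def)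

lemma msum_dim [simp]: "dim_row (msum nr nc F I) = nr" "dim_col (msum nr nc F I) = nc"
  by (simp_all add: msum_def)

lemma msum_entry: "i < nr \<Longrightarrow> j < nc \<Longrightarrow> msum nr nc F I $$ (i, j) = (\<Sum>x\<in>I. F x $$ (i, j))"
  by (simp add: msum_def)

lemma msum_mult_left:
  assumes "A \<in> carrier_mat a b" "\<And>x. x \<in> I \<Longrightarrow> F x \<in> carrier_mat b c"
  shows "A * msum b c F I = msum a c (\<lambda>x. A * F x) I"
proof (rule eq_matI)
  fix i j assume "i < dim_row (msum a c (\<lambda>x. A * F x) I)" "j < dim_col (msum a c (\<lambda>x. A * F x) I)"
  then have ij: "i < a" "j < c" by auto
  have "(A * msum b c F I) $$ (i, j) = (\<Sum>k = 0..<b. \<Sum>x\<in>I. A $$ (i, k) * F x $$ (k, j))"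
    using assms ij by (simp add: mat_mult_entry[where b=b and c=c] msum_entry sum_distrib_left del: index_mult_mat(1))
  also have "\<dots> = (\<Sum>x\<in>I. (A * F x) $$ (i, j))"
    using assms ij by (subst sum.swap) (auto simp: mat_mult_entry[where b=b and c=c] simp del: index_mult_mat(1) intro!: sum.cong)
  finally show "(A * msum b c F I) $$ (i, j) = msum a c (\<lambda>x. A * F x) I $$ (i, j)"
    using ij by (simp add: msum_entry)
qed (use assms in auto)

lemma msum_mult_right:
  assumes "B \<in> carrier_mat b c" "\<And>x. x \<in> I \<Longrightarrow> F x \<in> carrier_mat a b"
  shows "msum a b F I * B = msum a c (\<lambda>x. F x * B) I"
proof (rule eq_matI)
  fix i j assume "i < dim_row (msum a c (\<lambda>x. F x * B) I)" "j < dim_col (msum a c (\<lambda>x. F x * B) I)"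
  then have ij: "i < a" "j < c" by auto
  have "(msum a b F I * B) $$ (i, j) = (\<Sum>k = 0..<b. \<Sum>x\<in>I. F x $$ (i, k) * B $$ (k, j))"
    using assms ij by (simp add: mat_mult_entry[where a=a and b=b and c=c] msum_entry sum_distrib_right del: index_mult_mat(1))
  also have "\<dots> = (\<Sum>x\<in>I. (F x * B) $$ (i, j))"
    using assms ij by (subst sum.swap) (auto simp: mat_mult_entry[where a=a and b=b and c=c] simp del: index_mult_mat(1) intro!: sum.cong)
  finally show "(msum a b F I * B) $$ (i, j) = msum a c (\<lambda>x. F x * B) I $$ (i, j)"
    using ij by (simp add: msum_entry)
qed (use assms in auto)

lemma msum_trace:
  assumes "\<And>x. x \<in> I \<Longrightarrow> F x \<in> carrier_mat d d"
  shows "mat_trace (msum d d F I) = (\<Sum>x\<in>I. mat_trace (F x))"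
proof -
  have "mat_trace (msum d d F I) = (\<Sum>i = 0..<d. \<Sum>x\<in>I. F x $$ (i, i))"
    by (simp add: mat_trace_eq[of _ d] msum_entry)
  also have "\<dots> = (\<Sum>x\<in>I. mat_trace (F x))"
    using assms by (subst sum.swap) (auto simp: mat_trace_eq[of _ d] intro!: sum.cong)
  finally show ?thesis .
qed

lemma msum_cong: "(\<And>x. x \<in> I \<Longrightarrow> F x = F' x) \<Longrightarrow> msum a b F I = msum a b F' I"
  by (simp add: msum_def cong: sum.cong)

lemma msum_reindex: "bij_betw h I J \<Longrightarrow> msum a b F J = msum a b (\<lambda>x. F (h x)) I"
  unfolding msum_def by (subst sum.reindex_bij_betw[symmetric, of h I J]) auto

lemma msum_smult:
  assumes "\<And>x. x \<in> I \<Longrightarrow> F x \<in> carrier_mat a b"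
  shows "msum a b (\<lambda>x. c \<cdot>\<^sub>m F x) I = c \<cdot>\<^sub>m msum a b F I"
proof (rule eq_matI)
  fix i j assume "i < dim_row (c \<cdot>\<^sub>m msum a b F I)" "j < dim_col (c \<cdot>\<^sub>m msum a b F I)"
  then have ij: "i < a" "j < b" by auto
  have *: "(c \<cdot>\<^sub>m F x) $$ (i, j) = c * F x $$ (i, j)" if "x \<in> I" for x
    using assms[OF that] ij by simp
  show "msum a b (\<lambda>x. c \<cdot>\<^sub>m F x) I $$ (i, j) = (c \<cdot>\<^sub>m msum a b F I) $$ (i, j)"
    using ij * by (simp add: msum_entry sum_distrib_left)
qed auto

lemma msum_smult_const:
  assumes "M \<in> carrier_mat a b" "\<And>x. x \<in> I \<Longrightarrow> F x = c x \<cdot>\<^sub>m M"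
  shows "msum a b F I = (\<Sum>x\<in>I. c x) \<cdot>\<^sub>m M"
proof (rule eq_matI)
  fix i j assume "i < dim_row ((\<Sum>x\<in>I. c x) \<cdot>\<^sub>m M)" "j < dim_col ((\<Sum>x\<in>I. c x) \<cdot>\<^sub>m M)"
  then have ij: "i < a" "j < b" using assms(1) by auto
  show "msum a b F I $$ (i, j) = ((\<Sum>x\<in>I. c x) \<cdot>\<^sub>m M) $$ (i, j)"
    using ij assms by (simp add: msum_entry sum_distrib_right)
qed (use assms in auto)

lemma mat_trace_smult: "A \<in> carrier_mat d d \<Longrightarrow> mat_trace (c \<cdot>\<^sub>m A) = c * mat_trace A"
  by (simp add: mat_trace_eq[of _ d] sum_distrib_left)

lemma mat_trace_one: "mat_trace (1\<^sub>m d) = of_nat d"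
  by (simp add: mat_trace_eq[of _ d])

lemma mat_trace_zero: "mat_trace (0\<^sub>m d d) = 0"
  by (simp add: mat_trace_eq[of _ d])

lemma mat_eq_zeroI:
  fixes A :: "complex mat"
  assumes "A \<in> carrier_mat a b" "\<And>v. v \<in> carrier_vec b \<Longrightarrow> A *\<^sub>v v = 0\<^sub>v a"
  shows "A = 0\<^sub>m a b"
proof (rule eq_matI)
  fix i j assume "i < dim_row (0\<^sub>m a b)" "j < dim_col (0\<^sub>m a b)"
  then have ij: "i < a" "j < b" by auto
  have "(A *\<^sub>v unit_vec b j) $ i = A $$ (i, j)"
    using assms(1) ij by simp
  then show "A $$ (i, j) = 0\<^sub>m a b $$ (i, j)"
    using assms(2)[of "unit_vec b j"] ij by simp
qed (use assms in auto)

lemma mat_inverse_exists: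
  fixes A :: "complex mat"
  assumes A: "A \<in> carrier_mat d d"
    and ker: "\<And>v. v \<in> carrier_vec d \<Longrightarrow> A *\<^sub>v v = 0\<^sub>v d \<Longrightarrow> v = 0\<^sub>v d"
  obtains B where "B \<in> carrier_mat d d" "A * B = 1\<^sub>m d" "B * A = 1\<^sub>m d"
proof -
  have "det A \<noteq> 0" using det_0_iff_vec_prod_zero_field[OF A] ker by blast
  then have "A \<in> Units (ring_mat TYPE(complex) d ())" by (rule det_non_zero_imp_unit[OF A])
  then show ?thesis using that unfolding Units_def ring_mat_def by auto
qed

text \<open>All eigenvalues lie in {0, c}, so the trace is c times the number of entries c on the
  diagonal of a triangular form. If there are none, that form is strictly upper triangular, and
  squaring it to c times itself with c nonzero forces it to vanish. This lets a trace, hence a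
  character sum, detect whether a symmetriser acts as zero.\<close>

lemma trace_nonzero_if_scaled_idempotent:
  fixes A :: "complex mat"
  assumes A: "A \<in> carrier_mat d d" and id: "A * A = c \<cdot>\<^sub>m A" and c: "c \<noteq> 0" and nz: "A \<noteq> 0\<^sub>m d d"
  shows "mat_trace A \<noteq> 0"
proof
  assume tr: "mat_trace A = 0"
  obtain es where "char_poly A = (\<Prod>a\<leftarrow>es. [:- a, 1:])" using char_poly_factorized[OF A] by blast
  then obtain B where B: "B \<in> carrier_mat d d" "upper_triangular B" "similar_mat A B"
    using schur_decomposition_exists[OF A] by blast
  then obtain P Q where "similar_mat_wit A B P Q" unfolding similar_mat_def by blast
  from similar_mat_witD2[OF A this]
  have PQ: "P \<in> carrier_mat d d" "Q \<in> carrier_mat d d" "P * Q = 1\<^sub>m d" "Q * P = 1\<^sub>m d" "A = P * B * Q"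
    by auto
  have BA: "B = Q * A * P"
  proof -
    have "Q * A * P = (Q * P) * B * (Q * P)"
      unfolding PQ(5) using PQ(1,2) B(1) by (simp add: assoc_mult_mat[of _ d d _ d _ d])
    then show ?thesis using PQ(4) B(1) by simp
  qed
  have BB: "B * B = c \<cdot>\<^sub>m B"
  proof -
    have "B * B = Q * A * (P * Q) * A * P"
      unfolding BA using PQ(1,2) A by (simp add: assoc_mult_mat[of _ d d _ d _ d])
    also have "\<dots> = Q * (A * A) * P"
      using PQ A by (simp add: assoc_mult_mat[of _ d d _ d _ d])
    also have "\<dots> = c \<cdot>\<^sub>m B"
      unfolding id BA using PQ(1,2) A
      by (simp add: mult_smult_distrib[of _ d d _ d] mult_smult_assoc_mat[of _ d d _ d])
    finally show ?thesis .
  qed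
  have entry: "c * B $$ (i, j) = (\<Sum>k = 0..<d. B $$ (i, k) * B $$ (k, j))" if "i < d" "j < d" for i j
    using arg_cong[OF BB, of "\<lambda>M. M $$ (i, j)"] that B(1) by (simp add: mat_mult_entry[of _ d d _ d] del: index_mult_mat(1))
  have lower: "B $$ (i, j) = 0" if "j < i" "i < d" for i j
    using B(1,2) that by auto
  have diag: "B $$ (i, i) = 0 \<or> B $$ (i, i) = c" if "i < d" for i
  proof -
    have "c * B $$ (i, i) = (\<Sum>k = 0..<d. if k = i then B $$ (i, i) * B $$ (i, i) else 0)"
      unfolding entry[OF that that]
      by (rule sum.cong) (use that lower in \<open>auto simp: neq_iff\<close>)
    then show ?thesis using that by auto
  qed
  have "mat_trace B = 0"
  proof -
    have "mat_trace B = mat_trace (Q * (A * P))" using BA PQ A by (simp add: assoc_mult_mat[of _ d d _ d _ d])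
    also have "\<dots> = mat_trace (A * P * Q)" using PQ A by (intro mat_trace_comm[of _ d d]) auto
    also have "\<dots> = mat_trace A" using PQ A by (simp add: assoc_mult_mat[of _ d d _ d _ d])
    finally show ?thesis using tr by simp
  qed
  moreover have "mat_trace B = c * of_nat (card {i. i < d \<and> B $$ (i, i) = c})"
  proof -
    have "mat_trace B = (\<Sum>i = 0..<d. if B $$ (i, i) = c then c else 0)"
      unfolding mat_trace_eq[OF B(1)] by (rule sum.cong) (use diag in auto)
    also have "\<dots> = (\<Sum>i | i \<in> {0..<d} \<and> B $$ (i, i) = c. c)"
      by (rule sum.inter_filter[symmetric]) simp
    finally show ?thesis by simp
  qed
  ultimately have "{i. i < d \<and> B $$ (i, i) = c} = {}" using c by (simp add: card_eq_0_iff)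
  then have diag0: "B $$ (i, i) = 0" if "i < d" for i using diag that by blast
  \<comment> \<open>Induction on the distance from the diagonal: in the expansion of the entry of
    \<open>B * B\<close>, every summand has a factor on or below the diagonal, or one strictly
    nearer to it.\<close>
  have "B $$ (i, j) = 0" if "i < d" "j < d" for i j
    using that
  proof (induction "j - i" arbitrary: i j rule: less_induct)
    case less
    have "B $$ (i, k) * B $$ (k, j) = 0" if "k < d" for k
    proof (cases "i < k \<and> k < j")
      case True
      then have "B $$ (i, k) = 0" using less that by auto
      then show ?thesis by simp
    next
      case False
      then have "k < i \<or> k = i \<or> j < k \<or> j = k" by linarith
      then show ?thesis using lower diag0 less.prems that by auto
    qed
    then have "c * B $$ (i, j) = 0" using entry[OF less.prems] by (simp add: sum.neutral)
    then show ?case using c by simp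
  qed
  then have "B = 0\<^sub>m d d" using B(1) by (intro eq_matI) auto
  then have "A = 0\<^sub>m d d" using PQ by simp
  then show False using nz by simp
qed

section \<open>Invariant subspaces\<close>

definition lin_subspace :: "nat \<Rightarrow> complex vec set \<Rightarrow> bool" where
  "lin_subspace d W \<longleftrightarrow> W \<subseteq> carrier_vec d \<and> 0\<^sub>v d \<in> W \<and>
     (\<forall>v\<in>W. \<forall>w\<in>W. v + w \<in> W) \<and> (\<forall>c. \<forall>v\<in>W. c \<cdot>\<^sub>v v \<in> W)"

lemma subspace_iff_lin_subspace:
  "VectorSpace.subspace class_ring W (module_vec TYPE(complex) d) \<longleftrightarrow> lin_subspace d W"
proof
  interpret vec_space "TYPE(complex)" d .
  assume "VectorSpace.subspace class_ring W (module_vec TYPE(complex) d)"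
  then have s: "submodule class_ring W (module_vec TYPE(complex) d)" by (simp add: VectorSpace.subspace_def)
  have c: "carrier (module_vec TYPE(complex) d) = carrier_vec d" "carrier class_ring = UNIV"
    by (simp_all add: module_vec_simps class_ring_simps)
  show "lin_subspace d W"
    unfolding lin_subspace_def
    using submodule.subset[OF s] submodule.m_closed[OF s] submodule.smult_closed[OF s]
      submodule.zero_closed[OF s] unfolding c
    by (auto simp: module_vec_simps)
next
  assume "lin_subspace d W"
  then show "VectorSpace.subspace class_ring W (module_vec TYPE(complex) d)"
    unfolding VectorSpace.subspace_def lin_subspace_def submodule_def
    using vec_module[where 'a = complex and n = d] vec_vs[where 'a = complex and n = d]
    by (auto simp: module_vec_simps class_ring_simps)
qed

lemma lin_subspace_mult_vec:
  assumes W: "lin_subspace d W" and S: "S \<in> carrier_mat d r" "\<And>j. j < r \<Longrightarrow> col S j \<in> W"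
    and v: "v \<in> carrier_vec r"
  shows "S *\<^sub>v v \<in> W"
proof -
  have "vec d (\<lambda>i. \<Sum>j = 0..<k. S $$ (i, j) * v $ j) \<in> W" if "k \<le> r" for k
    using that
  proof (induction k)
    case 0
    have "vec d (\<lambda>i. \<Sum>j = 0..<0. S $$ (i, j) * v $ j) = 0\<^sub>v d" by auto
    then show ?case using W by (simp add: lin_subspace_def)
  next
    case (Suc k)
    have "vec d (\<lambda>i. \<Sum>j = 0..<Suc k. S $$ (i, j) * v $ j) =
        vec d (\<lambda>i. \<Sum>j = 0..<k. S $$ (i, j) * v $ j) + v $ k \<cdot>\<^sub>v col S k"
      using S(1) Suc.prems by (intro eq_vecI) auto
    then show ?case using Suc W S(2)[of k] by (auto simp: lin_subspace_def)
  qed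
  from this[of r] have "vec d (\<lambda>i. \<Sum>j = 0..<r. S $$ (i, j) * v $ j) \<in> W" by simp
  moreover have "S *\<^sub>v v = vec d (\<lambda>i. \<Sum>j = 0..<r. S $$ (i, j) * v $ j)"
    using S(1) v by (intro eq_vecI) (auto simp: mat_mult_vec_entry[of _ d r] simp del: index_mult_mat_vec)
  ultimately show ?thesis by simp
qed

text \<open>Take r maximal such that some invertible \<open>S\<close> has its first r columns in
  \<open>W\<close>. A vector of \<open>W\<close> with a nonzero coordinate at a position i \<ge> r
  could be exchanged into column r, contradicting maximality; hence these columns span
  \<open>W\<close>.\<close>

lemma subspace_adapted_basis:
  assumes W: "lin_subspace d W"
  obtains r S S' where "r \<le> d" "S \<in> carrier_mat d d" "S' \<in> carrier_mat d d"
    "S * S' = 1\<^sub>m d" "S' * S = 1\<^sub>m d" "\<And>j. j < r \<Longrightarrow> col S j \<in> W"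
    "\<And>w i. w \<in> W \<Longrightarrow> r \<le> i \<Longrightarrow> i < d \<Longrightarrow> (S' *\<^sub>v w) $ i = 0"
proof -
  define P where "P r \<longleftrightarrow> r \<le> d \<and> (\<exists>S S'. S \<in> carrier_mat d d \<and> S' \<in> carrier_mat d d \<and>
     S * S' = 1\<^sub>m d \<and> S' * S = 1\<^sub>m d \<and> (\<forall>j<r. col S j \<in> W))" for r
  have "P 0" unfolding P_def by (auto intro!: exI[of _ "1\<^sub>m d"])
  moreover have "\<And>r. P r \<Longrightarrow> r \<le> d" by (simp add: P_def)
  ultimately obtain r where r: "P r" and rmax: "\<And>s. P s \<Longrightarrow> s \<le> r"
    using Nat.ex_has_greatest_nat[of P 0 d] by blast
  then obtain S S' where S: "r \<le> d" "S \<in> carrier_mat d d" "S' \<in> carrier_mat d d"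
    "S * S' = 1\<^sub>m d" "S' * S = 1\<^sub>m d" "\<And>j. j < r \<Longrightarrow> col S j \<in> W"
    unfolding P_def by blast
  have "(S' *\<^sub>v w) $ i = 0" if w: "w \<in> W" and i: "r \<le> i" "i < d" for w i
  proof (rule ccontr)
    define c where "c = S' *\<^sub>v w"
    assume "(S' *\<^sub>v w) $ i \<noteq> 0"
    then have ci: "c $ i \<noteq> 0" by (simp add: c_def)
    have wd: "w \<in> carrier_vec d" using w W by (auto simp: lin_subspace_def)
    have cd: "c \<in> carrier_vec d" using S(3) wd by (simp add: c_def)
    have Sc: "S *\<^sub>v c = w"
      unfolding c_def using S wd by (simp flip: assoc_mult_mat_vec[of _ d d _ d])
    \<comment> \<open>The exchange: column r becomes the coordinate vector of w, column i (if
      different) the unit vector of position r, and the others stay. It is invertible because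
      \<open>c $ i\<close> is nonzero.\<close>
    define E where "E = mat d d (\<lambda>(a, j). if j = r then c $ a else
        if j = i then (if a = r then 1 else 0) else if a = j then 1 else (0::complex))"
    have E: "E \<in> carrier_mat d d" by (simp add: E_def)
    have rd: "r < d" using i by simp
    have "v = 0\<^sub>v d" if v: "v \<in> carrier_vec d" and Ev: "E *\<^sub>v v = 0\<^sub>v d" for v
    proof -
      have ent: "(\<Sum>j = 0..<d. E $$ (a, j) * v $ j) = 0" if "a < d" for a
        using arg_cong[OF Ev, of "\<lambda>x. x $ a"] that mat_mult_vec_entry[OF E v that] by simp
      have "(\<Sum>j = 0..<d. E $$ (i, j) * v $ j) = (\<Sum>j = 0..<d. if j = r then c $ i * v $ r else 0)"
        by (rule sum.cong) (use i in \<open>auto simp: E_def\<close>)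
      then have vr: "v $ r = 0" using ent[OF i(2)] ci rd by simp
      have vi: "v $ i = 0"
      proof (cases "i = r")
        case False
        have "(\<Sum>j = 0..<d. E $$ (r, j) * v $ j) = (\<Sum>j = 0..<d. if j = i then v $ i else 0)"
          by (rule sum.cong) (use i rd vr False in \<open>auto simp: E_def\<close>)
        then show ?thesis using ent[OF rd] i by simp
      qed (use vr in simp)
      have "v $ a = 0" if "a < d" for a
      proof (cases "a = r \<or> a = i")
        case False
        have "(\<Sum>j = 0..<d. E $$ (a, j) * v $ j) = (\<Sum>j = 0..<d. if j = a then v $ a else 0)"
          by (rule sum.cong) (use i that rd vr vi False in \<open>auto simp: E_def\<close>)
        then show ?thesis using ent[OF that] that by simp
      qed (use vr vi in auto)
      then show ?thesis using v by (intro eq_vecI) auto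
    qed
    from mat_inverse_exists[OF E this] obtain E' where E':
      "E' \<in> carrier_mat d d" "E * E' = 1\<^sub>m d" "E' * E = 1\<^sub>m d" by blast
    have "(S * E) * (E' * S') = S * (E * E') * S'"
      using S(2,3) E E'(1) by (simp add: assoc_mult_mat[of _ d d _ d _ d])
    then have 1: "(S * E) * (E' * S') = 1\<^sub>m d" using E' S by simp
    have "(E' * S') * (S * E) = E' * (S' * S) * E"
      using S(2,3) E E'(1) by (simp add: assoc_mult_mat[of _ d d _ d _ d])
    then have 2: "(E' * S') * (S * E) = 1\<^sub>m d" using E' S E by simp
    have "col (S * E) j \<in> W" if "j < Suc r" for j
    proof (cases "j = r")
      case True
      have "col E r = c" using rd cd by (intro eq_vecI) (auto simp: E_def)
      then have "col (S * E) j = w" using True rd S(2) E Sc by (simp only: col_mult2[of _ d d _ d])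
      then show ?thesis using w by simp
    next
      case False
      then have j: "j < r" using that by simp
      have "col E j = unit_vec d j" using rd j i by (intro eq_vecI) (auto simp: E_def unit_vec_def)
      moreover have "S *\<^sub>v unit_vec d j = col S j"
        using S(2) j rd by (intro eq_vecI) auto
      moreover have "j < d" using j rd by simp
      ultimately have "col (S * E) j = col S j" using S(2) E by (simp only: col_mult2[of _ d d _ d])
      then show ?thesis using S(6) j by simp
    qed
    then have "P (Suc r)" unfolding P_def using 1 2 S(2,3) E E'(1) rd
      by (intro conjI exI[of _ "S * E"] exI[of _ "E' * S'"]) auto
    then show False using rmax by fastforce
  qed
  then show ?thesis using that S by blast
qed

lemma mat_mult_unit_vec_entry:
  fixes A :: "complex mat"
  shows "A \<in> carrier_mat a b \<Longrightarrow> i < a \<Longrightarrow> j < b \<Longrightarrow> (A *\<^sub>v unit_vec b j) $ i = A $$ (i, j)"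
  by simp

lemma mat_mult_zero_vec: "A \<in> carrier_mat a b \<Longrightarrow> A *\<^sub>v 0\<^sub>v b = (0\<^sub>v a :: complex vec)"
  by (intro eq_vecI) auto

section \<open>Representations of finite groups\<close>

definition mrep :: "('g, 'b) monoid_scheme \<Rightarrow> nat \<Rightarrow> ('g \<Rightarrow> complex mat) \<Rightarrow> bool" where
  "mrep G d R \<longleftrightarrow> (\<forall>g\<in>carrier G. R g \<in> carrier_mat d d) \<and>
     (\<forall>g\<in>carrier G. \<forall>h\<in>carrier G. R (g \<otimes>\<^bsub>G\<^esub> h) = R g * R h) \<and> R \<one>\<^bsub>G\<^esub> = 1\<^sub>m d"

lemma mrepD:
  assumes "mrep G d R"
  shows "g \<in> carrier G \<Longrightarrow> R g \<in> carrier_mat d d"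
    "g \<in> carrier G \<Longrightarrow> h \<in> carrier G \<Longrightarrow> R (g \<otimes>\<^bsub>G\<^esub> h) = R g * R h"
    "R \<one>\<^bsub>G\<^esub> = 1\<^sub>m d"
  using assms by (auto simp: mrep_def)

locale fin_group = group G for G (structure) +
  assumes fin: "finite (carrier G)"
begin

lemma mrep_inv:
  assumes "mrep G d R" "g \<in> carrier G"
  shows "R g * R (inv g) = 1\<^sub>m d" "R (inv g) * R g = 1\<^sub>m d"
  using mrepD(2)[OF assms(1), of g "inv g"] mrepD(2)[OF assms(1), of "inv g" g] mrepD(3)[OF assms(1)] assms(2)
  by simp_all

text \<open>A homomorphism into the invertible matrices maps the neutral element to an invertible
  idempotent, hence to the identity; conversely \<open>R (inv g)\<close> inverts
  \<open>R g\<close>.\<close>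

lemma mrep_iff_hom: "mrep G d R \<longleftrightarrow> R \<in> hom G (GL d)"
proof
  assume R: "mrep G d R"
  have "R g \<in> Units (ring_mat TYPE(complex) d ())" if "g \<in> carrier G" for g
    unfolding Units_def using mrep_inv[OF R that] mrepD(1)[OF R] that
    by (auto simp: ring_mat_def intro!: bexI[of _ "R (inv g)"])
  then show "R \<in> hom G (GL d)"
    using mrepD(2)[OF R] by (auto simp: hom_def GL_def units_of_def ring_mat_def)
next
  assume R: "R \<in> hom G (GL d)"
  have c: "R g \<in> Units (ring_mat TYPE(complex) d ())" if "g \<in> carrier G" for g
    using R that by (auto simp: hom_def GL_def units_of_def)
  then have c': "R g \<in> carrier_mat d d" if "g \<in> carrier G" for g
    using that by (auto simp: Units_def ring_mat_def)
  have m: "R (g \<otimes> h) = R g * R h" if "g \<in> carrier G" "h \<in> carrier G" for g h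
    using R that by (auto simp: hom_def GL_def units_of_def ring_mat_def)
  obtain B where B: "B \<in> carrier_mat d d" "B * R \<one> = 1\<^sub>m d"
    using c[OF one_closed] by (auto simp: Units_def ring_mat_def)
  have "R \<one> = B * R \<one> * R \<one>" using B left_mult_one_mat[OF c'[OF one_closed]] by simp
  also have "\<dots> = B * (R \<one> * R \<one>)" using B(1) c'[OF one_closed] by (simp add: assoc_mult_mat[of _ d d _ d _ d])
  also have "\<dots> = 1\<^sub>m d" using m[of \<one> \<one>] B by simp
  finally show "mrep G d R" using c' m by (simp add: mrep_def)
qed

definition invariant :: "('a \<Rightarrow> complex mat) \<Rightarrow> complex vec set \<Rightarrow> bool" where
  "invariant R W \<longleftrightarrow> (\<forall>g\<in>carrier G. \<forall>w\<in>W. R g *\<^sub>v w \<in> W)"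

lemma irreducible_rep_iff:
  "irreducible_rep G d R \<longleftrightarrow> mrep G d R \<and> d > 0 \<and>
     (\<forall>W. lin_subspace d W \<and> invariant R W \<longrightarrow> W = {0\<^sub>v d} \<or> W = carrier_vec d)"
  by (simp add: irreducible_rep_def mrep_iff_hom subspace_iff_lin_subspace invariant_def)

lemma irreducible_repD:
  assumes "irreducible_rep G d R"
  shows "mrep G d R" "d > 0"
    "\<And>W. lin_subspace d W \<Longrightarrow> invariant R W \<Longrightarrow> W = {0\<^sub>v d} \<or> W = carrier_vec d"
  using assms by (auto simp: irreducible_rep_iff)

lemma sum_split_shift:
  fixes f :: "nat \<Rightarrow> complex"
  assumes "r \<le> d"
  shows "(\<Sum>k = 0..<d. f k) = (\<Sum>k = 0..<r. f k) + (\<Sum>k = 0..<d - r. f (k + r))"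
proof -
  have "(\<Sum>k = r..<d. f k) = (\<Sum>k = 0..<d - r. f (k + r))"
    using sum.shift_bounds_nat_ivl[of f 0 r "d - r"] assms by simp
  then show ?thesis using sum.atLeastLessThan_concat[of 0 r d f] assms by simp
qed

text \<open>In a basis adapted to \<open>W\<close> the matrices are block upper triangular, and the
  diagonal blocks are the representations on \<open>W\<close> and on the quotient. As only traces
  are compared, no invariant complement has to be constructed.\<close>

lemma reducible_split:
  assumes R: "mrep G d R" and W: "lin_subspace d W" "invariant R W"
    and ne: "W \<noteq> {0\<^sub>v d}" "W \<noteq> carrier_vec d"
  obtains r s A D where "r < d" "s < d" "mrep G r A" "mrep G s D"
    "\<And>g. g \<in> carrier G \<Longrightarrow> mat_trace (R g) = mat_trace (A g) + mat_trace (D g)"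
proof -
  obtain r S S' where S: "r \<le> d" "S \<in> carrier_mat d d" "S' \<in> carrier_mat d d"
    "S * S' = 1\<^sub>m d" "S' * S = 1\<^sub>m d" "\<And>j. j < r \<Longrightarrow> col S j \<in> W"
    and S0: "\<And>w i. w \<in> W \<Longrightarrow> r \<le> i \<Longrightarrow> i < d \<Longrightarrow> (S' *\<^sub>v w) $ i = 0"
    using subspace_adapted_basis[OF W(1)] by metis
  have Wd: "W \<subseteq> carrier_vec d" "0\<^sub>v d \<in> W" using W(1) by (auto simp: lin_subspace_def)
  have SS': "S *\<^sub>v (S' *\<^sub>v w) = w" if "w \<in> carrier_vec d" for w
    using S that by (simp flip: assoc_mult_mat_vec[of _ d d _ d])
  have r0: "r > 0"
  proof (rule ccontr)
    assume "\<not> r > 0"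
    then have "S' *\<^sub>v w = 0\<^sub>v d" if "w \<in> W" for w
      using S0[OF that] S(3) by (intro eq_vecI) auto
    then have "w = 0\<^sub>v d" if "w \<in> W" for w
      using SS'[of w] that Wd mat_mult_zero_vec[OF S(2)] by auto
    then show False using ne(1) Wd(2) by blast
  qed
  have rd: "r < d"
  proof (rule ccontr)
    assume "\<not> r < d"
    then have "r = d" using S(1) by simp
    then have "S *\<^sub>v v \<in> W" if "v \<in> carrier_vec d" for v
      using lin_subspace_mult_vec[OF W(1) S(2)] S(6) that by blast
    then have "w \<in> W" if "w \<in> carrier_vec d" for w
      using SS'[OF that] that S(3) by (metis mult_mat_vec_carrier)
    then show False using ne(2) Wd(1) by blast
  qed
  define T where "T g = S' * R g * S" for g
  have Rc: "R g \<in> carrier_mat d d" if "g \<in> carrier G" for g using mrepD(1)[OF R that] .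
  have Tc: "T g \<in> carrier_mat d d" if "g \<in> carrier G" for g
    using Rc[OF that] S by (simp add: T_def)
  have Tm: "T (g \<otimes> h) = T g * T h" if "g \<in> carrier G" "h \<in> carrier G" for g h
  proof -
    have "T g * T h = S' * R g * (S * S') * R h * S"
      unfolding T_def using Rc[OF that(1)] Rc[OF that(2)] S(2,3)
      by (simp add: assoc_mult_mat[of _ d d _ d _ d])
    then show ?thesis using Rc[OF that(1)] Rc[OF that(2)] S(2-4) mrepD(2)[OF R that]
      by (simp add: T_def assoc_mult_mat[of _ d d _ d _ d])
  qed
  have T1: "T \<one> = 1\<^sub>m d" using S mrepD(3)[OF R] by (simp add: T_def)
  \<comment> \<open>In the adapted basis, invariance of \<open>W\<close> becomes the vanishing of
    the lower left block.\<close>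
  have T0: "T g $$ (i, j) = 0" if "g \<in> carrier G" "r \<le> i" "i < d" "j < r" for g i j
  proof -
    have "R g *\<^sub>v col S j \<in> W" using W(2) S(6)[OF that(4)] that(1) by (simp add: invariant_def)
    then have "(S' *\<^sub>v (R g *\<^sub>v col S j)) $ i = 0" using S0 that by simp
    moreover have "S' *\<^sub>v (R g *\<^sub>v col S j) = col (T g) j"
    proof -
      have "j < d" using that rd by simp
      moreover have "T g = S' * (R g * S)"
        unfolding T_def using Rc[OF that(1)] S(2,3) by (simp add: assoc_mult_mat[of _ d d _ d _ d])
      ultimately show ?thesis using Rc[OF that(1)] S(2,3)
        by (simp only: col_mult2[OF S(3) mult_carrier_mat[OF Rc[OF that(1)] S(2)]] col_mult2[OF Rc[OF that(1)] S(2)])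
    qed
    ultimately show ?thesis using Tc[OF that(1)] that rd by simp
  qed
  have Tmult: "T (g \<otimes> h) $$ (i, j) = (\<Sum>k = 0..<r. T g $$ (i, k) * T h $$ (k, j)) +
      (\<Sum>k = 0..<d - r. T g $$ (i, k + r) * T h $$ (k + r, j))"
    if "g \<in> carrier G" "h \<in> carrier G" "i < d" "j < d" for g h i j
    unfolding Tm[OF that(1,2)] mat_mult_entry[OF Tc[OF that(1)] Tc[OF that(2)] that(3,4)]
    by (rule sum_split_shift) (use rd in simp)
  define A where "A g = mat r r (\<lambda>ij. T g $$ ij)" for g
  define D where "D g = mat (d - r) (d - r) (\<lambda>(i, j). T g $$ (i + r, j + r))" for g
  have "mrep G r A"
    unfolding mrep_def
  proof (intro conjI ballI)
    fix g h assume gh: "g \<in> carrier G" "h \<in> carrier G"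
    show "A (g \<otimes> h) = A g * A h"
    proof (rule eq_matI)
      fix i j assume "i < dim_row (A g * A h)" "j < dim_col (A g * A h)"
      then have ij: "i < r" "j < r" by (auto simp: A_def)
      have "(\<Sum>k = 0..<d - r. T g $$ (i, k + r) * T h $$ (k + r, j)) = 0"
        using T0[OF gh(2)] ij by (intro sum.neutral) auto
      then have "A (g \<otimes> h) $$ (i, j) = (\<Sum>k = 0..<r. T g $$ (i, k) * T h $$ (k, j))"
        using Tmult[OF gh, of i j] ij rd by (simp add: A_def)
      also have "\<dots> = (A g * A h) $$ (i, j)"
        using ij by (subst mat_mult_entry[of _ r r _ r]) (auto simp: A_def)
      finally show "A (g \<otimes> h) $$ (i, j) = (A g * A h) $$ (i, j)" .
    qed (auto simp: A_def)
  next
    show "A \<one> = 1\<^sub>m r" unfolding A_def T1 using rd by (intro eq_matI) auto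
  qed (auto simp: A_def)
  moreover have "mrep G (d - r) D"
    unfolding mrep_def
  proof (intro conjI ballI)
    fix g h assume gh: "g \<in> carrier G" "h \<in> carrier G"
    show "D (g \<otimes> h) = D g * D h"
    proof (rule eq_matI)
      fix i j assume "i < dim_row (D g * D h)" "j < dim_col (D g * D h)"
      then have ij: "i < d - r" "j < d - r" by (auto simp: D_def)
      have "(\<Sum>k = 0..<r. T g $$ (i + r, k) * T h $$ (k, j + r)) = 0"
        using T0[OF gh(1)] ij by (intro sum.neutral) auto
      then have "D (g \<otimes> h) $$ (i, j) =
          (\<Sum>k = 0..<d - r. T g $$ (i + r, k + r) * T h $$ (k + r, j + r))"
        using Tmult[OF gh, of "i + r" "j + r"] ij rd by (simp add: D_def)
      also have "\<dots> = (D g * D h) $$ (i, j)"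
        using ij by (subst mat_mult_entry[of _ "d - r" "d - r" _ "d - r"]) (auto simp: D_def)
      finally show "D (g \<otimes> h) $$ (i, j) = (D g * D h) $$ (i, j)" .
    qed (auto simp: D_def)
  next
    show "D \<one> = 1\<^sub>m (d - r)" unfolding D_def T1 using rd by (intro eq_matI) auto
  qed (auto simp: D_def)
  moreover have "mat_trace (R g) = mat_trace (A g) + mat_trace (D g)" if "g \<in> carrier G" for g
  proof -
    have "mat_trace (T g) = mat_trace (S * (S' * R g))"
      unfolding T_def using S(2,3) Rc[OF that] by (intro mat_trace_comm[of _ d d]) auto
    also have "S * (S' * R g) = R g"
      using S(2-4) Rc[OF that] by (simp flip: assoc_mult_mat[of _ d d _ d _ d])
    finally have "mat_trace (R g) = (\<Sum>i = 0..<d. T g $$ (i, i))"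
      using mat_trace_eq[OF Tc[OF that]] by simp
    also have "\<dots> = (\<Sum>i = 0..<r. T g $$ (i, i)) + (\<Sum>i = 0..<d - r. T g $$ (i + r, i + r))"
      by (rule sum_split_shift) (use rd in simp)
    also have "\<dots> = mat_trace (A g) + mat_trace (D g)"
      by (subst (1 2) mat_trace_eq) (auto simp: A_def D_def)
    finally show ?thesis .
  qed
  ultimately show ?thesis using that[of r "d - r" A D] r0 rd by simp
qed

text \<open>Pairing with \<open>f\<close> is additive over the two diagonal blocks of a reducible
  representation, so it stays nonzero on one of them, which has smaller degree.\<close>

lemma irreducible_constituent:
  assumes "mrep G d R" "(\<Sum>g\<in>carrier G. f g * mat_trace (R g)) \<noteq> 0"
  shows "\<exists>e Q. irreducible_rep G e Q \<and> (\<Sum>g\<in>carrier G. f g * mat_trace (Q g)) \<noteq> 0"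
  using assms
proof (induction d arbitrary: R rule: less_induct)
  case (less d)
  show ?case
  proof (cases "irreducible_rep G d R")
    case True
    then show ?thesis using less.prems by blast
  next
    case False
    have "d > 0"
    proof (rule ccontr)
      assume "\<not> d > 0"
      then have "mat_trace (R g) = 0" if "g \<in> carrier G" for g
        using mat_trace_eq[OF mrepD(1)[OF less.prems(1) that]] by simp
      then show False using less.prems(2) by simp
    qed
    then obtain W where W: "lin_subspace d W" "invariant R W" "W \<noteq> {0\<^sub>v d}" "W \<noteq> carrier_vec d"
      using False less.prems(1) by (auto simp: irreducible_rep_iff)
    obtain r s A D where rs: "r < d" "s < d" "mrep G r A" "mrep G s D"
      "\<And>g. g \<in> carrier G \<Longrightarrow> mat_trace (R g) = mat_trace (A g) + mat_trace (D g)"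
      using reducible_split[OF less.prems(1) W] by metis
    have "(\<Sum>g\<in>carrier G. f g * mat_trace (R g)) =
        (\<Sum>g\<in>carrier G. f g * mat_trace (A g)) + (\<Sum>g\<in>carrier G. f g * mat_trace (D g))"
      by (simp add: rs(5) distrib_left sum.distrib)
    then have "(\<Sum>g\<in>carrier G. f g * mat_trace (A g)) \<noteq> 0 \<or> (\<Sum>g\<in>carrier G. f g * mat_trace (D g)) \<noteq> 0"
      using less.prems(2) by auto
    then show ?thesis using less.IH rs(1-4) by blast
  qed
qed

text \<open>Permutation matrices of left multiplication; only the neutral element has fixed
  points.\<close>

lemma regular_rep:
  obtains R where "mrep G (Coset.order G) R"
    "\<And>g. g \<in> carrier G \<Longrightarrow> mat_trace (R g) = (if g = \<one> then of_nat (Coset.order G) else 0)"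
proof -
  define N where "N = Coset.order G"
  obtain h where h: "bij_betw h {0..<N} (carrier G)"
    using ex_bij_betw_nat_finite[OF fin] by (auto simp: N_def Coset.order_def)
  have hc: "h i \<in> carrier G" if "i < N" for i
    using bij_betwE[OF h] that by auto
  have hinj: "h i = h j \<longleftrightarrow> i = j" if "i < N" "j < N" for i j
    using bij_betw_imp_inj_on[OF h] that by (auto dest: inj_onD)
  define R where "R g = mat N N (\<lambda>(i, j). if g \<otimes> h j = h i then 1 else (0::complex))" for g
  have "mrep G N R"
    unfolding mrep_def
  proof (intro conjI ballI)
    fix g g' assume g: "g \<in> carrier G" "g' \<in> carrier G"
    show "R (g \<otimes> g') = R g * R g'"
    proof (rule eq_matI)
      fix i j assume "i < dim_row (R g * R g')" "j < dim_col (R g * R g')"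
      then have ij: "i < N" "j < N" by (auto simp: R_def)
      have "g' \<otimes> h j \<in> carrier G" using g hc[OF ij(2)] by simp
      then obtain k where k: "k < N" "h k = g' \<otimes> h j"
        using bij_betw_imp_surj_on[OF h] by (metis atLeastLessThan_iff imageE)
      have "(R g * R g') $$ (i, j) = (\<Sum>l = 0..<N. R g $$ (i, l) * R g' $$ (l, j))"
        using ij by (intro mat_mult_entry[of _ N N _ N]) (auto simp: R_def)
      also have "\<dots> = (\<Sum>l = 0..<N. if l = k then R g $$ (i, k) else 0)"
        using ij k hinj by (intro sum.cong) (auto simp: R_def simp flip: k(2))
      also have "\<dots> = R g $$ (i, k)" using k by simp
      also have "\<dots> = R (g \<otimes> g') $$ (i, j)"
        using ij k g hc[OF ij(2)] by (simp add: R_def m_assoc)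
      finally show "R (g \<otimes> g') $$ (i, j) = (R g * R g') $$ (i, j)" by simp
    qed (auto simp: R_def)
  next
    show "R \<one> = 1\<^sub>m N" unfolding R_def using hc hinj by (intro eq_matI) auto
  qed (auto simp: R_def)
  moreover have "mat_trace (R g) = (if g = \<one> then of_nat N else 0)" if "g \<in> carrier G" for g
  proof -
    have "mat_trace (R g) = (\<Sum>i = 0..<N. if g = \<one> then 1 else 0)"
      unfolding R_def using that hc
      by (subst mat_trace_eq[of _ N]) (auto intro!: sum.cong simp: l_cancel_one)
    then show ?thesis by simp
  qed
  ultimately show ?thesis using that by (simp add: N_def)
qed

text \<open>The regular character vanishes off the neutral element, so pairing it with
  \<open>f\<close> gives \<open>f \<one>\<close> times the group order, and some irreducible
  constituent must contribute.\<close>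

lemma irreducible_rep_detecting:
  assumes "f \<one> \<noteq> 0"
  obtains d R where "irreducible_rep G d R" "(\<Sum>g\<in>carrier G. f g * mat_trace (R g)) \<noteq> 0"
proof -
  obtain R where R: "mrep G (Coset.order G) R"
    "\<And>g. g \<in> carrier G \<Longrightarrow> mat_trace (R g) = (if g = \<one> then of_nat (Coset.order G) else 0)"
    using regular_rep by metis
  have "(\<Sum>g\<in>carrier G. f g * mat_trace (R g)) = (\<Sum>g\<in>carrier G. if g = \<one> then f \<one> * of_nat (Coset.order G) else 0)"
    by (rule sum.cong) (auto simp: R(2))
  also have "\<dots> = f \<one> * of_nat (Coset.order G)" using fin by simp
  also have "\<dots> \<noteq> 0" using assms fin order_gt_0_iff_finite by auto
  finally show ?thesis using irreducible_constituent[OF R(1)] that by blast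
qed

text \<open>The vectors killed by all \<open>A * R g\<close> form an invariant subspace. If every
  product vanished, this subspace would contain the image of \<open>B\<close>; it cannot be zero
  since \<open>B\<close> is not, and it cannot be everything since g = \<one> would give
  \<open>A\<close> = 0. The applications take a row symmetriser for \<open>A\<close> and a column
  symmetriser for \<open>B\<close>.\<close>

lemma irreducible_rep_product_nonzero:
  assumes R: "irreducible_rep G d R" and A: "A \<in> carrier_mat a d" "A \<noteq> 0\<^sub>m a d"
    and B: "B \<in> carrier_mat d b" "B \<noteq> 0\<^sub>m d b"
  shows "\<exists>g\<in>carrier G. A * R g * B \<noteq> 0\<^sub>m a b"
proof (rule ccontr)
  assume "\<not> ?thesis"
  then have z: "A * R g * B = 0\<^sub>m a b" if "g \<in> carrier G" for g using that by blast
  note rep = irreducible_repD(1)[OF R]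
  note Rc = mrepD(1)[OF rep]
  define W where "W = {w \<in> carrier_vec d. \<forall>g\<in>carrier G. (A * R g) *\<^sub>v w = 0\<^sub>v a}"
  have ARc: "A * R g \<in> carrier_mat a d" if "g \<in> carrier G" for g using A(1) Rc[OF that] by auto
  have "lin_subspace d W"
    unfolding lin_subspace_def W_def using mat_mult_zero_vec[OF ARc]
    by (auto simp: mult_add_distrib_mat_vec[OF ARc] mult_mat_vec[OF ARc])
  moreover have "invariant R W"
    unfolding invariant_def W_def
  proof (intro ballI CollectI conjI)
    fix g w assume g: "g \<in> carrier G" and w: "w \<in> {w \<in> carrier_vec d. \<forall>g\<in>carrier G. (A * R g) *\<^sub>v w = 0\<^sub>v a}"
    then have wd: "w \<in> carrier_vec d" by simp
    then show "R g *\<^sub>v w \<in> carrier_vec d" using Rc[OF g] by (auto intro: mult_mat_vec_carrier)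
    fix h assume h: "h \<in> carrier G"
    have "(A * R h) *\<^sub>v (R g *\<^sub>v w) = (A * R h * R g) *\<^sub>v w"
      by (rule assoc_mult_mat_vec[OF ARc[OF h] Rc[OF g] wd, symmetric])
    also have "A * R h * R g = A * R (h \<otimes> g)"
      unfolding mrepD(2)[OF rep h g] by (rule assoc_mult_mat[OF A(1) Rc[OF h] Rc[OF g]])
    finally show "(A * R h) *\<^sub>v (R g *\<^sub>v w) = 0\<^sub>v a" using w g h by auto
  qed
  ultimately consider "W = {0\<^sub>v d}" | "W = carrier_vec d" using irreducible_repD(3)[OF R] by blast
  then show False
  proof cases
    case 1
    have "B = 0\<^sub>m d b"
    proof (rule mat_eq_zeroI[OF B(1)])
      fix v :: "complex vec" assume v: "v \<in> carrier_vec b"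
      have "(A * R g) *\<^sub>v (B *\<^sub>v v) = 0\<^sub>v a" if g: "g \<in> carrier G" for g
      proof -
        have "0\<^sub>m a b *\<^sub>v v = 0\<^sub>v a" using v by (intro eq_vecI) auto
        then show ?thesis using assoc_mult_mat_vec[OF ARc[OF g] B(1) v] z[OF g] by simp
      qed
      then have "B *\<^sub>v v \<in> W" using B(1) v by (auto simp: W_def)
      then show "B *\<^sub>v v = 0\<^sub>v d" using 1 by simp
    qed
    then show ?thesis using B by simp
  next
    case 2
    have "A = 0\<^sub>m a d"
    proof (rule mat_eq_zeroI[OF A(1)])
      fix v :: "complex vec" assume "v \<in> carrier_vec d"
      then have "(A * R \<one>) *\<^sub>v v = 0\<^sub>v a" using 2 by (auto simp: W_def)
      then show "A *\<^sub>v v = 0\<^sub>v a" using mrepD(3)[OF rep] A(1) by simp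
    qed
    then show ?thesis using A by simp
  qed
qed

section \<open>Schur's lemma and orthogonality\<close>

text \<open>Kernel and image of a nonzero intertwiner are invariant, so it is bijective, and
  conjugating by it would equate the traces. The representations are told apart by a trace because
  distinct characters are what the applications provide.\<close>

lemma schur_zero:
  assumes R: "irreducible_rep G d R" and Q: "irreducible_rep G e Q"
    and T: "T \<in> carrier_mat d e" and comm: "\<And>g. g \<in> carrier G \<Longrightarrow> R g * T = T * Q g"
    and g0: "g0 \<in> carrier G" "mat_trace (R g0) \<noteq> mat_trace (Q g0)"
  shows "T = 0\<^sub>m d e"
proof (rule ccontr)
  assume nz: "T \<noteq> 0\<^sub>m d e"
  note rR = irreducible_repD(1)[OF R] and rQ = irreducible_repD(1)[OF Q]
  note cR = mrepD(1)[OF rR] and cQ = mrepD(1)[OF rQ]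
  have commv: "R g *\<^sub>v (T *\<^sub>v v) = T *\<^sub>v (Q g *\<^sub>v v)" if "g \<in> carrier G" "v \<in> carrier_vec e" for g v
    using comm[OF that(1)] cR[OF that(1)] cQ[OF that(1)] T that(2)
    by (metis assoc_mult_mat_vec)
  define K where "K = {v \<in> carrier_vec e. T *\<^sub>v v = 0\<^sub>v d}"
  have "lin_subspace e K" unfolding lin_subspace_def K_def using T
    by (auto simp: mult_add_distrib_mat_vec[of _ _ e] mult_mat_vec[of _ _ e])
  moreover have "invariant Q K" unfolding invariant_def K_def
    using cQ mat_mult_zero_vec[OF cR] by (auto intro: mult_mat_vec_carrier simp flip: commv)
  ultimately have "K = {0\<^sub>v e} \<or> K = carrier_vec e" using irreducible_repD(3)[OF Q] by blast
  moreover have "K \<noteq> carrier_vec e" using nz mat_eq_zeroI[OF T] by (auto simp: K_def)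
  ultimately have K: "K = {0\<^sub>v e}" by blast
  define I where "I = (\<lambda>v. T *\<^sub>v v) ` carrier_vec e"
  have "lin_subspace d I" unfolding lin_subspace_def
  proof (intro conjI ballI allI)
    show "I \<subseteq> carrier_vec d" using T by (auto simp: I_def)
    show "0\<^sub>v d \<in> I" unfolding I_def using T by (auto intro!: image_eqI[of _ _ "0\<^sub>v e"])
    show "v + w \<in> I" if vw: "v \<in> I" "w \<in> I" for v w
    proof -
      from vw obtain v' w' where "v' \<in> carrier_vec e" "w' \<in> carrier_vec e" "v = T *\<^sub>v v'" "w = T *\<^sub>v w'"
        by (auto simp: I_def)
      then show ?thesis unfolding I_def using T
        by (intro image_eqI[of _ _ "v' + w'"]) (auto simp: mult_add_distrib_mat_vec[of _ _ e])
    qed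
    show "c \<cdot>\<^sub>v v \<in> I" if v: "v \<in> I" for c v
    proof -
      from v obtain v' where "v' \<in> carrier_vec e" "v = T *\<^sub>v v'"  by (auto simp: I_def)
      then show ?thesis unfolding I_def using T
        by (intro image_eqI[of _ _ "c \<cdot>\<^sub>v v'"]) (auto simp: mult_mat_vec[of _ _ e])
    qed
  qed
  moreover have "invariant R I" unfolding invariant_def I_def
    using cQ commv by (auto simp: mult_mat_vec_carrier[of _ e e])
  ultimately have "I = {0\<^sub>v d} \<or> I = carrier_vec d" using irreducible_repD(3)[OF R] by blast
  moreover have "I \<noteq> {0\<^sub>v d}" using nz mat_eq_zeroI[OF T] by (auto simp: I_def)
  ultimately have I: "I = carrier_vec d" by blast
  \<comment> \<open>Preimages of the unit vectors form the columns of a right inverse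
    \<open>S\<close>; the trivial kernel makes it a left inverse as well, although d and e are not
    known to agree.\<close>
  have "\<exists>v. v \<in> carrier_vec e \<and> T *\<^sub>v v = unit_vec d j" for j
    using I by (metis I_def imageE unit_vec_carrier)
  then obtain s where s: "\<And>j. s j \<in> carrier_vec e" "\<And>j. T *\<^sub>v s j = unit_vec d j" by metis
  define S where "S = mat e d (\<lambda>(i, j). s j $ i)"
  have Sc: "S \<in> carrier_mat e d" by (simp add: S_def)
  have colS: "col S j = s j" if "j < d" for j
    using that s(1)[of j] by (intro eq_vecI) (auto simp: S_def)
  have TS: "T * S = 1\<^sub>m d"
  proof (rule eq_matI)
    fix i j assume "i < dim_row (1\<^sub>m d)" "j < dim_col (1\<^sub>m d)"
    then have ij: "i < d" "j < d" by auto
    have "(T * S) $$ (i, j) = (T *\<^sub>v s j) $ i"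
      using ij T Sc colS[OF ij(2)] by simp
    then show "(T * S) $$ (i, j) = 1\<^sub>m d $$ (i, j)" using s(2) ij by (simp add: unit_vec_def)
  qed (use T Sc in auto)
  have ST: "S * T = 1\<^sub>m e"
  proof -
    have "S *\<^sub>v (T *\<^sub>v v) = v" if v: "v \<in> carrier_vec e" for v
    proof -
      have c: "S *\<^sub>v (T *\<^sub>v v) \<in> carrier_vec e" using Sc T v by auto
      have "T *\<^sub>v (S *\<^sub>v (T *\<^sub>v v)) = (T * S) *\<^sub>v (T *\<^sub>v v)"
        using T Sc v by (subst assoc_mult_mat_vec[of _ d e _ d]) auto
      then have "T *\<^sub>v (S *\<^sub>v (T *\<^sub>v v)) = T *\<^sub>v v" using TS T v by simp
      then have "T *\<^sub>v (S *\<^sub>v (T *\<^sub>v v) - v) = 0\<^sub>v d"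
        using T c v by (simp add: mult_minus_distrib_mat_vec[of _ d e])
      then have "S *\<^sub>v (T *\<^sub>v v) - v \<in> K" using c v by (simp add: K_def)
      then have 0: "S *\<^sub>v (T *\<^sub>v v) - v = 0\<^sub>v e" using K by simp
      show ?thesis
      proof (rule eq_vecI)
        fix i assume "i < dim_vec v"
        then show "(S *\<^sub>v (T *\<^sub>v v)) $ i = v $ i"
          using arg_cong[OF 0, of "\<lambda>x. x $ i"] c v by simp
      qed (use Sc v in simp)
    qed
    then have "(S * T) *\<^sub>v unit_vec e j = unit_vec e j" for j
      using Sc T by (simp add: assoc_mult_mat_vec[of _ e d _ e])
    note this
    have "(S * T) $$ (i, j) = 1\<^sub>m e $$ (i, j)" if "i < e" "j < e" for i j
    proof -
      have "(S * T) $$ (i, j) = ((S * T) *\<^sub>v unit_vec e j) $ i"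
        using that Sc T by (intro mat_mult_unit_vec_entry[symmetric, of _ e e]) auto
      then show ?thesis using \<open>(S * T) *\<^sub>v unit_vec e j = unit_vec e j\<close> that by (simp add: unit_vec_def)
    qed
    then show ?thesis using Sc T by (intro eq_matI) auto
  qed
  have "mat_trace (R g0) = mat_trace (R g0 * T * S)"
    using cR[OF g0(1)] T Sc TS by (simp add: assoc_mult_mat[of _ d d _ e _ d])
  also have "\<dots> = mat_trace (T * (Q g0 * S))"
    using comm[OF g0(1)] cQ[OF g0(1)] T Sc by (simp add: assoc_mult_mat[of _ d e _ e _ d])
  also have "\<dots> = mat_trace (Q g0 * S * T)"
    using cQ[OF g0(1)] T Sc by (intro mat_trace_comm) auto
  also have "\<dots> = mat_trace (Q g0)"
    using cQ[OF g0(1)] T Sc ST by (simp add: assoc_mult_mat[of _ e e _ d _ e])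
  finally show False using g0(2) by simp
qed

text \<open>An eigenspace of \<open>T\<close> is a nonzero invariant subspace, hence everything; the
  scalar is recovered from the trace.\<close>

lemma schur_scalar:
  assumes R: "irreducible_rep G d R"
    and T: "T \<in> carrier_mat d d" and comm: "\<And>g. g \<in> carrier G \<Longrightarrow> R g * T = T * R g"
  shows "T = (mat_trace T / of_nat d) \<cdot>\<^sub>m 1\<^sub>m d"
proof -
  note rR = irreducible_repD(1)[OF R]
  note cR = mrepD(1)[OF rR] 
  have d: "d > 0" using irreducible_repD(2)[OF R] .
  obtain c where "c \<in> spectrum T" using spectrum_non_empty[OF T d] by blast
  then obtain v0 where v0: "v0 \<in> carrier_vec d" "v0 \<noteq> 0\<^sub>v d" "T *\<^sub>v v0 = c \<cdot>\<^sub>v v0"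
    using T by (auto simp: spectrum_def eigenvalue_def eigenvector_def)
  define W where "W = {v \<in> carrier_vec d. T *\<^sub>v v = c \<cdot>\<^sub>v v}"
  have "lin_subspace d W" unfolding lin_subspace_def W_def using T
    by (auto simp: mult_add_distrib_mat_vec[of _ d d] mult_mat_vec[of _ d d] smult_add_distrib_vec[of _ d]
        smult_smult_assoc mult.commute)
  moreover have "invariant R W" unfolding invariant_def W_def
  proof (intro ballI CollectI conjI)
    fix g w assume g: "g \<in> carrier G" and w: "w \<in> {v \<in> carrier_vec d. T *\<^sub>v v = c \<cdot>\<^sub>v v}"
    then show "R g *\<^sub>v w \<in> carrier_vec d" using cR by (auto intro: mult_mat_vec_carrier)
    have "T *\<^sub>v (R g *\<^sub>v w) = R g *\<^sub>v (T *\<^sub>v w)"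
      using comm[OF g] cR[OF g] T w by (metis (no_types, lifting) assoc_mult_mat_vec mem_Collect_eq)
    then show "T *\<^sub>v (R g *\<^sub>v w) = c \<cdot>\<^sub>v (R g *\<^sub>v w)"
      using w cR[OF g] by (auto simp: mult_mat_vec[of _ d d])
  qed
  ultimately have "W = {0\<^sub>v d} \<or> W = carrier_vec d" using irreducible_repD(3)[OF R] by blast
  moreover have "v0 \<in> W" using v0 by (simp add: W_def)
  ultimately have W: "W = carrier_vec d" using v0 by auto
  have Tc: "T = c \<cdot>\<^sub>m 1\<^sub>m d"
  proof (rule eq_matI)
    fix i j assume "i < dim_row (c \<cdot>\<^sub>m 1\<^sub>m d)" "j < dim_col (c \<cdot>\<^sub>m 1\<^sub>m d)"
    then have ij: "i < d" "j < d" by auto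
    have "unit_vec d j \<in> W" using W by simp
    then have "(T *\<^sub>v unit_vec d j) $ i = (c \<cdot>\<^sub>v unit_vec d j) $ i" by (simp add: W_def)
    then show "T $$ (i, j) = (c \<cdot>\<^sub>m 1\<^sub>m d) $$ (i, j)" using ij T by simp
  qed (use T in auto)
  then have "mat_trace T = c * of_nat d" by (simp add: mat_trace_smult[of _ d] mat_trace_one)
  then show ?thesis using Tc d by simp
qed

text \<open>Summing the translates of an arbitrary matrix \<open>X\<close> over the group yields an
  intertwiner from \<open>Q\<close> to \<open>R\<close>, to which Schur's lemma applies.\<close>

definition intertwine :: "nat \<Rightarrow> nat \<Rightarrow> ('a \<Rightarrow> complex mat) \<Rightarrow> ('a \<Rightarrow> complex mat) \<Rightarrow> complex mat \<Rightarrow> complex mat" where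
  "intertwine d e R Q X = msum d e (\<lambda>g. R g * X * Q (inv g)) (carrier G)"

lemma cancel_inv:
  assumes "x \<in> carrier G" "y \<in> carrier G"
  shows "inv x \<otimes> (x \<otimes> y) = y" "x \<otimes> (inv x \<otimes> y) = y"
  using assms by (simp_all flip: m_assoc)

lemma bij_left_mult: "h \<in> carrier G \<Longrightarrow> bij_betw (\<lambda>g. h \<otimes> g) (carrier G) (carrier G)"
  by (rule bij_betw_byWitness[where f' = "\<lambda>g. inv h \<otimes> g"]) (auto simp: cancel_inv)

lemma bij_right_mult: "h \<in> carrier G \<Longrightarrow> bij_betw (\<lambda>g. g \<otimes> h) (carrier G) (carrier G)"
  by (rule bij_betw_byWitness[where f' = "\<lambda>g. g \<otimes> inv h"]) (auto simp: m_assoc cancel_inv)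

lemma bij_conj: "h \<in> carrier G \<Longrightarrow> bij_betw (\<lambda>g. h \<otimes> g \<otimes> inv h) (carrier G) (carrier G)"
  by (rule bij_betw_byWitness[where f' = "\<lambda>g. inv h \<otimes> g \<otimes> h"])
    (auto simp: m_assoc cancel_inv)

lemma intertwine_comm:
  assumes R: "mrep G d R" and Q: "mrep G e Q" and X: "X \<in> carrier_mat d e" and h: "h \<in> carrier G"
  shows "R h * intertwine d e R Q X = intertwine d e R Q X * Q h"
proof -
  note cR = mrepD(1)[OF R] and cQ = mrepD(1)[OF Q]
  have RXQ: "R g * X * Q (inv g) \<in> carrier_mat d e" if "g \<in> carrier G" for g
    using cR[OF that] X cQ[of "inv g"] that by auto
  have "R h * intertwine d e R Q X = msum d e (\<lambda>g. R h * (R g * X * Q (inv g))) (carrier G)"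
    unfolding intertwine_def using cR[OF h] RXQ by (rule msum_mult_left)
  also have "\<dots> = msum d e (\<lambda>g. R (h \<otimes> g) * X * Q (inv (h \<otimes> g)) * Q h) (carrier G)"
  proof (rule msum_cong)
    fix g assume g: "g \<in> carrier G"
    have "Q (inv (h \<otimes> g)) * Q h = Q (inv g)"
      using g h mrepD(2)[OF Q, of "inv (h \<otimes> g)" h] by (simp add: inv_mult_group m_assoc)
    moreover have "R (h \<otimes> g) * X * Q (inv (h \<otimes> g)) * Q h = R (h \<otimes> g) * X * (Q (inv (h \<otimes> g)) * Q h)"
      using g h by (intro assoc_mult_mat[of _ d e _ e _ e] mult_carrier_mat[OF cR X] cQ) auto
    ultimately show "R h * (R g * X * Q (inv g)) = R (h \<otimes> g) * X * Q (inv (h \<otimes> g)) * Q h"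
      using g h X cR[OF h] cR[OF g] cQ[of "inv g"] mrepD(2)[OF R h g]
      by (simp add: assoc_mult_mat[of _ d d _ d _ e] assoc_mult_mat[of _ d d _ e _ e])
  qed
  also have "\<dots> = msum d e (\<lambda>g. R g * X * Q (inv g) * Q h) (carrier G)"
    by (rule msum_reindex[symmetric, OF bij_left_mult[OF h]])
  also have "\<dots> = intertwine d e R Q X * Q h"
    unfolding intertwine_def using cQ[OF h] RXQ by (rule msum_mult_right[symmetric])
  finally show ?thesis .
qed

text \<open>With the elementary matrix at (i, j), the (i, j) entry of the group sum involves only
  diagonal entries, which are what a product of two traces expands into.\<close>

lemma intertwine_elementary:
  assumes R: "mrep G d R" and Q: "mrep G e Q" and ij: "i < d" "j < e"
  defines "X \<equiv> mat d e (\<lambda>ab. if ab = (i, j) then 1 else 0)"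
  shows "X \<in> carrier_mat d e"
    "intertwine d e R Q X $$ (i, j) = (\<Sum>g\<in>carrier G. R g $$ (i, i) * Q (inv g) $$ (j, j))"
proof -
  note cR = mrepD(1)[OF R] and cQ = mrepD(1)[OF Q]
  show X: "X \<in> carrier_mat d e" by (simp add: X_def)
  have "(R g * X * Q (inv g)) $$ (i, j) = R g $$ (i, i) * Q (inv g) $$ (j, j)" if g: "g \<in> carrier G" for g
  proof -
    have RX: "(R g * X) $$ (i, b) = (if b = j then R g $$ (i, i) else 0)" if "b < e" for b
    proof -
      have "(R g * X) $$ (i, b) = (\<Sum>a = 0..<d. R g $$ (i, a) * X $$ (a, b))"
        using ij that X cR[OF g] by (intro mat_mult_entry) auto
      also have "\<dots> = (\<Sum>a = 0..<d. if a = i then (if b = j then R g $$ (i, i) else 0) else 0)"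
        by (rule sum.cong) (use that in \<open>auto simp: X_def\<close>)
      finally show ?thesis using ij by simp
    qed
    have "(R g * X * Q (inv g)) $$ (i, j) = (\<Sum>b = 0..<e. (R g * X) $$ (i, b) * Q (inv g) $$ (b, j))"
      using ij X cR[OF g] cQ[of "inv g"] g by (intro mat_mult_entry) auto
    also have "\<dots> = (\<Sum>b = 0..<e. if b = j then R g $$ (i, i) * Q (inv g) $$ (j, j) else 0)"
      by (rule sum.cong) (auto simp: RX simp del: index_mult_mat(1))
    finally show ?thesis using ij by simp
  qed
  then show "intertwine d e R Q X $$ (i, j) = (\<Sum>g\<in>carrier G. R g $$ (i, i) * Q (inv g) $$ (j, j))"
    unfolding intertwine_def using ij by (simp add: msum_entry del: index_mult_mat(1))
qed

lemma trace_orthogonality: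
  assumes R: "irreducible_rep G d R" and Q: "irreducible_rep G e Q"
    and g0: "g0 \<in> carrier G" "mat_trace (R g0) \<noteq> mat_trace (Q g0)"
  shows "(\<Sum>g\<in>carrier G. mat_trace (R g) * mat_trace (Q (inv g))) = 0"
proof -
  note rR = irreducible_repD(1)[OF R] and rQ = irreducible_repD(1)[OF Q]
  note cR = mrepD(1)[OF rR] and cQ = mrepD(1)[OF rQ]
  have "(\<Sum>g\<in>carrier G. R g $$ (i, i) * Q (inv g) $$ (j, j)) = 0" if ij: "i < d" "j < e" for i j
  proof -
    note X = intertwine_elementary[OF rR rQ ij]
    show ?thesis
      using schur_zero[OF R Q _ intertwine_comm[OF rR rQ X(1)] g0] X(2) ij
      by (simp add: intertwine_def)
  qed
  note z = this
  have "(\<Sum>g\<in>carrier G. mat_trace (R g) * mat_trace (Q (inv g))) =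
      (\<Sum>g\<in>carrier G. \<Sum>i = 0..<d. \<Sum>j = 0..<e. R g $$ (i, i) * Q (inv g) $$ (j, j))"
    using cR cQ by (intro sum.cong) (simp_all add: mat_trace_eq[of _ d] mat_trace_eq[of _ e] sum_product)
  also have "\<dots> = (\<Sum>i = 0..<d. \<Sum>j = 0..<e. \<Sum>g\<in>carrier G. R g $$ (i, i) * Q (inv g) $$ (j, j))"
    by (subst sum.swap, rule sum.cong[OF refl], rule sum.swap)
  also have "\<dots> = 0" using z by simp
  finally show ?thesis .
qed

text \<open>The group sum for the elementary matrix at (i, j) is scalar by Schur's lemma, and its
  trace is the group order if i = j and 0 otherwise. Hence each of the d pairs with i = j
  contributes the order divided by d.\<close>

lemma trace_norm:
  assumes R: "irreducible_rep G d R"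
  shows "(\<Sum>g\<in>carrier G. mat_trace (R g) * mat_trace (R (inv g))) = of_nat (Coset.order G)"
proof -
  note rR = irreducible_repD(1)[OF R]
  note cR = mrepD(1)[OF rR]
  have d: "d > 0" using irreducible_repD(2)[OF R] .
  have e: "(\<Sum>g\<in>carrier G. R g $$ (i, i) * R (inv g) $$ (j, j)) = (if j = i then of_nat (Coset.order G) / of_nat d else 0)"
    if ij: "i < d" "j < d" for i j
  proof -
    define X where "X = mat d d (\<lambda>ab. if ab = (i, j) then 1 else (0::complex))"
    note X = intertwine_elementary[OF rR rR ij, folded X_def]
    define T where "T = intertwine d d R R X"
    have Tc: "T \<in> carrier_mat d d" by (simp add: T_def intertwine_def)
    have trX: "mat_trace X = (if i = j then 1 else 0)"
    proof -
      have "mat_trace X = (\<Sum>a = 0..<d. if a = i then (if i = j then 1 else 0) else 0)"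
        unfolding mat_trace_eq[OF X(1)] by (rule sum.cong) (auto simp: X_def)
      then show ?thesis using ij by simp
    qed
    have "mat_trace (R g * X * R (inv g)) = mat_trace X" if g: "g \<in> carrier G" for g
    proof -
      have "mat_trace (R g * X * R (inv g)) = mat_trace (R (inv g) * (R g * X))"
        using cR g X(1) by (intro mat_trace_comm[of _ d d] mult_carrier_mat[of _ d d]) auto
      also have "R (inv g) * (R g * X) = X"
        using cR[OF g] cR[of "inv g"] g X(1) mrep_inv[OF rR g] by (simp flip: assoc_mult_mat[of _ d d _ d _ d])
      finally show ?thesis .
    qed
    then have "mat_trace T = of_nat (Coset.order G) * mat_trace X"
      unfolding T_def intertwine_def using cR X(1)
      by (subst msum_trace) (auto simp: Coset.order_def intro!: mult_carrier_mat[of _ d d])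
    moreover have "T = (mat_trace T / of_nat d) \<cdot>\<^sub>m 1\<^sub>m d"
      using intertwine_comm[OF rR rR X(1)] by (intro schur_scalar[OF R Tc]) (simp add: T_def)
    then have "T $$ (i, j) = (mat_trace T / of_nat d) * (if i = j then 1 else 0)"
      using ij by (subst (asm) mat_eq_iff) (simp add: intertwine_def T_def)
    ultimately show ?thesis using X(2) trX by (auto simp: T_def)
  qed
  have "(\<Sum>g\<in>carrier G. mat_trace (R g) * mat_trace (R (inv g))) =
      (\<Sum>g\<in>carrier G. \<Sum>i = 0..<d. \<Sum>j = 0..<d. R g $$ (i, i) * R (inv g) $$ (j, j))"
    using cR by (intro sum.cong) (simp_all add: mat_trace_eq[of _ d] sum_product)
  also have "\<dots> = (\<Sum>i = 0..<d. \<Sum>j = 0..<d. \<Sum>g\<in>carrier G. R g $$ (i, i) * R (inv g) $$ (j, j))"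
    by (subst sum.swap, rule sum.cong[OF refl], rule sum.swap)
  also have "\<dots> = (\<Sum>i = 0..<d. of_nat (Coset.order G) / of_nat d)"
    using e by (intro sum.cong) auto
  also have "\<dots> = of_nat (Coset.order G)" using d by simp
  finally show ?thesis .
qed

text \<open>Conjugating by the Gram matrix of the averaged inner product turns \<open>R (inv g)\<close> into the
  conjugate transpose of \<open>R g\<close>.\<close>

lemma trace_inv:
  assumes R: "mrep G d R" and h: "h \<in> carrier G"
  shows "mat_trace (R (inv h)) = cnj (mat_trace (R h))"
proof -
  note cR = mrepD(1)[OF R]
  define J :: "complex mat \<Rightarrow> complex mat" where "J A = mat d d (\<lambda>(i, j). cnj (A $$ (j, i)))" for A
  have Jc: "J A \<in> carrier_mat d d" for A by (simp add: J_def)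
  have Jm: "J (A * B) = J B * J A" if "A \<in> carrier_mat d d" "B \<in> carrier_mat d d" for A B
  proof (rule eq_matI)
    fix i j assume "i < dim_row (J B * J A)" "j < dim_col (J B * J A)"
    then have ij: "i < d" "j < d" by (auto simp: J_def)
    have "J (A * B) $$ (i, j) = cnj ((A * B) $$ (j, i))" using ij by (simp add: J_def)
    also have "\<dots> = (\<Sum>k = 0..<d. J B $$ (i, k) * J A $$ (k, j))"
      using ij that by (subst mat_mult_entry[of _ d d _ d]) (auto simp: J_def mult.commute)
    also have "\<dots> = (J B * J A) $$ (i, j)"
      using ij Jc by (intro mat_mult_entry[symmetric]) auto
    finally show "J (A * B) $$ (i, j) = (J B * J A) $$ (i, j)" .
  qed (auto simp: J_def)
  have Jt: "mat_trace (J A) = cnj (mat_trace A)" if "A \<in> carrier_mat d d" for A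
    unfolding mat_trace_eq[OF that] mat_trace_eq[OF Jc] by (simp add: J_def)
  define H where "H = msum d d (\<lambda>g. J (R g) * R g) (carrier G)"
  have Hc: "H \<in> carrier_mat d d" by (simp add: H_def)
  have "v = 0\<^sub>v d" if v: "v \<in> carrier_vec d" and Hv: "H *\<^sub>v v = 0\<^sub>v d" for v
  proof -
    define u where "u g = R g *\<^sub>v v" for g
    have ue: "u g $ k = (\<Sum>j = 0..<d. R g $$ (k, j) * v $ j)" if "g \<in> carrier G" "k < d" for g k
      unfolding u_def using cR[OF that(1)] v that(2) by (rule mat_mult_vec_entry)
    have 0: "(\<Sum>i = 0..<d. cnj (v $ i) * (H *\<^sub>v v) $ i) = 0" using Hv by simp
    have Hvi: "(H *\<^sub>v v) $ i = (\<Sum>g\<in>carrier G. \<Sum>k = 0..<d. cnj (R g $$ (k, i)) * u g $ k)" if "i < d" for i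
    proof -
      have "(H *\<^sub>v v) $ i = (\<Sum>j = 0..<d. \<Sum>g\<in>carrier G. (J (R g) * R g) $$ (i, j) * v $ j)"
        unfolding mat_mult_vec_entry[OF Hc v that] using that
        by (simp add: H_def msum_entry sum_distrib_right del: index_mult_mat(1))
      also have "\<dots> = (\<Sum>g\<in>carrier G. \<Sum>j = 0..<d. (\<Sum>k = 0..<d. cnj (R g $$ (k, i)) * R g $$ (k, j)) * v $ j)"
        using that Jc cR by (subst sum.swap)
          (auto simp: mat_mult_entry[of _ d d _ d] J_def simp del: index_mult_mat(1) intro!: sum.cong)
      also have "\<dots> = (\<Sum>g\<in>carrier G. \<Sum>k = 0..<d. \<Sum>j = 0..<d. cnj (R g $$ (k, i)) * (R g $$ (k, j) * v $ j))"
        by (rule sum.cong[OF refl], subst sum.swap) (simp add: sum_distrib_right mult.assoc)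
      also have "\<dots> = (\<Sum>g\<in>carrier G. \<Sum>k = 0..<d. cnj (R g $$ (k, i)) * u g $ k)"
        by (simp add: ue sum_distrib_left)
      finally show ?thesis .
    qed
    \<comment> \<open>The Hermitian form of \<open>H\<close> at \<open>v\<close> is the sum of the
      squared norms of all \<open>R g *\<^sub>v v\<close>; the term of the neutral element is the
      squared norm of \<open>v\<close>, so \<open>H\<close> has trivial kernel.\<close>
    have "(\<Sum>i = 0..<d. cnj (v $ i) * (H *\<^sub>v v) $ i) =
        (\<Sum>i = 0..<d. \<Sum>g\<in>carrier G. \<Sum>k = 0..<d. cnj (R g $$ (k, i) * v $ i) * u g $ k)"
      by (rule sum.cong) (simp_all add: Hvi sum_distrib_left mult_ac del: index_mult_mat_vec)
    also have "\<dots> = (\<Sum>g\<in>carrier G. \<Sum>k = 0..<d. \<Sum>i = 0..<d. cnj (R g $$ (k, i) * v $ i) * u g $ k)"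
      by (subst sum.swap, rule sum.cong[OF refl], rule sum.swap)
    also have "\<dots> = (\<Sum>g\<in>carrier G. \<Sum>k = 0..<d. cnj (u g $ k) * u g $ k)"
      by (simp add: ue sum_distrib_right)
    also have "\<dots> = of_real (\<Sum>g\<in>carrier G. \<Sum>k = 0..<d. (cmod (u g $ k))\<^sup>2)"
      by (simp add: mult.commute[of "cnj _"] complex_norm_square[symmetric])
    finally have e: "(\<Sum>i = 0..<d. cnj (v $ i) * (H *\<^sub>v v) $ i) =
        of_real (\<Sum>g\<in>carrier G. \<Sum>k = 0..<d. (cmod (u g $ k))\<^sup>2)" .
    have "(\<Sum>g\<in>carrier G. \<Sum>k = 0..<d. (cmod (u g $ k))\<^sup>2) = 0"
      by (rule of_real_eq_0_iff[THEN iffD1, OF trans[OF e[symmetric] 0]])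
    then have "(\<Sum>k = 0..<d. (cmod (u g $ k))\<^sup>2) = 0" if "g \<in> carrier G" for g
      using that fin by (subst (asm) sum_nonneg_eq_0_iff) (auto intro: sum_nonneg)
    from this[OF one_closed] have "u \<one> $ k = 0" if "k < d" for k
      using that by (subst (asm) sum_nonneg_eq_0_iff) auto
    moreover have "u \<one> = v" using mrepD(3)[OF R] v by (simp add: u_def)
    ultimately show ?thesis using v by (intro eq_vecI) auto
  qed
  from mat_inverse_exists[OF Hc this] obtain K where K: "K \<in> carrier_mat d d" "H * K = 1\<^sub>m d" "K * H = 1\<^sub>m d"
    by blast
  \<comment> \<open>Right multiplication by h permutes the terms of the sum, so the Hermitian form
    is invariant.\<close>
  have inv: "J (R h) * H * R h = H"
  proof -
    have "J (R h) * H * R h = msum d d (\<lambda>g. J (R h) * (J (R g) * R g) * R h) (carrier G)"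
    proof -
      have JRc: "J (R g) * R g \<in> carrier_mat d d" if "g \<in> carrier G" for g by (rule mult_carrier_mat[OF Jc cR[OF that]])
      then have "J (R h) * (J (R g) * R g) \<in> carrier_mat d d" if "g \<in> carrier G" for g
        using Jc that by (metis mult_carrier_mat)
      note c = this
      have "J (R h) * H = msum d d (\<lambda>g. J (R h) * (J (R g) * R g)) (carrier G)"
        unfolding H_def by (rule msum_mult_left[OF Jc]) (rule JRc)
      then show ?thesis
        using msum_mult_right[of "R h" d d "carrier G" "\<lambda>g. J (R h) * (J (R g) * R g)" d, OF cR[OF h] c] by simp
    qed
    also have "\<dots> = msum d d (\<lambda>g. J (R (g \<otimes> h)) * R (g \<otimes> h)) (carrier G)"
    proof (rule msum_cong)
      fix g assume g: "g \<in> carrier G"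
      show "J (R h) * (J (R g) * R g) * R h = J (R (g \<otimes> h)) * R (g \<otimes> h)"
        using cR[OF g] cR[OF h] Jc mrepD(2)[OF R g h] by (simp add: Jm assoc_mult_mat[of _ d d _ d _ d] mult_carrier_mat[of _ d d _ d])
    qed
    also have "\<dots> = H" unfolding H_def by (rule msum_reindex[symmetric, OF bij_right_mult[OF h]])
    finally show ?thesis .
  qed
  have "J (R h) = H * R (inv h) * K"
  proof -
    have "J (R h) = J (R h) * (H * (R h * R (inv h)) * K)"
      using mrep_inv[OF R h] K Hc Jc[of "R h"] by simp
    also have "\<dots> = J (R h) * H * R h * R (inv h) * K"
      using cR[OF h] cR[of "inv h"] h K(1) Hc Jc[of "R h"] by (simp add: assoc_mult_mat[of _ d d _ d _ d])
    finally show ?thesis using inv by simp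
  qed
  then have "cnj (mat_trace (R h)) = mat_trace (H * R (inv h) * K)" using Jt[OF cR[OF h]] by simp
  also have "\<dots> = mat_trace (K * (H * R (inv h)))"
    using cR[of "inv h"] h K(1) Hc by (intro mat_trace_comm[of _ d d]) auto
  also have "K * (H * R (inv h)) = R (inv h)"
    using cR[of "inv h"] h K Hc by (simp flip: assoc_mult_mat[of _ d d _ d _ d])
  finally show ?thesis by simp
qed

definition class_fun :: "('a \<Rightarrow> complex) \<Rightarrow> bool" where
  "class_fun f \<longleftrightarrow> (\<forall>g\<in>carrier G. \<forall>h\<in>carrier G. f (h \<otimes> g \<otimes> inv h) = f g)"

lemma trace_conj:
  assumes R: "mrep G d R" and gh: "g \<in> carrier G" "h \<in> carrier G"
  shows "mat_trace (R (h \<otimes> g \<otimes> inv h)) = mat_trace (R g)"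
proof -
  note cR = mrepD(1)[OF R]
  have "R (h \<otimes> g \<otimes> inv h) = R h * R g * R (inv h)"
    using gh by (simp add: mrepD(2)[OF R])
  then have "mat_trace (R (h \<otimes> g \<otimes> inv h)) = mat_trace (R (inv h) * (R h * R g))"
    using cR gh mat_trace_comm[of "R h * R g" d d "R (inv h)"] mult_carrier_mat[of "R h" d d "R g" d] by auto
  also have "R (inv h) * (R h * R g) = R g"
    using cR[OF gh(1)] cR[OF gh(2)] cR[of "inv h"] gh mrep_inv[OF R gh(2)]
    by (simp flip: assoc_mult_mat[of _ d d _ d _ d])
  finally show ?thesis .
qed

lemma irreducible_character_class_fun:
  assumes "irreducible_character G \<chi>"
  shows "class_fun \<chi>"
proof -
  obtain d R where R: "irreducible_rep G d R" "\<chi> = (\<lambda>g\<in>carrier G. mat_trace (R g))"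
    using assms unfolding irreducible_character_def by blast
  show ?thesis using trace_conj[OF irreducible_repD(1)[OF R(1)]] by (simp add: class_fun_def R(2))
qed

text \<open>The weighted sum commutes with every \<open>R h\<close> because conjugation by h
  permutes its terms and preserves \<open>f\<close>; Schur's lemma makes it a scalar, found by
  taking traces.\<close>

lemma class_fun_average_scalar:
  assumes R: "irreducible_rep G d R" and f: "class_fun f"
  shows "msum d d (\<lambda>g. f g \<cdot>\<^sub>m R g) (carrier G) =
    ((\<Sum>g\<in>carrier G. f g * mat_trace (R g)) / of_nat d) \<cdot>\<^sub>m 1\<^sub>m d"
proof -
  note rR = irreducible_repD(1)[OF R]
  note cR = mrepD(1)[OF rR]
  define T where "T = msum d d (\<lambda>g. f g \<cdot>\<^sub>m R g) (carrier G)"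
  have Tc: "T \<in> carrier_mat d d" by (simp add: T_def)
  have "R h * T = T * R h" if h: "h \<in> carrier G" for h
  proof -
    have "R h * T = msum d d (\<lambda>g. R h * (f g \<cdot>\<^sub>m R g)) (carrier G)"
      unfolding T_def using cR h by (intro msum_mult_left) auto
    also have "\<dots> = msum d d (\<lambda>g. f (h \<otimes> g \<otimes> inv h) \<cdot>\<^sub>m R (h \<otimes> g \<otimes> inv h) * R h) (carrier G)"
    proof (rule msum_cong)
      fix g assume g: "g \<in> carrier G"
      have "R (h \<otimes> g \<otimes> inv h) * R h = R h * R g"
        using g h by (simp add: m_assoc flip: mrepD(2)[OF rR])
      then show "R h * (f g \<cdot>\<^sub>m R g) = f (h \<otimes> g \<otimes> inv h) \<cdot>\<^sub>m R (h \<otimes> g \<otimes> inv h) * R h"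
        using f g h cR[OF g] cR[OF h] cR[of "h \<otimes> g \<otimes> inv h"]
        by (simp add: class_fun_def mult_smult_distrib[of _ d d _ d] mult_smult_assoc_mat[of _ d d _ d])
    qed
    also have "\<dots> = msum d d (\<lambda>g. f g \<cdot>\<^sub>m R g * R h) (carrier G)"
      by (rule msum_reindex[symmetric, OF bij_conj[OF h]])
    also have "\<dots> = T * R h"
      unfolding T_def using cR h by (intro msum_mult_right[symmetric]) auto
    finally show ?thesis .
  qed
  then have "T = (mat_trace T / of_nat d) \<cdot>\<^sub>m 1\<^sub>m d" by (rule schur_scalar[OF R Tc])
  moreover have "mat_trace T = (\<Sum>g\<in>carrier G. f g * mat_trace (R g))"
    unfolding T_def using cR by (subst msum_trace) (auto intro!: sum.cong mat_trace_smult)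
  ultimately show ?thesis by (simp add: T_def)
qed

lemma irreducible_characters_orthogonal:
  assumes "irreducible_character G \<chi>" "irreducible_character G \<psi>" "\<chi> \<noteq> \<psi>"
  shows "char_inner G \<chi> \<psi> = 0"
proof -
  obtain d R e Q where R: "irreducible_rep G d R" "\<chi> = (\<lambda>g\<in>carrier G. mat_trace (R g))"
    and Q: "irreducible_rep G e Q" "\<psi> = (\<lambda>g\<in>carrier G. mat_trace (Q g))"
    using assms unfolding irreducible_character_def by blast
  obtain g0 where "g0 \<in> carrier G" "mat_trace (R g0) \<noteq> mat_trace (Q g0)"
    using assms(3) R(2) Q(2) by (metis (no_types, lifting) restrict_ext)
  from trace_orthogonality[OF R(1) Q(1) this] show ?thesis
    by (simp add: char_inner_def R(2) Q(2) trace_inv[OF irreducible_repD(1)[OF Q(1)]] cong: sum.cong)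
qed

lemma irreducible_character_norm:
  assumes "irreducible_character G \<chi>"
  shows "char_inner G \<chi> \<chi> = 1"
proof -
  obtain d R where R: "irreducible_rep G d R" "\<chi> = (\<lambda>g\<in>carrier G. mat_trace (R g))"
    using assms unfolding irreducible_character_def by blast
  have "Coset.order G > 0" using fin order_gt_0_iff_finite by blast
  then show ?thesis using trace_norm[OF R(1)]
    by (simp add: char_inner_def R(2) trace_inv[OF irreducible_repD(1)[OF R(1)]] cong: sum.cong)
qed

end

section \<open>Diagrams, fillings and Young subgroups\<close>

section \<open>Functions with prescribed fibres\<close>

lemma sum_if_card: "finite A \<Longrightarrow> (\<Sum>i\<in>A. if P i then 1 else 0) = card (A \<inter> {i. P i})"
  by (simp add: sum.If_cases)

lemma permutes_inv_in: "p permutes X \<Longrightarrow> x \<in> X \<Longrightarrow> inv' p x \<in> X"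
  using permutes_in_image[OF permutes_inv] by fast

lemma bij_betw_fibres:
  fixes f :: "'a \<Rightarrow> 'c" and h :: "'b \<Rightarrow> 'c"
  assumes "finite X" "finite Y" "\<And>c. card {x\<in>X. f x = c} = card {y\<in>Y. h y = c}"
  obtains u where "bij_betw u X Y" "\<And>x. x \<in> X \<Longrightarrow> h (u x) = f x"
proof -
  have "\<exists>b. bij_betw b {x\<in>X. f x = c} {y\<in>Y. h y = c}" for c
    using assms by (intro finite_same_card_bij) auto
  then obtain b where b: "\<And>c. bij_betw (b c) {x\<in>X. f x = c} {y\<in>Y. h y = c}" by metis
  define u where "u x = b (f x) x" for x
  have uY: "u x \<in> Y" and hu: "h (u x) = f x" if "x \<in> X" for x
    using bij_betwE[OF b[of "f x"]] that by (auto simp: u_def)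
  have "inj_on u X"
  proof (rule inj_onI)
    fix x x' assume x: "x \<in> X" "x' \<in> X" "u x = u x'"
    then have "f x = f x'" using hu by metis
    then show "x = x'" using bij_betw_imp_inj_on[OF b[of "f x"]] x by (auto simp: u_def dest: inj_onD)
  qed
  moreover have "y \<in> u ` X" if y: "y \<in> Y" for y
  proof -
    have "y \<in> b (h y) ` {x\<in>X. f x = h y}" using bij_betw_imp_surj_on[OF b[of "h y"]] y by auto
    then obtain x where "x \<in> X" "f x = h y" "y = b (h y) x" by auto
    then show ?thesis by (intro image_eqI[of _ _ x]) (simp_all add: u_def)
  qed
  ultimately have "bij_betw u X Y" using uY by (auto simp: bij_betw_def)
  then show ?thesis using that hu by blast
qed

lemma permutes_fibres:
  assumes "finite X" "\<And>c. card {x\<in>X. f x = c} = card {x\<in>X. h x = c}"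
  obtains p where "p permutes X" "\<And>x. x \<in> X \<Longrightarrow> h (p x) = f x"
proof -
  obtain u where u: "bij_betw u X X" "\<And>x. x \<in> X \<Longrightarrow> h (u x) = f x"
    using bij_betw_fibres[OF assms(1,1,2)] by metis
  define p where "p = (\<lambda>x. if x \<in> X then u x else x)"
  have "bij_betw p X X" using u(1) by (rule bij_betw_cong[THEN iffD1, rotated]) (simp add: p_def)
  then have "p permutes X" by (rule bij_imp_permutes) (simp add: p_def)
  then show ?thesis using that u(2) by (simp add: p_def)
qed

section \<open>Parts and conjugate partitions\<close>

text \<open>Rows past the end have length 0, so that partitions of different lengths can be compared
  row by row.\<close>

definition part :: "nat list \<Rightarrow> nat \<Rightarrow> nat" where
  "part \<mu> i = (if i < length \<mu> then \<mu> ! i else 0)"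

lemma part_antimono: "\<mu> \<in> partitions n \<Longrightarrow> i \<le> j \<Longrightarrow> part \<mu> j \<le> part \<mu> i"
  by (cases "i = j") (auto simp: part_def partitions_def sorted_wrt_iff_nth_less)

lemma part_pos_iff: "\<mu> \<in> partitions n \<Longrightarrow> 0 < part \<mu> i \<longleftrightarrow> i < length \<mu>"
  by (auto simp: part_def partitions_def) (metis neq0_conv nth_mem)

lemma partition_eqI:
  assumes "\<mu> \<in> partitions n" "\<nu> \<in> partitions k" "\<And>i. part \<mu> i = part \<nu> i"
  shows "\<mu> = \<nu>"
proof (rule nth_equalityI)
  have "i < length \<mu> \<longleftrightarrow> i < length \<nu>" for i
    using part_pos_iff[OF assms(1), of i] part_pos_iff[OF assms(2), of i] assms(3) by simp
  then show l: "length \<mu> = length \<nu>" by (meson linorder_neqE_nat nat_neq_iff)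
  fix i assume "i < length \<mu>"
  then show "\<mu> ! i = \<nu> ! i" using assms(3)[of i] l by (simp add: part_def)
qed

lemma sum_list_part: "sum_list \<mu> = (\<Sum>i<length \<mu>. part \<mu> i)"
  by (simp add: sum_list_sum_nth part_def atLeast0LessThan)

lemma length_conj_part: "length (conj_part \<mu>) = Max (insert 0 (set \<mu>))"
  by (simp add: conj_part_def)

lemma part_le_length_conj: "part \<mu> i \<le> length (conj_part \<mu>)"
  by (auto simp: length_conj_part part_def)

lemma finite_part_gt: "finite {i. j < part \<mu> i}"
  by (rule finite_subset[of _ "{..<length \<mu>}"]) (auto simp: part_def split: if_splits)

lemma part_conj: "part (conj_part \<mu>) j = card {i. j < part \<mu> i}"
proof (cases "j < length (conj_part \<mu>)")
  case True
  then have "part (conj_part \<mu>) j = length (filter (\<lambda>x. j < x) \<mu>)"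
    by (simp add: part_def conj_part_def)
  also have "\<dots> = card {i. i < length \<mu> \<and> j < \<mu> ! i}" by (rule length_filter_conv_card)
  also have "{i. i < length \<mu> \<and> j < \<mu> ! i} = {i. j < part \<mu> i}" by (auto simp: part_def split: if_splits)
  finally show ?thesis .
next
  case False
  then have "{i. j < part \<mu> i} = {}"
    using part_le_length_conj[of \<mu>] by (auto simp: not_less intro: order_trans)
  then show ?thesis using False by (simp add: part_def)
qed

text \<open>Both sides say that the cell in row i and column j belongs to the diagram: the rows
  longer than j form an initial segment because the row lengths weakly decrease.\<close>

lemma less_part_conj_iff:
  assumes "\<mu> \<in> partitions n"
  shows "i < part (conj_part \<mu>) j \<longleftrightarrow> j < part \<mu> i"
proof -
  let ?A = "{i. j < part \<mu> i}"
  have down: "i' \<in> ?A" if "i \<in> ?A" "i' \<le> i" for i i'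
    using part_antimono[OF assms that(2)] that(1) by simp
  have "?A = {..<card ?A}"
  proof (cases "?A = {}")
    case False
    define m where "m = Max ?A"
    have "m \<in> ?A" using Max_in[OF finite_part_gt False] by (simp add: m_def)
    moreover have "i \<le> m" if "i \<in> ?A" for i using Max_ge[OF finite_part_gt that] by (simp add: m_def)
    ultimately have "?A = {..m}" using down by blast
    then show ?thesis by (simp add: lessThan_Suc_atMost)
  qed simp
  then show ?thesis unfolding part_conj by blast
qed

lemma conj_part_in_partitions:
  assumes "\<mu> \<in> partitions n"
  shows "conj_part \<mu> \<in> partitions n"
proof -
  let ?c = "conj_part \<mu>"
  have nth: "?c ! j = card {i. j < part \<mu> i}" if "j < length ?c" for j
    using part_conj[of \<mu> j] that by (simp add: part_def)
  have "sorted_wrt (\<ge>) ?c"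
    unfolding sorted_wrt_iff_nth_less
    by (auto simp: nth intro!: card_mono finite_part_gt)
  moreover have "0 \<notin> set ?c"
  proof
    assume "0 \<in> set ?c"
    then obtain j where j: "j < length ?c" "?c ! j = 0" by (auto simp: in_set_conv_nth)
    then have "\<mu> \<noteq> []" by (auto simp: length_conj_part)
    then have "Max (insert 0 (set \<mu>)) \<in> set \<mu>"
      using Max_in[of "insert 0 (set \<mu>)"] j(1) by (auto simp: length_conj_part)
    then obtain i where "i < length \<mu>" "\<mu> ! i = length ?c" by (auto simp: in_set_conv_nth length_conj_part)
    then have "i \<in> {i. j < part \<mu> i}" using j(1) by (simp add: part_def)
    then show False using nth[OF j(1)] j(2) card_0_eq[OF finite_part_gt[of j \<mu>]] by auto
  qed
  moreover have "sum_list ?c = n"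
  proof -
    \<comment> \<open>The cells of the diagram are counted by columns, then by rows.\<close>
    have "sum_list ?c = (\<Sum>j<length ?c. \<Sum>i<length \<mu>. if j < part \<mu> i then 1 else 0)"
      unfolding sum_list_part
    proof (rule sum.cong[OF refl])
      fix j
      have "{i. j < part \<mu> i} = {..<length \<mu>} \<inter> {i. j < part \<mu> i}" by (auto simp: part_def split: if_splits)
      then show "part ?c j = (\<Sum>i<length \<mu>. if j < part \<mu> i then 1 else 0)"
        unfolding part_conj by (simp add: sum_if_card)
    qed
    also have "\<dots> = (\<Sum>i<length \<mu>. \<Sum>j<length ?c. if j < part \<mu> i then 1 else 0)" by (rule sum.swap)
    also have "\<dots> = (\<Sum>i<length \<mu>. part \<mu> i)"
    proof (rule sum.cong[OF refl])
      fix i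
      have "{..<length ?c} \<inter> {j. j < part \<mu> i} = {..<part \<mu> i}" using part_le_length_conj[of \<mu> i] by auto
      then show "(\<Sum>j<length ?c. if j < part \<mu> i then 1 else 0) = part \<mu> i"
        by (simp add: sum_if_card)
    qed
    finally show ?thesis using assms by (simp add: partitions_def flip: sum_list_part)
  qed
  ultimately show ?thesis by (simp add: partitions_def)
qed

lemma conj_part_conj_part:
  assumes "\<mu> \<in> partitions n"
  shows "conj_part (conj_part \<mu>) = \<mu>"
proof (rule partition_eqI)
  show "conj_part (conj_part \<mu>) \<in> partitions n" using assms by (intro conj_part_in_partitions)
  show "part (conj_part (conj_part \<mu>)) i = part \<mu> i" for i
    unfolding part_conj[of "conj_part \<mu>"] less_part_conj_iff[OF assms] by simp
qed fact

lemma sum_list_conj_part: "\<mu> \<in> partitions n \<Longrightarrow> sum_list (conj_part \<mu>) = n"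
  using conj_part_in_partitions by (auto simp: partitions_def)

lemma sum_list_partition: "\<mu> \<in> partitions n \<Longrightarrow> sum_list \<mu> = n"
  by (simp add: partitions_def)

section \<open>Tableaux and dominance\<close>

text \<open>A pair of functions \<open>r\<close>, \<open>c\<close> that is jointly injective plays the role of a filling of a
  diagram, \<open>r\<close> and \<open>c\<close> giving the row and the column of an entry.\<close>

locale filling =
  fixes X :: "'a set" and r c :: "'a \<Rightarrow> nat" and \<alpha> \<beta> :: "nat list" and n
  assumes finX: "finite X"
    and \<beta>: "\<beta> \<in> partitions n"
    and r: "\<And>i. card {x\<in>X. r x = i} = part \<alpha> i"
    and c: "\<And>j. card {x\<in>X. c x = j} = part (conj_part \<beta>) j"
    and inj: "inj_on (\<lambda>x. (r x, c x)) X"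
begin

abbreviation "cnt s j \<equiv> card {x\<in>X. r x < s \<and> c x = j}"

lemma c_less: "x \<in> X \<Longrightarrow> c x < length (conj_part \<beta>)"
proof (rule ccontr)
  assume x: "x \<in> X" and "\<not> c x < length (conj_part \<beta>)"
  then have "card {y\<in>X. c y = c x} = 0" using c by (simp add: part_def)
  then show False using x finX by auto
qed

lemma card_rows_below: "(\<Sum>i<s. part \<alpha> i) = (\<Sum>j<length (conj_part \<beta>). cnt s j)"
proof -
  have "(\<Sum>i<s. part \<alpha> i) = card (\<Union>i\<in>{..<s}. {x\<in>X. r x = i})"
    unfolding r[symmetric] by (rule card_UN_disjoint[symmetric]) (use finX in auto)
  also have "(\<Union>i\<in>{..<s}. {x\<in>X. r x = i}) = (\<Union>j\<in>{..<length (conj_part \<beta>)}. {x\<in>X. r x < s \<and> c x = j})"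
    using c_less by auto
  also have "card \<dots> = (\<Sum>j<length (conj_part \<beta>). cnt s j)"
    by (rule card_UN_disjoint) (use finX in auto)
  finally show ?thesis .
qed

text \<open>Joint injectivity lets a column meet each row at most once, so at most s of its entries
  lie in the first s rows.\<close>

lemma cnt_le: "cnt s j \<le> min s (part (conj_part \<beta>) j)"
proof -
  have "cnt s j \<le> part (conj_part \<beta>) j"
    unfolding c[symmetric] by (rule card_mono) (use finX in auto)
  moreover have "cnt s j \<le> card {..<s}"
    by (rule card_inj_on_le[where f = r]) (use inj in \<open>auto simp: inj_on_def\<close>)
  ultimately show ?thesis by simp
qed

lemma sum_min: "(\<Sum>j<length (conj_part \<beta>). min s (part (conj_part \<beta>) j)) = (\<Sum>i<s. part \<beta> i)"
proof -
  have "(\<Sum>j<length (conj_part \<beta>). min s (part (conj_part \<beta>) j)) =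
      (\<Sum>j<length (conj_part \<beta>). \<Sum>i<s. if j < part \<beta> i then 1 else 0)"
  proof (rule sum.cong[OF refl])
    fix j
    have "{..<s} \<inter> {i. j < part \<beta> i} = {..<min s (part (conj_part \<beta>) j)}"
      using less_part_conj_iff[OF \<beta>] by auto
    then show "min s (part (conj_part \<beta>) j) = (\<Sum>i<s. if j < part \<beta> i then 1 else 0)"
      by (simp add: sum_if_card) 
  qed
  also have "\<dots> = (\<Sum>i<s. \<Sum>j<length (conj_part \<beta>). if j < part \<beta> i then 1 else 0)" by (rule sum.swap)
  also have "\<dots> = (\<Sum>i<s. part \<beta> i)"
  proof (rule sum.cong[OF refl])
    fix i
    have "{..<length (conj_part \<beta>)} \<inter> {j. j < part \<beta> i} = {..<part \<beta> i}"
      using part_le_length_conj[of \<beta> i] by auto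
    then show "(\<Sum>j<length (conj_part \<beta>). if j < part \<beta> i then 1 else 0) = part \<beta> i"
      by (simp add: sum_if_card)
  qed
  finally show ?thesis .
qed

text \<open>In each column, the first s rows hold at most the minimum of s and the column length,
  and these bounds add up to the first s rows of \<open>\<beta>\<close>.\<close>

lemma dominance: "(\<Sum>i<s. part \<alpha> i) \<le> (\<Sum>i<s. part \<beta> i)"
  unfolding card_rows_below sum_min[symmetric] by (rule sum_mono) (rule cnt_le)

text \<open>For equal shapes the counts and their bounds have the same total, so every bound is
  attained.\<close>

lemma cnt_eq:
  assumes "\<alpha> = \<beta>"
  shows "cnt s j = min s (part (conj_part \<beta>) j)"
proof (cases "j < length (conj_part \<beta>)")
  case True
  show ?thesis
    by (rule sum_mono_inv[of "cnt s" "{..<length (conj_part \<beta>)}"])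
      (use assms card_rows_below[of s] sum_min[of s] cnt_le True in auto)
next
  case False
  then have e: "{x\<in>X. r x < s \<and> c x = j} = {}" using c_less by auto
  have "cnt s j = 0" unfolding e by simp
  then show ?thesis using False by (simp add: part_def)
qed

text \<open>Comparing the counts for s = i and s = i + 1 shows how many entries lie in row i and
  column j: one for a cell of the diagram, none elsewhere.\<close>

lemma filling_image:
  assumes "\<alpha> = \<beta>"
  shows "(\<lambda>x. (r x, c x)) ` X = {(i, j). j < part \<beta> i}"
proof -
  have *: "card {x\<in>X. r x = i \<and> c x = j} = (if j < part \<beta> i then 1 else 0)" for i j
  proof -
    have "{x\<in>X. r x < Suc i \<and> c x = j} = {x\<in>X. r x < i \<and> c x = j} \<union> {x\<in>X. r x = i \<and> c x = j}" by auto
    then have "cnt (Suc i) j = cnt i j + card {x\<in>X. r x = i \<and> c x = j}"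
      using finX by (simp add: card_Un_disjoint disjoint_iff)
    then show ?thesis
      unfolding cnt_eq[OF assms] using less_part_conj_iff[OF \<beta>, of i j] by (auto simp: min_def split: if_splits)
  qed
  have "c x < part \<beta> (r x)" if "x \<in> X" for x
  proof (rule ccontr)
    assume "\<not> c x < part \<beta> (r x)"
    then have "card {y\<in>X. r y = r x \<and> c y = c x} = 0" using * by simp
    then show False using finX that by auto
  qed
  moreover have "\<exists>x\<in>X. r x = i \<and> c x = j" if "j < part \<beta> i" for i j
  proof -
    have "card {x\<in>X. r x = i \<and> c x = j} \<noteq> 0" using *[of i j] that by simp
    then have "{x\<in>X. r x = i \<and> c x = j} \<noteq> {}" by (metis card.empty)
    then show ?thesis by auto
  qed
  ultimately show ?thesis by (auto simp: image_iff) metis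
qed

end

section \<open>Young subgroups as stabilisers\<close>

text \<open>Encodes the blocks by a function on points, so that a Young subgroup becomes the group
  of permutations leaving this function invariant.\<close>

definition row_of :: "nat list \<Rightarrow> nat \<Rightarrow> nat" where
  "row_of \<mu> x = (LEAST i. x \<le> sum_list (take (Suc i) \<mu>))"

lemma sum_list_take_mono: "i \<le> j \<Longrightarrow> sum_list (take i \<mu>) \<le> sum_list (take j (\<mu> :: nat list))"
proof -
  assume "i \<le> j"
  then have "take j \<mu> = take i \<mu> @ take (j - i) (drop i \<mu>)" by (metis le_add_diff_inverse take_add)
  then show ?thesis by simp
qed

lemma row_of_eq_iff:
  assumes "x \<in> {1..sum_list \<mu>}"
  shows "row_of \<mu> x = i \<longleftrightarrow> i < length \<mu> \<and> x \<in> young_block \<mu> i"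
proof
  assume i: "row_of \<mu> x = i"
  have ne: "\<mu> \<noteq> []" using assms by auto
  have "x \<le> sum_list (take (Suc (length \<mu> - 1)) \<mu>)" using assms by simp
  then have le: "x \<le> sum_list (take (Suc i) \<mu>)" and "i \<le> length \<mu> - 1"
    using i LeastI[of "\<lambda>i. x \<le> sum_list (take (Suc i) \<mu>)" "length \<mu> - 1"]
      Least_le[of "\<lambda>i. x \<le> sum_list (take (Suc i) \<mu>)" "length \<mu> - 1"]
    unfolding row_of_def by simp_all
  moreover have "sum_list (take i \<mu>) < x"
  proof (cases i)
    case (Suc k)
    then have "k < (LEAST i. x \<le> sum_list (take (Suc i) \<mu>))" using i by (simp add: row_of_def)
    then show ?thesis using not_less_Least Suc by (metis not_le)
  qed (use assms in simp)
  ultimately show "i < length \<mu> \<and> x \<in> young_block \<mu> i" using ne by (cases \<mu>) (auto simp: young_block_def)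
next
  assume i: "i < length \<mu> \<and> x \<in> young_block \<mu> i"
  show "row_of \<mu> x = i"
    unfolding row_of_def
  proof (rule Least_equality)
    fix k assume "x \<le> sum_list (take (Suc k) \<mu>)"
    then show "i \<le> k" using i sum_list_take_mono[of "Suc k" i \<mu>] by (auto simp: young_block_def not_less_eq_eq[symmetric])
  qed (use i in \<open>auto simp: young_block_def\<close>)
qed

lemma young_block_subset: "young_block \<mu> i \<subseteq> {1..sum_list \<mu>}"
  using sum_list_take_mono[of "Suc i" "max (Suc i) (length \<mu>)" \<mu>] by (auto simp: young_block_def)

lemma row_of_fibre: "i < length \<mu> \<Longrightarrow> {x\<in>{1..sum_list \<mu>}. row_of \<mu> x = i} = young_block \<mu> i"
  using young_block_subset[of \<mu> i] row_of_eq_iff[of _ \<mu> i] by blast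

lemma card_row_of_fibre: "card {x\<in>{1..sum_list \<mu>}. row_of \<mu> x = i} = part \<mu> i"
proof (cases "i < length \<mu>")
  case True
  then show ?thesis
    unfolding row_of_fibre[OF True] by (simp add: young_block_def part_def take_Suc_conv_app_nth)
next
  case False
  then have "{x\<in>{1..sum_list \<mu>}. row_of \<mu> x = i} = {}" by (auto simp: row_of_eq_iff)
  then show ?thesis using False by (simp add: part_def)
qed

lemma young_subgroup_iff:
  "p \<in> young_subgroup \<mu> \<longleftrightarrow>
    p permutes {1..sum_list \<mu>} \<and> (\<forall>x\<in>{1..sum_list \<mu>}. row_of \<mu> (p x) = row_of \<mu> x)"
proof (intro iffI conjI ballI)
  assume p: "p \<in> young_subgroup \<mu>"
  then show perm: "p permutes {1..sum_list \<mu>}" by (simp add: young_subgroup_def sym_group_carrier)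
  fix x assume x: "x \<in> {1..sum_list \<mu>}"
  then have i: "row_of \<mu> x < length \<mu>" "x \<in> young_block \<mu> (row_of \<mu> x)" using row_of_eq_iff by blast+
  then have "p x \<in> young_block \<mu> (row_of \<mu> x)" using p by (auto simp: young_subgroup_def)
  then show "row_of \<mu> (p x) = row_of \<mu> x" using i x permutes_in_image[OF perm] by (simp add: row_of_eq_iff)
next
  assume p: "p permutes {1..sum_list \<mu>} \<and> (\<forall>x\<in>{1..sum_list \<mu>}. row_of \<mu> (p x) = row_of \<mu> x)"
  have "p ` young_block \<mu> i = young_block \<mu> i" if i: "i < length \<mu>" for i
  proof (rule card_subset_eq)
    show "finite (young_block \<mu> i)" by (simp add: young_block_def)
    show "p ` young_block \<mu> i \<subseteq> young_block \<mu> i"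
      unfolding row_of_fibre[OF i, symmetric] using p permutes_in_image by fastforce
    show "card (p ` young_block \<mu> i) = card (young_block \<mu> i)"
      using p by (intro card_image) (metis permutes_inj inj_on_subset subset_UNIV)
  qed
  then show "p \<in> young_subgroup \<mu>" using p by (simp add: young_subgroup_def sym_group_carrier)
qed

section \<open>Symmetric groups\<close>

lemma fin_group_sym: "fin_group (sym_group n)"
  unfolding fin_group_def fin_group_axioms_def
  using sym_group_is_group by (auto simp: sym_group_def finite_permutations)

lemma carrier_sym_group: "carrier (sym_group n) = {p. p permutes {1..n}}"
  by (simp add: sym_group_def)

lemma inv_sym_group: "p permutes {1..n} \<Longrightarrow> inv\<^bsub>sym_group n\<^esub> p = inv' p"
  by (rule group.inv_equality[OF sym_group_is_group])
    (simp_all add: sym_group_mult sym_group_one sym_group_carrier permutes_inv permutes_inv_o)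

lemma order_sym_group: "Coset.order (sym_group n) = fact n"
  by (simp add: Coset.order_def carrier_sym_group card_permutations)

lemma finite_young_subgroup: "finite (young_subgroup \<mu>)"
  by (rule finite_subset[OF _ finite_permutations[of "{1..sum_list \<mu>}"]]) (auto simp: young_subgroup_iff)

lemma young_subgroup_closed:
  assumes "p \<in> young_subgroup \<mu>" "q \<in> young_subgroup \<mu>"
  shows "p \<circ> q \<in> young_subgroup \<mu>" "inv' p \<in> young_subgroup \<mu>" "id \<in> young_subgroup \<mu>"
proof -
  have p: "p permutes {1..sum_list \<mu>}" and q: "q permutes {1..sum_list \<mu>}"
    using assms by (auto simp: young_subgroup_iff)
  show "p \<circ> q \<in> young_subgroup \<mu>"
    using assms permutes_compose[OF q p] permutes_in_image[OF q] by (auto simp: young_subgroup_iff)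
  have "row_of \<mu> (inv' p x) = row_of \<mu> x" if x: "x \<in> {1..sum_list \<mu>}" for x
  proof -
    have "inv' p x \<in> {1..sum_list \<mu>}" using permutes_in_image[OF permutes_inv[OF p]] x by blast
    then have "row_of \<mu> (p (inv' p x)) = row_of \<mu> (inv' p x)" using assms(1) young_subgroup_iff by blast
    then show ?thesis using permutes_inverses(1)[OF p] by simp
  qed
  then show "inv' p \<in> young_subgroup \<mu>" using permutes_inv[OF p] by (auto simp: young_subgroup_iff)
  show "id \<in> young_subgroup \<mu>" by (auto simp: young_subgroup_iff permutes_id)
qed

text \<open>The condition under which a double coset of two Young subgroups contributes, namely that no
  transposition of the first one is conjugate under \<open>g\<close> to an element of the second one.\<close>

definition admissible :: "nat list \<Rightarrow> nat list \<Rightarrow> (nat \<Rightarrow> nat) \<Rightarrow> bool" where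
  "admissible \<alpha> \<gamma> g \<longleftrightarrow> inj_on (\<lambda>x. (row_of \<alpha> x, row_of \<gamma> (inv' g x))) {1..sum_list \<alpha>}"

lemma card_row_of_inv_fibre:
  assumes "g permutes {1..sum_list \<gamma>}"
  shows "card {x\<in>{1..sum_list \<gamma>}. row_of \<gamma> (inv' g x) = i} = part \<gamma> i"
proof -
  have "bij_betw g {x\<in>{1..sum_list \<gamma>}. row_of \<gamma> x = i} {x\<in>{1..sum_list \<gamma>}. row_of \<gamma> (inv' g x) = i}"
  proof (rule bij_betw_byWitness[where f' = "inv' g"])
    show "g ` {x\<in>{1..sum_list \<gamma>}. row_of \<gamma> x = i} \<subseteq> {x\<in>{1..sum_list \<gamma>}. row_of \<gamma> (inv' g x) = i}"
      using permutes_in_image[OF assms] permutes_inverses(2)[OF assms] by fastforce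
    show "inv' g ` {x\<in>{1..sum_list \<gamma>}. row_of \<gamma> (inv' g x) = i} \<subseteq> {x\<in>{1..sum_list \<gamma>}. row_of \<gamma> x = i}"
      using permutes_inv_in[OF assms] by blast
  qed (auto simp: permutes_inverses[OF assms])
  from bij_betw_same_card[OF this] show ?thesis using card_row_of_fibre[of \<gamma> i] by simp
qed

lemma admissible_filling:
  assumes "\<alpha> \<in> partitions n" "\<beta> \<in> partitions n" "g permutes {1..n}" "admissible \<alpha> (conj_part \<beta>) g"
  shows "filling {1..n} (row_of \<alpha>) (\<lambda>x. row_of (conj_part \<beta>) (inv' g x)) \<alpha> \<beta> n"
  unfolding filling_def
  using card_row_of_fibre[of \<alpha>] card_row_of_inv_fibre[of g "conj_part \<beta>"] assms
  by (auto simp: admissible_def sum_list_partition sum_list_conj_part)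

text \<open>Two points that share a row and whose preimages under g share a column give a
  transposition in the first group; conjugated by g it becomes the transposition of the preimages,
  which lies in the second group.\<close>

lemma not_admissible_transposition:
  assumes "g permutes {1..n}" "sum_list \<alpha> = n" "sum_list \<gamma> = n" "\<not> admissible \<alpha> \<gamma> g"
  obtains t where "t \<in> young_subgroup \<alpha>" "inv' g \<circ> t \<circ> g \<in> young_subgroup \<gamma>" "sign (inv' g \<circ> t \<circ> g) = -1"
proof -
  obtain x x' where x: "x \<in> {1..n}" "x' \<in> {1..n}" "x \<noteq> x'" "row_of \<alpha> x = row_of \<alpha> x'"
    "row_of \<gamma> (inv' g x) = row_of \<gamma> (inv' g x')"
    using assms(2,4) by (auto simp: admissible_def inj_on_def)
  define t where "t = Transposition.transpose x x'"
  have tp: "t permutes {1..n}" unfolding t_def using x by (intro permutes_swap_id) auto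
  have "row_of \<alpha> (t y) = row_of \<alpha> y" for y
    using x(4) by (auto simp: t_def Transposition.transpose_def)
  then have 1: "t \<in> young_subgroup \<alpha>" using tp assms(2) by (simp add: young_subgroup_iff)
  have g: "bij g" "surj g" using assms(1) permutes_bij permutes_surj by blast+
  have s: "inv' g \<circ> t \<circ> g = Transposition.transpose (inv' g x) (inv' g x')"
    unfolding t_def using g permutes_inverses[OF assms(1)]
    by (auto simp: fun_eq_iff Transposition.transpose_def)
  have gi: "inv' g x \<in> {1..n}" "inv' g x' \<in> {1..n}" using permutes_in_image[OF permutes_inv[OF assms(1)]] x by blast+
  have ne: "inv' g x \<noteq> inv' g x'" using x(3) permutes_inverses(1)[OF assms(1)] by metis
  have "row_of \<gamma> ((inv' g \<circ> t \<circ> g) y) = row_of \<gamma> y" for y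
    unfolding s using x(5) by (auto simp: Transposition.transpose_def)
  moreover have "inv' g \<circ> t \<circ> g permutes {1..n}" unfolding s using gi by (intro permutes_swap_id) auto
  ultimately have 2: "inv' g \<circ> t \<circ> g \<in> young_subgroup \<gamma>" using assms(3) by (simp add: young_subgroup_iff)
  have "sign (inv' g \<circ> t \<circ> g) = -1" unfolding s using ne by (simp add: sign_swap_id)
  then show ?thesis using that 1 2 by blast
qed

context
  fixes \<alpha> :: "nat list" and n :: nat
  assumes \<alpha>: "\<alpha> \<in> partitions n"
begin

text \<open>The cells of the diagram are numbered twice, by \<open>u\<close> along rows and by
  \<open>v\<close> along columns. The permutation sought takes the second number of a cell to the
  first.\<close>

lemma admissible_exists: "\<exists>w. w permutes {1..n} \<and> admissible \<alpha> (conj_part \<alpha>) w"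
proof -
  define D where "D = {(i, j). j < part \<alpha> i}"
  have "D \<subseteq> {..<length \<alpha>} \<times> {..<length (conj_part \<alpha>)}"
    using part_le_length_conj[of \<alpha>] by (auto simp: D_def part_def split: if_splits intro: less_le_trans)
  then have finD: "finite D" by (rule finite_subset) simp
  have rowD: "card {d\<in>D. fst d = i} = part \<alpha> i" for i
  proof -
    have "{d\<in>D. fst d = i} = Pair i ` {..<part \<alpha> i}" by (auto simp: D_def)
    then show ?thesis by (simp add: card_image inj_on_def)
  qed
  have colD: "card {d\<in>D. snd d = j} = part (conj_part \<alpha>) j" for j
  proof -
    have "{d\<in>D. snd d = j} = (\<lambda>i. (i, j)) ` {i. j < part \<alpha> i}" by (auto simp: D_def)
    then show ?thesis by (simp add: card_image inj_on_def part_conj)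
  qed
  obtain u where u: "bij_betw u {1..n} D" "\<And>x. x \<in> {1..n} \<Longrightarrow> fst (u x) = row_of \<alpha> x"
    using bij_betw_fibres[of "{1..n}" D "row_of \<alpha>" fst] finD rowD card_row_of_fibre[of \<alpha>]
    by (metis \<alpha> finite_atLeastAtMost sum_list_partition)
  obtain v where v: "bij_betw v {1..n} D" "\<And>x. x \<in> {1..n} \<Longrightarrow> snd (v x) = row_of (conj_part \<alpha>) x"
    using bij_betw_fibres[of "{1..n}" D "row_of (conj_part \<alpha>)" snd] finD colD
      card_row_of_fibre[of "conj_part \<alpha>"]
    by (metis \<alpha> finite_atLeastAtMost sum_list_conj_part)
  define q where "q = (\<lambda>x. if x \<in> {1..n} then inv_into {1..n} v (u x) else x)"
  have "bij_betw (inv_into {1..n} v \<circ> u) {1..n} {1..n}"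
    using u(1) bij_betw_inv_into[OF v(1)] by (rule bij_betw_trans)
  then have "bij_betw q {1..n} {1..n}"
    by (rule bij_betw_cong[THEN iffD1, rotated]) (simp add: q_def)
  then have q: "q permutes {1..n}" by (rule bij_imp_permutes) (auto simp: q_def)
  have vq: "v (q x) = u x" if "x \<in> {1..n}" for x
  proof -
    have "u x \<in> v ` {1..n}" using bij_betwE[OF u(1)] bij_betw_imp_surj_on[OF v(1)] that by blast
    then show ?thesis using that by (simp add: q_def f_inv_into_f)
  qed
  have "row_of (conj_part \<alpha>) (q x) = snd (u x)" if "x \<in> {1..n}" for x
    using v(2)[of "q x"] vq[OF that] permutes_in_image[OF q] that by metis
  then have "(row_of \<alpha> x, row_of (conj_part \<alpha>) (inv' (inv' q) x)) = u x" if "x \<in> {1..n}" for x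
    using u(2)[OF that] that permutes_inv_inv[OF q] by (simp add: prod_eq_iff)
  then have "admissible \<alpha> (conj_part \<alpha>) (inv' q)"
    unfolding admissible_def sum_list_partition[OF \<alpha>]
    using bij_betw_imp_inj_on[OF u(1)] by (subst inj_on_cong[where g = u]) auto
  then show ?thesis using permutes_inv[OF q] by blast
qed

text \<open>By \<open>filling_image\<close> each cell of the diagram has exactly one entry in the
  filling of g and one in that of w. Matching these entries gives y in the row group, and what
  remains of g after removing y and w preserves the columns.\<close>

lemma admissible_double_coset:
  assumes g: "g permutes {1..n}" "admissible \<alpha> (conj_part \<alpha>) g"
    and w: "w permutes {1..n}" "admissible \<alpha> (conj_part \<alpha>) w"
  obtains y z where "y \<in> young_subgroup \<alpha>" "z \<in> young_subgroup (conj_part \<alpha>)" "g = y \<circ> w \<circ> z"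
proof -
  let ?X = "{1..n}"
  let ?c = "row_of (conj_part \<alpha>)"
  define G where "G x = (row_of \<alpha> x, ?c (inv' g x))" for x
  define W where "W x = (row_of \<alpha> x, ?c (inv' w x))" for x
  have GW: "G ` ?X = W ` ?X" "inj_on G ?X" "inj_on W ?X"
    unfolding G_def W_def
    using filling.filling_image[OF admissible_filling[OF \<alpha> \<alpha> g]] filling.inj[OF admissible_filling[OF \<alpha> \<alpha> g]]
      filling.filling_image[OF admissible_filling[OF \<alpha> \<alpha> w]] filling.inj[OF admissible_filling[OF \<alpha> \<alpha> w]]
    by auto
  define y where "y = (\<lambda>x. if x \<in> ?X then inv_into ?X G (W x) else x)"
  have "bij_betw (inv_into ?X G \<circ> W) ?X ?X"
    using GW by (intro bij_betw_trans[of W ?X "G ` ?X"] bij_betw_inv_into) (auto simp: bij_betw_def)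
  then have "bij_betw y ?X ?X"
    by (rule bij_betw_cong[THEN iffD1, rotated]) (simp add: y_def)
  then have y: "y permutes ?X" by (rule bij_imp_permutes) (auto simp: y_def)
  have Gy: "G (y x) = W x" if "x \<in> ?X" for x
    using GW that by (simp add: y_def f_inv_into_f)
  have yY: "y \<in> young_subgroup \<alpha>"
    using y Gy by (auto simp: young_subgroup_iff sum_list_partition[OF \<alpha>] G_def W_def)
  define z where "z = inv' w \<circ> inv' y \<circ> g"
  have z: "z permutes ?X" unfolding z_def by (intro permutes_compose permutes_inv g w y)
  have "?c (z x) = ?c x" if x: "x \<in> ?X" for x
  proof -
    have "g x \<in> ?X" using permutes_in_image[OF g(1)] x by blast
    then have yx: "inv' y (g x) \<in> ?X" using permutes_in_image[OF permutes_inv[OF y]] by blast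
    have "snd (G (y (inv' y (g x)))) = snd (W (inv' y (g x)))" using Gy[OF yx] by simp
    then show ?thesis using permutes_inverses[OF y] permutes_inverses[OF g(1)]
      by (simp add: G_def W_def z_def)
  qed
  then have "z \<in> young_subgroup (conj_part \<alpha>)"
    using z by (simp add: young_subgroup_iff sum_list_conj_part[OF \<alpha>])
  moreover have "g = y \<circ> w \<circ> z"
    unfolding z_def using permutes_inverses[OF y] permutes_inverses[OF w(1)] by (simp add: fun_eq_iff)
  ultimately show ?thesis using that yY by blast
qed

text \<open>As y = w z^-1 w^-1, it preserves the columns moved by w as well as the rows, and joint
  injectivity leaves only the identity.\<close>

lemma admissible_stabiliser_trivial:
  assumes w: "w permutes {1..n}" "admissible \<alpha> (conj_part \<alpha>) w"
    and y: "y \<in> young_subgroup \<alpha>" and z: "z \<in> young_subgroup (conj_part \<alpha>)"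
    and e: "y \<circ> w \<circ> z = w"
  shows "y = id \<and> z = id"
proof -
  have yp: "y permutes {1..n}" and zp: "z permutes {1..n}"
    using y z by (auto simp: young_subgroup_iff sum_list_partition[OF \<alpha>] sum_list_conj_part[OF \<alpha>])
  have "y x = x" if x: "x \<in> {1..n}" for x
  proof -
    have x': "inv' w x \<in> {1..n}" using permutes_in_image[OF permutes_inv[OF w(1)]] x by blast
    define a where "a = inv' z (inv' w x)"
    have a: "a \<in> {1..n}" using permutes_in_image[OF permutes_inv[OF zp]] x' by (simp add: a_def)
    have za: "z a = inv' w x" using permutes_inverses(1)[OF zp] by (simp add: a_def)
    have "y x = w a" using fun_cong[OF e, of a] za permutes_inverses(1)[OF w(1)] by simp
    then have "inv' w (y x) = a" using permutes_inverses(2)[OF w(1)] by simp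
    moreover have "row_of (conj_part \<alpha>) (z a) = row_of (conj_part \<alpha>) a"
      using z a by (simp add: young_subgroup_iff sum_list_conj_part[OF \<alpha>])
    ultimately have "row_of (conj_part \<alpha>) (inv' w (y x)) = row_of (conj_part \<alpha>) (inv' w x)"
      using za by simp
    moreover have "row_of \<alpha> (y x) = row_of \<alpha> x"
      using y x by (simp add: young_subgroup_iff sum_list_partition[OF \<alpha>])
    moreover have "y x \<in> {1..n}" using permutes_in_image[OF yp] x by blast
    ultimately show ?thesis using w(2) x
      unfolding admissible_def sum_list_partition[OF \<alpha>] by (auto dest: inj_onD)
  qed
  then have "y = id" using yp by (auto simp: fun_eq_iff permutes_def)
  moreover have "z = id"
  proof
    fix x
    have "w (z x) = w x" using fun_cong[OF e, of x] \<open>y = id\<close> by simp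
    then show "z x = id x" using permutes_inj[OF w(1)] by (simp add: inj_eq)
  qed
  ultimately show ?thesis by simp
qed

end

context fin_group
begin

lemma order_pos: "Coset.order G > 0"
  using fin order_gt_0_iff_finite by blast

text \<open>Frobenius reciprocity: substituting the conjugate of g by x in the double sum makes
  every x contribute the same sum over \<open>H\<close>.\<close>

lemma char_inner_induced:
  assumes \<phi>: "class_fun \<phi>" and H: "H \<subseteq> carrier G"
  shows "char_inner G \<phi> (induced G H \<psi>) = (\<Sum>h\<in>H. \<phi> h * cnj (\<psi> h)) / of_nat (card H)"
proof -
  define \<psi>' where "\<psi>' y = (if y \<in> H then cnj (\<psi> y) else 0)" for y
  have ind: "cnj (induced G H \<psi> g) = (\<Sum>x\<in>carrier G. \<psi>' (inv x \<otimes> g \<otimes> x)) / of_nat (card H)" for g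
    by (auto simp: induced_def \<psi>'_def Let_def intro!: sum.cong)
  have inner: "(\<Sum>g\<in>carrier G. \<phi> g * \<psi>' (inv x \<otimes> g \<otimes> x)) = (\<Sum>h\<in>H. \<phi> h * cnj (\<psi> h))"
    if x: "x \<in> carrier G" for x
  proof -
    have "(\<Sum>g\<in>carrier G. \<phi> g * \<psi>' (inv x \<otimes> g \<otimes> x)) =
        (\<Sum>y\<in>carrier G. \<phi> (x \<otimes> y \<otimes> inv x) * \<psi>' (inv x \<otimes> (x \<otimes> y \<otimes> inv x) \<otimes> x))"
      by (rule sum.reindex_bij_betw[OF bij_conj[OF x], symmetric])
    also have "\<dots> = (\<Sum>y\<in>carrier G. \<phi> y * \<psi>' y)"
      using \<phi> x by (intro sum.cong) (auto simp: class_fun_def m_assoc cancel_inv)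
    also have "\<dots> = (\<Sum>y\<in>carrier G. if y \<in> H then \<phi> y * cnj (\<psi> y) else 0)"
      by (rule sum.cong) (auto simp: \<psi>'_def)
    also have "\<dots> = (\<Sum>y\<in>carrier G \<inter> H. \<phi> y * cnj (\<psi> y))"
      using fin by (simp add: sum.inter_restrict)
    also have "carrier G \<inter> H = H" using H by blast
    finally show ?thesis .
  qed
  have "(\<Sum>g\<in>carrier G. \<phi> g * cnj (induced G H \<psi> g)) =
      (\<Sum>g\<in>carrier G. \<Sum>x\<in>carrier G. \<phi> g * \<psi>' (inv x \<otimes> g \<otimes> x)) / of_nat (card H)"
    unfolding ind by (simp add: sum_divide_distrib sum_distrib_left)
  also have "\<dots> = (\<Sum>x\<in>carrier G. \<Sum>g\<in>carrier G. \<phi> g * \<psi>' (inv x \<otimes> g \<otimes> x)) / of_nat (card H)"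
    by (subst sum.swap) simp
  also have "\<dots> = of_nat (Coset.order G) * (\<Sum>h\<in>H. \<phi> h * cnj (\<psi> h)) / of_nat (card H)"
    using inner by (simp add: Coset.order_def)
  finally show ?thesis using order_pos by (simp add: char_inner_def)
qed

end

section \<open>Classification of the irreducible characters of symmetric groups\<close>

section \<open>Young symmetrisers in a representation\<close>

text \<open>In a representation, the unnormalised projection onto the vectors fixed by the Young
  subgroup.\<close>

definition row_sum :: "nat \<Rightarrow> ((nat \<Rightarrow> nat) \<Rightarrow> complex mat) \<Rightarrow> nat list \<Rightarrow> complex mat" where
  "row_sum d R \<alpha> = msum d d R (young_subgroup \<alpha>)"

text \<open>In a representation, the unnormalised projection onto the vectors on which the Young
  subgroup acts by the sign.\<close>

definition col_sum :: "nat \<Rightarrow> ((nat \<Rightarrow> nat) \<Rightarrow> complex mat) \<Rightarrow> nat list \<Rightarrow> complex mat" where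
  "col_sum d R \<gamma> = msum d d (\<lambda>z. of_int (sign z) \<cdot>\<^sub>m R z) (young_subgroup \<gamma>)"

lemma mat_smult_smult: "a \<cdot>\<^sub>m (b \<cdot>\<^sub>m A) = (a * b :: complex) \<cdot>\<^sub>m A"
  by (intro eq_matI) (auto simp: mult.assoc)

lemma sign_sq: "of_int (sign p) * of_int (sign p) = (1 :: complex)"
  by (simp add: sign_def)

lemma young_inverses: "y \<in> young_subgroup \<mu> \<Longrightarrow> y (inv' y x) = x" "y \<in> young_subgroup \<mu> \<Longrightarrow> inv' y (y x) = x"
  by (auto simp: young_subgroup_iff permutes_inverses)

lemma bij_young_left: "y \<in> young_subgroup \<mu> \<Longrightarrow> bij_betw (\<lambda>x. y \<circ> x) (young_subgroup \<mu>) (young_subgroup \<mu>)"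
  by (rule bij_betw_byWitness[where f' = "\<lambda>x. inv' y \<circ> x"])
    (auto simp: young_subgroup_closed young_inverses fun_eq_iff)

lemma bij_young_right: "y \<in> young_subgroup \<mu> \<Longrightarrow> bij_betw (\<lambda>x. x \<circ> y) (young_subgroup \<mu>) (young_subgroup \<mu>)"
  by (rule bij_betw_byWitness[where f' = "\<lambda>x. x \<circ> inv' y"])
    (auto simp: young_subgroup_closed young_inverses fun_eq_iff)

lemma young_subgroup_permutation: "z \<in> young_subgroup \<mu> \<Longrightarrow> permutation z"
  by (auto simp: young_subgroup_iff permutation_permutes)

lemma card_young_subgroup: "card (young_subgroup \<alpha>) \<noteq> 0"
proof -
  have "id \<in> young_subgroup \<alpha>" by (auto simp: young_subgroup_iff permutes_id)
  then show ?thesis using finite_young_subgroup by auto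
qed

locale sym_rep =
  fixes n d R
  assumes rep: "mrep (sym_group n) d R"
begin

lemma R_carrier: "p permutes {1..n} \<Longrightarrow> R p \<in> carrier_mat d d"
  using mrepD(1)[OF rep] by (simp add: sym_group_carrier)

lemma R_comp: "p permutes {1..n} \<Longrightarrow> q permutes {1..n} \<Longrightarrow> R (p \<circ> q) = R p * R q"
  using mrepD(2)[OF rep] by (simp add: sym_group_carrier sym_group_mult)

lemma R_id: "R id = 1\<^sub>m d"
  using mrepD(3)[OF rep] by (simp add: sym_group_one)

lemma row_sum_carrier [simp]: "row_sum d R \<alpha> \<in> carrier_mat d d"
  by (simp add: row_sum_def)

lemma col_sum_carrier [simp]: "col_sum d R \<gamma> \<in> carrier_mat d d"
  by (simp add: col_sum_def)

context
  fixes \<alpha> assumes \<alpha>: "sum_list \<alpha> = n"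
begin

lemma young_permutes: "y \<in> young_subgroup \<alpha> \<Longrightarrow> y permutes {1..n}"
  using \<alpha> by (simp add: young_subgroup_iff)

lemma row_sum_absorb:
  assumes y: "y \<in> young_subgroup \<alpha>"
  shows "row_sum d R \<alpha> * R y = row_sum d R \<alpha>"
proof -
  have "row_sum d R \<alpha> * R y = msum d d (\<lambda>x. R x * R y) (young_subgroup \<alpha>)"
    unfolding row_sum_def using R_carrier young_permutes y by (intro msum_mult_right) auto
  also have "\<dots> = msum d d (\<lambda>x. R (x \<circ> y)) (young_subgroup \<alpha>)"
    using R_comp young_permutes y by (intro msum_cong) auto
  also have "\<dots> = row_sum d R \<alpha>"
    unfolding row_sum_def by (rule msum_reindex[symmetric, OF bij_young_right[OF y]])
  finally show ?thesis .
qed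

lemma col_sum_absorb:
  assumes z: "z \<in> young_subgroup \<alpha>"
  shows "R z * col_sum d R \<alpha> = of_int (sign z) \<cdot>\<^sub>m col_sum d R \<alpha>"
proof -
  have "R z * col_sum d R \<alpha> = msum d d (\<lambda>x. R z * (of_int (sign x) \<cdot>\<^sub>m R x)) (young_subgroup \<alpha>)"
    unfolding col_sum_def using R_carrier young_permutes z by (intro msum_mult_left) auto
  also have "\<dots> = msum d d (\<lambda>x. of_int (sign z) \<cdot>\<^sub>m (of_int (sign (z \<circ> x)) \<cdot>\<^sub>m R (z \<circ> x))) (young_subgroup \<alpha>)"
  proof (rule msum_cong)
    fix x assume x: "x \<in> young_subgroup \<alpha>"
    have s: "of_int (sign z) * of_int (sign (z \<circ> x)) = (of_int (sign x) :: complex)"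
      using sign_compose[OF young_subgroup_permutation[OF z] young_subgroup_permutation[OF x]]
      by (simp add: mult.assoc[symmetric] sign_sq)
    show "R z * (of_int (sign x) \<cdot>\<^sub>m R x) = of_int (sign z) \<cdot>\<^sub>m (of_int (sign (z \<circ> x)) \<cdot>\<^sub>m R (z \<circ> x))"
      using R_comp[OF young_permutes[OF z] young_permutes[OF x]] R_carrier[OF young_permutes[OF z]]
        R_carrier[OF young_permutes[OF x]] s
      by (simp add: mult_smult_distrib[of _ d d _ d] mat_smult_smult)
  qed
  also have "\<dots> = of_int (sign z) \<cdot>\<^sub>m msum d d (\<lambda>x. of_int (sign (z \<circ> x)) \<cdot>\<^sub>m R (z \<circ> x)) (young_subgroup \<alpha>)"
    using R_carrier young_permutes young_subgroup_closed(1)[OF z] by (intro msum_smult) auto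
  also have "msum d d (\<lambda>x. of_int (sign (z \<circ> x)) \<cdot>\<^sub>m R (z \<circ> x)) (young_subgroup \<alpha>) = col_sum d R \<alpha>"
    unfolding col_sum_def
    by (rule msum_reindex[symmetric, OF bij_young_left[OF z], where F = "\<lambda>z. of_int (sign z) \<cdot>\<^sub>m R z"])
  finally show ?thesis .
qed

lemma row_sum_idem: "row_sum d R \<alpha> * row_sum d R \<alpha> = of_nat (card (young_subgroup \<alpha>)) \<cdot>\<^sub>m row_sum d R \<alpha>"
proof -
  have "row_sum d R \<alpha> * row_sum d R \<alpha> = msum d d (\<lambda>y. row_sum d R \<alpha> * R y) (young_subgroup \<alpha>)"
    unfolding row_sum_def[of d R \<alpha>] using R_carrier young_permutes
    by (intro msum_mult_left) (auto simp: row_sum_def[symmetric])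
  also have "\<dots> = (\<Sum>y\<in>young_subgroup \<alpha>. 1) \<cdot>\<^sub>m row_sum d R \<alpha>"
    by (rule msum_smult_const) (auto simp: row_sum_absorb)
  finally show ?thesis by simp
qed

lemma col_sum_idem: "col_sum d R \<alpha> * col_sum d R \<alpha> = of_nat (card (young_subgroup \<alpha>)) \<cdot>\<^sub>m col_sum d R \<alpha>"
proof -
  have "col_sum d R \<alpha> * col_sum d R \<alpha> =
      msum d d (\<lambda>z. (of_int (sign z) \<cdot>\<^sub>m R z) * col_sum d R \<alpha>) (young_subgroup \<alpha>)"
    unfolding col_sum_def[of d R \<alpha>] using R_carrier young_permutes
    by (intro msum_mult_right) (auto simp: col_sum_def[symmetric])
  also have "\<dots> = (\<Sum>y\<in>young_subgroup \<alpha>. 1) \<cdot>\<^sub>m col_sum d R \<alpha>"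
  proof (rule msum_smult_const)
    fix z assume z: "z \<in> young_subgroup \<alpha>"
    show "(of_int (sign z) \<cdot>\<^sub>m R z) * col_sum d R \<alpha> = 1 \<cdot>\<^sub>m col_sum d R \<alpha>"
      using R_carrier[OF young_permutes[OF z]] col_sum_absorb[OF z]
      by (simp add: mult_smult_assoc_mat[of _ d d _ d] mat_smult_smult sign_sq)
  qed simp
  finally show ?thesis by simp
qed

text \<open>Multiplicities are given by sums of traces over the Young subgroup, whereas products of
  symmetrisers need matrices that do not vanish; the row sum being a scaled idempotent allows
  passing between the two.\<close>

lemma trace_row_sum_iff: "(\<Sum>y\<in>young_subgroup \<alpha>. mat_trace (R y)) \<noteq> 0 \<longleftrightarrow> row_sum d R \<alpha> \<noteq> 0\<^sub>m d d"
proof -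
  have "(\<Sum>y\<in>young_subgroup \<alpha>. mat_trace (R y)) = mat_trace (row_sum d R \<alpha>)"
    unfolding row_sum_def using R_carrier young_permutes by (intro msum_trace[symmetric]) auto
  moreover have "row_sum d R \<alpha> \<noteq> 0\<^sub>m d d \<Longrightarrow> mat_trace (row_sum d R \<alpha>) \<noteq> 0"
    using card_young_subgroup by (intro trace_nonzero_if_scaled_idempotent[OF _ row_sum_idem]) auto
  ultimately show ?thesis by (metis mat_trace_zero)
qed

lemma trace_col_sum_iff:
  "(\<Sum>z\<in>young_subgroup \<alpha>. of_int (sign z) * mat_trace (R z)) \<noteq> 0 \<longleftrightarrow> col_sum d R \<alpha> \<noteq> 0\<^sub>m d d"
proof -
  have "(\<Sum>z\<in>young_subgroup \<alpha>. of_int (sign z) * mat_trace (R z)) = mat_trace (col_sum d R \<alpha>)"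
    unfolding col_sum_def using R_carrier young_permutes
    by (subst msum_trace) (auto intro!: sum.cong mat_trace_smult[symmetric])
  moreover have "col_sum d R \<alpha> \<noteq> 0\<^sub>m d d \<Longrightarrow> mat_trace (col_sum d R \<alpha>) \<noteq> 0"
    using card_young_subgroup by (intro trace_nonzero_if_scaled_idempotent[OF _ col_sum_idem]) auto
  ultimately show ?thesis by (metis mat_trace_zero)
qed

end

text \<open>Up to sign a function on the double cosets of the row group and the column group, by
  \<open>sandwich_double_coset\<close>.\<close>

definition sandwich :: "nat list \<Rightarrow> nat list \<Rightarrow> (nat \<Rightarrow> nat) \<Rightarrow> complex mat" where
  "sandwich \<alpha> \<gamma> g = row_sum d R \<alpha> * R g * col_sum d R \<gamma>"

lemma sandwich_carrier: "g permutes {1..n} \<Longrightarrow> sandwich \<alpha> \<gamma> g \<in> carrier_mat d d"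
  unfolding sandwich_def
  by (rule mult_carrier_mat[OF mult_carrier_mat[OF row_sum_carrier R_carrier] col_sum_carrier])

lemma sandwich_double_coset:
  assumes "sum_list \<alpha> = n" "sum_list \<gamma> = n" "y \<in> young_subgroup \<alpha>" "z \<in> young_subgroup \<gamma>"
    and w: "w permutes {1..n}"
  shows "sandwich \<alpha> \<gamma> (y \<circ> w \<circ> z) = of_int (sign z) \<cdot>\<^sub>m sandwich \<alpha> \<gamma> w"
proof -
  note yp = young_permutes[OF assms(1,3)] and zp = young_permutes[OF assms(2,4)]
  note c = R_carrier[OF yp] R_carrier[OF zp] R_carrier[OF w] row_sum_carrier[of \<alpha>] col_sum_carrier[of \<gamma>]
  have "R (y \<circ> w \<circ> z) = R y * R w * R z"
    using R_comp yp zp w permutes_compose[OF w yp] by simp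
  then have "sandwich \<alpha> \<gamma> (y \<circ> w \<circ> z) = row_sum d R \<alpha> * R y * R w * (R z * col_sum d R \<gamma>)"
    unfolding sandwich_def using c
    by (simp add: assoc_mult_mat[of _ d d _ d _ d] mult_carrier_mat[of _ d d _ d])
  also have "\<dots> = of_int (sign z) \<cdot>\<^sub>m sandwich \<alpha> \<gamma> w"
    unfolding sandwich_def row_sum_absorb[OF assms(1,3)] col_sum_absorb[OF assms(2,4)] using c
    by (simp add: mult_smult_distrib[of _ d d _ d] mult_carrier_mat[of _ d d _ d])
  finally show ?thesis .
qed

text \<open>The transposition t and its conjugate s satisfy t g = g s. Absorbing t into the row sum
  keeps the product, absorbing s into the column sum negates it.\<close>

lemma sandwich_not_admissible:
  assumes "sum_list \<alpha> = n" "sum_list \<gamma> = n" "g permutes {1..n}" "\<not> admissible \<alpha> \<gamma> g"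
  shows "sandwich \<alpha> \<gamma> g = 0\<^sub>m d d"
proof -
  obtain t where t: "t \<in> young_subgroup \<alpha>" "inv' g \<circ> t \<circ> g \<in> young_subgroup \<gamma>"
    "sign (inv' g \<circ> t \<circ> g) = -1"
    using not_admissible_transposition[OF assms(3,1,2,4)] by metis
  define s where "s = inv' g \<circ> t \<circ> g"
  have id: "id \<in> young_subgroup \<alpha>" "id \<in> young_subgroup \<gamma>"
    by (auto simp: young_subgroup_iff permutes_id)
  have "t \<circ> g \<circ> id = id \<circ> g \<circ> s"
    unfolding s_def using permutes_inverses[OF assms(3)] by (simp add: fun_eq_iff)
  then have "sandwich \<alpha> \<gamma> (t \<circ> g \<circ> id) = sandwich \<alpha> \<gamma> (id \<circ> g \<circ> s)" by (rule arg_cong)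
  then have "1 \<cdot>\<^sub>m sandwich \<alpha> \<gamma> g = -1 \<cdot>\<^sub>m sandwich \<alpha> \<gamma> g"
    unfolding sandwich_double_coset[OF assms(1,2) t(1) id(2) assms(3)]
      sandwich_double_coset[OF assms(1,2) id(1) t(2)[folded s_def] assms(3)]
    using t(3) by (simp add: s_def sign_id)
  then have e: "(1 \<cdot>\<^sub>m sandwich \<alpha> \<gamma> g) $$ (i, j) = (-1 \<cdot>\<^sub>m sandwich \<alpha> \<gamma> g) $$ (i, j)" for i j by simp
  show ?thesis
  proof (rule eq_matI)
    fix i j assume "i < dim_row (0\<^sub>m d d)" "j < dim_col (0\<^sub>m d d)"
    then show "sandwich \<alpha> \<gamma> g $$ (i, j) = 0\<^sub>m d d $$ (i, j)"
      using e[of i j] sandwich_carrier[OF assms(3), of \<alpha> \<gamma>] by simp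
  qed (use sandwich_carrier[OF assms(3), of \<alpha> \<gamma>] in auto)
qed

text \<open>The scalar \<open>k\<close> by which a weighted group sum acts is computed a second
  time, by expanding the sum between the symmetrisers. The result is expressed by \<open>f\<close>,
  w and the coefficients \<open>c\<close> alone.\<close>

lemma sandwich_class_sum:
  assumes w: "w permutes {1..n}"
    and T: "msum d d (\<lambda>g. f g \<cdot>\<^sub>m R g) (carrier (sym_group n)) = k \<cdot>\<^sub>m 1\<^sub>m d"
    and c: "\<And>g. g permutes {1..n} \<Longrightarrow> sandwich \<alpha> \<gamma> g = c g \<cdot>\<^sub>m sandwich \<alpha> \<gamma> w"
  shows "k \<cdot>\<^sub>m sandwich \<alpha> \<gamma> w = (\<Sum>g\<in>carrier (sym_group n). f g * c (w \<circ> g)) \<cdot>\<^sub>m sandwich \<alpha> \<gamma> w"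
proof -
  let ?S = "carrier (sym_group n)"
  let ?A = "row_sum d R \<alpha>" and ?B = "col_sum d R \<gamma>"
  have wc: "?A * R w \<in> carrier_mat d d" by (rule mult_carrier_mat[OF row_sum_carrier R_carrier[OF w]])
  have "k \<cdot>\<^sub>m sandwich \<alpha> \<gamma> w = ?A * R w * (k \<cdot>\<^sub>m 1\<^sub>m d) * ?B"
    unfolding sandwich_def using wc
    by (simp add: mult_smult_distrib[of _ d d _ d] mult_smult_assoc_mat[of _ d d _ d] right_mult_one_mat[OF wc])
  also have "\<dots> = msum d d (\<lambda>g. ?A * R w * (f g \<cdot>\<^sub>m R g)) ?S * ?B"
    unfolding T[symmetric] using R_carrier
    by (subst msum_mult_left[OF wc, of _ _ d]) (auto simp: sym_group_carrier)
  also have "\<dots> = msum d d (\<lambda>g. ?A * R w * (f g \<cdot>\<^sub>m R g) * ?B) ?S"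
    using wc R_carrier by (intro msum_mult_right[OF col_sum_carrier])
      (auto simp: sym_group_carrier intro!: mult_carrier_mat[OF wc])
  also have "\<dots> = (\<Sum>g\<in>?S. f g * c (w \<circ> g)) \<cdot>\<^sub>m sandwich \<alpha> \<gamma> w"
  proof (rule msum_smult_const)
    show "sandwich \<alpha> \<gamma> w \<in> carrier_mat d d" by (rule sandwich_carrier[OF w])
    fix g assume "g \<in> ?S"
    then have g: "g permutes {1..n}" by (simp add: sym_group_carrier)
    have "?A * R w * (f g \<cdot>\<^sub>m R g) * ?B = f g \<cdot>\<^sub>m sandwich \<alpha> \<gamma> (w \<circ> g)"
      unfolding sandwich_def R_comp[OF w g] using R_carrier[OF w] R_carrier[OF g] wc
        row_sum_carrier[of \<alpha>] col_sum_carrier[of \<gamma>]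
      by (simp add: mult_smult_distrib[of _ d d _ d] mult_smult_assoc_mat[of _ d d _ d]
          assoc_mult_mat[of _ d d _ d _ d] mult_carrier_mat[of _ d d _ d])
    also have "\<dots> = (f g * c (w \<circ> g)) \<cdot>\<^sub>m sandwich \<alpha> \<gamma> w"
      unfolding c[OF permutes_compose[OF g w]] by (simp add: mat_smult_smult)
    finally show "?A * R w * (f g \<cdot>\<^sub>m R g) * ?B = (f g * c (w \<circ> g)) \<cdot>\<^sub>m sandwich \<alpha> \<gamma> w" .
  qed
  finally show ?thesis .
qed

end

section \<open>The irreducible characters labelled by partitions\<close>

text \<open>The defining condition of \<open>irr_sym\<close> as a predicate, so that existence and
  uniqueness can be stated separately.\<close>

definition labelled :: "nat \<Rightarrow> nat list \<Rightarrow> ((nat \<Rightarrow> nat) \<Rightarrow> complex) \<Rightarrow> bool" where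
  "labelled n \<alpha> \<chi> \<longleftrightarrow> irreducible_character (sym_group n) \<chi> \<and>
     char_inner (sym_group n) \<chi> (induced (sym_group n) (young_subgroup \<alpha>) (\<lambda>_. 1)) \<noteq> 0 \<and>
     char_inner (sym_group n) \<chi>
       (induced (sym_group n) (young_subgroup (conj_part \<alpha>)) (\<lambda>p. of_int (sign p))) \<noteq> 0"

lemma young_subgroup_subset: "sum_list \<mu> = n \<Longrightarrow> young_subgroup \<mu> \<subseteq> carrier (sym_group n)"
  by (auto simp: young_subgroup_iff sym_group_carrier)

lemma inner_triv_induced_iff:
  assumes "fin_group.class_fun (sym_group n) \<chi>" "sum_list \<mu> = n"
  shows "char_inner (sym_group n) \<chi> (induced (sym_group n) (young_subgroup \<mu>) (\<lambda>_. 1)) \<noteq> 0 \<longleftrightarrow>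
    (\<Sum>y\<in>young_subgroup \<mu>. \<chi> y) \<noteq> 0"
  using fin_group.char_inner_induced[OF fin_group_sym assms(1) young_subgroup_subset[OF assms(2)], of "\<lambda>_. 1"]
    card_young_subgroup by simp

lemma inner_sign_induced_iff:
  assumes "fin_group.class_fun (sym_group n) \<chi>" "sum_list \<mu> = n"
  shows "char_inner (sym_group n) \<chi> (induced (sym_group n) (young_subgroup \<mu>) (\<lambda>p. of_int (sign p))) \<noteq> 0 \<longleftrightarrow>
    (\<Sum>z\<in>young_subgroup \<mu>. of_int (sign z) * \<chi> z) \<noteq> 0"
  using fin_group.char_inner_induced[OF fin_group_sym assms(1) young_subgroup_subset[OF assms(2)],
      of "\<lambda>p. of_int (sign p)"]
    card_young_subgroup by (simp add: mult.commute)

lemma labelled_iff_sums: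
  assumes "irreducible_character (sym_group n) \<chi>" "\<alpha> \<in> partitions n"
  shows "labelled n \<alpha> \<chi> \<longleftrightarrow> (\<Sum>y\<in>young_subgroup \<alpha>. \<chi> y) \<noteq> 0 \<and>
    (\<Sum>z\<in>young_subgroup (conj_part \<alpha>). of_int (sign z) * \<chi> z) \<noteq> 0"
  unfolding labelled_def
  using assms inner_triv_induced_iff inner_sign_induced_iff
    fin_group.irreducible_character_class_fun[OF fin_group_sym assms(1)]
  by (simp add: sum_list_partition sum_list_conj_part)

lemma labelled_iff_nonzero:
  assumes R: "irreducible_rep (sym_group n) d R" and \<chi>: "\<chi> = (\<lambda>g\<in>carrier (sym_group n). mat_trace (R g))"
    and \<alpha>: "\<alpha> \<in> partitions n"
  shows "labelled n \<alpha> \<chi> \<longleftrightarrow> row_sum d R \<alpha> \<noteq> 0\<^sub>m d d \<and> col_sum d R (conj_part \<alpha>) \<noteq> 0\<^sub>m d d"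
proof -
  interpret S: fin_group "sym_group n" by (rule fin_group_sym)
  interpret sym_rep n d R by unfold_locales (rule S.irreducible_repD(1)[OF R])
  have irr: "irreducible_character (sym_group n) \<chi>"
    unfolding irreducible_character_def using R \<chi> by blast
  have s: "sum_list \<alpha> = n" "sum_list (conj_part \<alpha>) = n"
    using \<alpha> by (simp_all add: sum_list_partition sum_list_conj_part)
  have v: "\<chi> y = mat_trace (R y)" if "y \<in> young_subgroup \<mu>" "sum_list \<mu> = n" for y \<mu>
    using that young_subgroup_subset[of \<mu> n] by (auto simp: \<chi>)
  show ?thesis
    unfolding labelled_iff_sums[OF irr \<alpha>] trace_row_sum_iff[OF s(1), symmetric] trace_col_sum_iff[OF s(2), symmetric]
    using v s by (simp cong: sum.cong)
qed

text \<open>The sum of all y w z w^-1, weighted by the sign of z, has coefficient 1 at the identity,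
  so some irreducible representation gives it a nonzero trace. There neither the row sum nor the
  column sum can vanish.\<close>

lemma labelled_exists:
  assumes \<alpha>: "\<alpha> \<in> partitions n"
  shows "\<exists>\<chi>. labelled n \<alpha> \<chi>"
proof -
  interpret S: fin_group "sym_group n" by (rule fin_group_sym)
  let ?Y = "young_subgroup \<alpha>" and ?Z = "young_subgroup (conj_part \<alpha>)"
  have s: "sum_list \<alpha> = n" "sum_list (conj_part \<alpha>) = n"
    using \<alpha> by (simp_all add: sum_list_partition sum_list_conj_part)
  obtain w where w: "w permutes {1..n}" "admissible \<alpha> (conj_part \<alpha>) w"
    using admissible_exists[OF \<alpha>] by blast
  have Yp: "y permutes {1..n}" if "y \<in> ?Y" for y using that s by (simp add: young_subgroup_iff)
  have Zp: "z permutes {1..n}" if "z \<in> ?Z" for z using that s by (simp add: young_subgroup_iff)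
  define k where "k y z = y \<circ> w \<circ> z \<circ> inv' w" for y z :: "nat \<Rightarrow> nat"
  have kp: "k y z permutes {1..n}" if "y \<in> ?Y" "z \<in> ?Z" for y z
    unfolding k_def using that Yp Zp w by (intro permutes_compose permutes_inv) auto
  define f where "f g = (\<Sum>y\<in>?Y. \<Sum>z\<in>?Z. if k y z = g then of_int (sign z) else (0::complex))" for g
  \<comment> \<open>Only the trivial pair produces the identity, so nothing cancels in that
    coefficient.\<close>
  have k1: "k y z = id \<longleftrightarrow> y = id \<and> z = id" if "y \<in> ?Y" "z \<in> ?Z" for y z
  proof
    assume e: "k y z = id"
    have "y \<circ> w \<circ> z = k y z \<circ> w" unfolding k_def using permutes_inverses[OF w(1)] by (simp add: fun_eq_iff)
    then show "y = id \<and> z = id" using admissible_stabiliser_trivial[OF \<alpha> w that] e by simp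
  qed (use permutes_inverses[OF w(1)] in \<open>simp add: k_def fun_eq_iff\<close>)
  have id: "id \<in> ?Y" "id \<in> ?Z" by (auto simp: young_subgroup_iff permutes_id)
  have "f id = (\<Sum>y\<in>?Y. \<Sum>z\<in>?Z. if z = id then (if y = id then 1 else 0) else 0)"
    unfolding f_def using k1 by (intro sum.cong) (auto simp: sign_id)
  also have "\<dots> = 1" using id by (simp add: finite_young_subgroup)
  finally have "f \<one>\<^bsub>sym_group n\<^esub> \<noteq> 0" by (simp add: sym_group_one)
  then obtain d R where R: "irreducible_rep (sym_group n) d R"
    and nz: "(\<Sum>g\<in>carrier (sym_group n). f g * mat_trace (R g)) \<noteq> 0"
    using S.irreducible_rep_detecting by blast
  interpret sym_rep n d R by unfold_locales (rule S.irreducible_repD(1)[OF R])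
  let ?A = "row_sum d R \<alpha>" and ?B = "col_sum d R (conj_part \<alpha>)"
  have wi: "inv' w permutes {1..n}" using w(1) by (rule permutes_inv)
  have "(\<Sum>g\<in>carrier (sym_group n). f g * mat_trace (R g)) =
      (\<Sum>g\<in>carrier (sym_group n). \<Sum>y\<in>?Y. \<Sum>z\<in>?Z. if k y z = g then of_int (sign z) * mat_trace (R g) else 0)"
    unfolding f_def by (simp add: sum_distrib_right if_distrib[of "\<lambda>x. x * _"] cong: if_cong)
  also have "\<dots> = (\<Sum>y\<in>?Y. \<Sum>z\<in>?Z. \<Sum>g\<in>carrier (sym_group n). if k y z = g then of_int (sign z) * mat_trace (R g) else 0)"
    by (subst sum.swap, rule sum.cong[OF refl], rule sum.swap)
  also have "\<dots> = (\<Sum>y\<in>?Y. \<Sum>z\<in>?Z. of_int (sign z) * mat_trace (R (k y z)))"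
    using kp S.fin by (intro sum.cong) (auto simp: sum.delta' sym_group_carrier)
  also have "\<dots> = mat_trace (?A * (R w * (?B * R (inv' w))))"
  proof -
    note c = R_carrier[OF w(1)] R_carrier[OF wi]
    have M: "R w * (?B * R (inv' w)) = msum d d (\<lambda>z. R w * ((of_int (sign z) \<cdot>\<^sub>m R z) * R (inv' w))) ?Z"
      unfolding col_sum_def using c R_carrier Zp
      by (subst msum_mult_right[of _ d d], simp, simp) (intro msum_mult_left, auto intro!: mult_carrier_mat[of _ d d _ d])
    have "?A * (R w * (?B * R (inv' w))) = msum d d (\<lambda>y. R y * (R w * (?B * R (inv' w)))) ?Y"
      unfolding row_sum_def using R_carrier Yp c
      by (intro msum_mult_right) (auto intro!: mult_carrier_mat[of _ d d _ d])
    then have "mat_trace (?A * (R w * (?B * R (inv' w)))) = (\<Sum>y\<in>?Y. mat_trace (R y * (R w * (?B * R (inv' w)))))"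
      using R_carrier Yp c by (simp add: msum_trace mult_carrier_mat[of _ d d _ d])
    also have "\<dots> = (\<Sum>y\<in>?Y. \<Sum>z\<in>?Z. of_int (sign z) * mat_trace (R (k y z)))"
    proof (rule sum.cong[OF refl])
      fix y assume y: "y \<in> ?Y"
      note cy = R_carrier[OF Yp[OF y]]
      have "R y * (R w * (?B * R (inv' w))) = msum d d (\<lambda>z. R y * (R w * ((of_int (sign z) \<cdot>\<^sub>m R z) * R (inv' w)))) ?Z"
        unfolding M using c cy R_carrier Zp by (intro msum_mult_left) (auto intro!: mult_carrier_mat[of _ d d _ d])
      also have "\<dots> = msum d d (\<lambda>z. of_int (sign z) \<cdot>\<^sub>m R (k y z)) ?Z"
      proof (rule msum_cong)
        fix z assume z: "z \<in> ?Z"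
        note cz = R_carrier[OF Zp[OF z]]
        have "R (k y z) = R y * (R w * (R z * R (inv' w)))"
          unfolding k_def comp_assoc using Yp[OF y] Zp[OF z] w(1) wi
          by (simp add: R_comp permutes_compose)
        then show "R y * (R w * ((of_int (sign z) \<cdot>\<^sub>m R z) * R (inv' w))) = of_int (sign z) \<cdot>\<^sub>m R (k y z)"
          using c cy cz by (simp add: mult_smult_distrib[of _ d d _ d] mult_smult_assoc_mat[of _ d d _ d]
              mult_carrier_mat[of _ d d _ d])
      qed
      finally show "mat_trace (R y * (R w * (?B * R (inv' w)))) = (\<Sum>z\<in>?Z. of_int (sign z) * mat_trace (R (k y z)))"
        using R_carrier kp[OF y] by (simp add: msum_trace mat_trace_smult[of _ d])
    qed
    finally show ?thesis by simp
  qed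
  finally have nz': "mat_trace (?A * (R w * (?B * R (inv' w)))) \<noteq> 0" using nz by simp
  have "?A \<noteq> 0\<^sub>m d d"
  proof
    assume "?A = 0\<^sub>m d d"
    moreover have "R w * (?B * R (inv' w)) \<in> carrier_mat d d"
      using R_carrier w(1) wi by (auto intro!: mult_carrier_mat[of _ d d _ d])
    ultimately show False using nz' mat_trace_zero[of d] by (metis left_mult_zero_mat)
  qed
  moreover have "?B \<noteq> 0\<^sub>m d d"
  proof
    assume "?B = 0\<^sub>m d d"
    then have "R w * (?B * R (inv' w)) = 0\<^sub>m d d"
      using R_carrier[OF w(1)] R_carrier[OF wi] by simp
    then show False using nz' mat_trace_zero right_mult_zero_mat[OF row_sum_carrier] by metis
  qed
  ultimately show ?thesis using labelled_iff_nonzero[OF R refl \<alpha>] by blast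
qed

text \<open>The coefficient of g can be taken as a sign on the double coset of w and as 0 off it. It
  does not depend on the representation, which is what makes two of them comparable.\<close>

lemma sandwich_coefficients:
  assumes \<alpha>: "\<alpha> \<in> partitions n"
  obtains w c where "w permutes {1..n}"
    "\<And>d R g. sym_rep n d R \<Longrightarrow> g permutes {1..n} \<Longrightarrow>
      sym_rep.sandwich d R \<alpha> (conj_part \<alpha>) g = c g \<cdot>\<^sub>m sym_rep.sandwich d R \<alpha> (conj_part \<alpha>) w"
proof -
  have s: "sum_list \<alpha> = n" "sum_list (conj_part \<alpha>) = n"
    using \<alpha> by (simp_all add: sum_list_partition sum_list_conj_part)
  obtain w where w: "w permutes {1..n}" "admissible \<alpha> (conj_part \<alpha>) w"
    using admissible_exists[OF \<alpha>] by blast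
  have "\<exists>k. \<forall>d R. sym_rep n d R \<longrightarrow>
      sym_rep.sandwich d R \<alpha> (conj_part \<alpha>) g = k \<cdot>\<^sub>m sym_rep.sandwich d R \<alpha> (conj_part \<alpha>) w"
    if g: "g permutes {1..n}" for g
  proof (cases "admissible \<alpha> (conj_part \<alpha>) g")
    case True
    obtain y z where yz: "y \<in> young_subgroup \<alpha>" "z \<in> young_subgroup (conj_part \<alpha>)" "g = y \<circ> w \<circ> z"
      using admissible_double_coset[OF \<alpha> g True w] by metis
    then show ?thesis using sym_rep.sandwich_double_coset[OF _ s yz(1,2) w(1)] by blast
  next
    case False
    have "sym_rep.sandwich d R \<alpha> (conj_part \<alpha>) g = 0 \<cdot>\<^sub>m sym_rep.sandwich d R \<alpha> (conj_part \<alpha>) w"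
      if "sym_rep n d R" for d R
      using sym_rep.sandwich_not_admissible[OF that s g False] sym_rep.sandwich_carrier[OF that w(1), of \<alpha> "conj_part \<alpha>"]
      by (auto intro!: eq_matI)
    then show ?thesis by blast
  qed
  then obtain c where "\<And>d R g. sym_rep n d R \<Longrightarrow> g permutes {1..n} \<Longrightarrow>
      sym_rep.sandwich d R \<alpha> (conj_part \<alpha>) g = c g \<cdot>\<^sub>m sym_rep.sandwich d R \<alpha> (conj_part \<alpha>) w"
    by metis
  then show ?thesis using that w(1) by blast
qed

text \<open>If two distinct irreducible characters had the same label, the central element given by the
  first one would act on the one-dimensional space of sandwiched group elements both as a nonzero
  scalar and as zero.\<close>

lemma labelled_unique:
  assumes \<alpha>: "\<alpha> \<in> partitions n" and l: "labelled n \<alpha> \<chi>" "labelled n \<alpha> \<psi>"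
  shows "\<chi> = \<psi>"
proof (rule ccontr)
  assume ne: "\<chi> \<noteq> \<psi>"
  interpret S: fin_group "sym_group n" by (rule fin_group_sym)
  let ?S = "carrier (sym_group n)"
  obtain d R where R: "irreducible_rep (sym_group n) d R" "\<chi> = (\<lambda>g\<in>?S. mat_trace (R g))"
    using l(1) unfolding labelled_def irreducible_character_def by blast
  obtain e Q where Q: "irreducible_rep (sym_group n) e Q" "\<psi> = (\<lambda>g\<in>?S. mat_trace (Q g))"
    using l(2) unfolding labelled_def irreducible_character_def by blast
  interpret R: sym_rep n d R by unfold_locales (rule S.irreducible_repD(1)[OF R(1)])
  interpret Q: sym_rep n e Q by unfold_locales (rule S.irreducible_repD(1)[OF Q(1)])
  obtain w c where w: "w permutes {1..n}" and c: "\<And>d R g. sym_rep n d R \<Longrightarrow> g permutes {1..n} \<Longrightarrow>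
      sym_rep.sandwich d R \<alpha> (conj_part \<alpha>) g = c g \<cdot>\<^sub>m sym_rep.sandwich d R \<alpha> (conj_part \<alpha>) w"
    using sandwich_coefficients[OF \<alpha>] by metis
  note cR = c[OF R.sym_rep_axioms] and cQ = c[OF Q.sym_rep_axioms]
  let ?MR = "R.sandwich \<alpha> (conj_part \<alpha>) w" and ?MQ = "Q.sandwich \<alpha> (conj_part \<alpha>) w"
  have "row_sum d R \<alpha> \<noteq> 0\<^sub>m d d" "col_sum d R (conj_part \<alpha>) \<noteq> 0\<^sub>m d d"
    using labelled_iff_nonzero[OF R \<alpha>] l(1) by auto
  then obtain g where "g \<in> ?S" "R.sandwich \<alpha> (conj_part \<alpha>) g \<noteq> 0\<^sub>m d d"
    using S.irreducible_rep_product_nonzero[OF R(1) R.row_sum_carrier _ R.col_sum_carrier]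
    unfolding R.sandwich_def by blast
  then have MR: "?MR \<noteq> 0\<^sub>m d d" using cR[of g] by (auto simp: sym_group_carrier)
  have "row_sum e Q \<alpha> \<noteq> 0\<^sub>m e e" "col_sum e Q (conj_part \<alpha>) \<noteq> 0\<^sub>m e e"
    using labelled_iff_nonzero[OF Q \<alpha>] l(2) by auto
  then obtain g where "g \<in> ?S" "Q.sandwich \<alpha> (conj_part \<alpha>) g \<noteq> 0\<^sub>m e e"
    using S.irreducible_rep_product_nonzero[OF Q(1) Q.row_sum_carrier _ Q.col_sum_carrier]
    unfolding Q.sandwich_def by blast
  then have MQ: "?MQ \<noteq> 0\<^sub>m e e" using cQ[of g] by (auto simp: sym_group_carrier)
  have scal: "k = k'" if M: "k \<cdot>\<^sub>m M = k' \<cdot>\<^sub>m M" "M \<in> carrier_mat a a" "M \<noteq> 0\<^sub>m a a" for k k' :: complex and M a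
  proof -
    obtain i j where ij: "i < a" "j < a" "M $$ (i, j) \<noteq> 0"
      using M(2,3) by (metis eq_matI carrier_matD index_zero_mat)
    have "(k \<cdot>\<^sub>m M) $$ (i, j) = (k' \<cdot>\<^sub>m M) $$ (i, j)" using M(1) by simp
    then show ?thesis using ij M(2) by simp
  qed
  define f where "f g = cnj (mat_trace (R g))" for g
  have f: "S.class_fun f"
    using S.trace_conj[OF S.irreducible_repD(1)[OF R(1)]] by (simp add: S.class_fun_def f_def)
  have fi: "f g = mat_trace (R (inv\<^bsub>sym_group n\<^esub> g))" if "g \<in> ?S" for g
    using S.trace_inv[OF S.irreducible_repD(1)[OF R(1)] that] by (simp add: f_def)
  \<comment> \<open>\<open>?C\<close> is built from \<open>f\<close>, \<open>c\<close> and w only,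
    so the same number has to equal the scalar for \<open>R\<close> and the scalar for
    \<open>Q\<close>.\<close>
  let ?C = "\<Sum>g\<in>?S. f g * c (w \<circ> g)"
  have "(\<Sum>g\<in>?S. f g * mat_trace (R g)) = of_nat (Coset.order (sym_group n))"
    using S.trace_norm[OF R(1)] by (simp add: fi mult.commute cong: sum.cong)
  then have "(of_nat (Coset.order (sym_group n)) / of_nat d) \<cdot>\<^sub>m ?MR = ?C \<cdot>\<^sub>m ?MR"
    using R.sandwich_class_sum[OF w S.class_fun_average_scalar[OF R(1) f] cR] by simp
  then have 1: "of_nat (Coset.order (sym_group n)) / of_nat d = ?C"
    using scal[OF _ R.sandwich_carrier[OF w] MR] by blast
  obtain g0 where g0: "g0 \<in> ?S" "mat_trace (Q g0) \<noteq> mat_trace (R g0)"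
    using ne R(2) Q(2) by (metis (no_types, lifting) restrict_ext)
  have "(\<Sum>g\<in>?S. f g * mat_trace (Q g)) = 0"
    using S.trace_orthogonality[OF Q(1) R(1) g0] by (simp add: fi mult.commute cong: sum.cong)
  then have "0 \<cdot>\<^sub>m ?MQ = ?C \<cdot>\<^sub>m ?MQ"
    using Q.sandwich_class_sum[OF w S.class_fun_average_scalar[OF Q(1) f] cQ] by simp
  then have 2: "0 = ?C" using scal[OF _ Q.sandwich_carrier[OF w] MQ] by blast
  show False using 1 2 S.order_pos S.irreducible_repD(2)[OF R(1)] by simp
qed

lemma irr_sym_labelled:
  assumes "\<alpha> \<in> partitions n"
  shows "labelled n \<alpha> (irr_sym \<alpha>)"
proof -
  have "irr_sym \<alpha> = (THE \<chi>. labelled n \<alpha> \<chi>)"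
    unfolding irr_sym_def labelled_def Let_def sum_list_partition[OF assms] ..
  moreover have "\<exists>!\<chi>. labelled n \<alpha> \<chi>" using labelled_exists[OF assms] labelled_unique[OF assms] by blast
  ultimately show ?thesis by (simp add: theI')
qed

lemma irr_sym_eqI: "\<alpha> \<in> partitions n \<Longrightarrow> labelled n \<alpha> \<chi> \<Longrightarrow> irr_sym \<alpha> = \<chi>"
  using labelled_unique irr_sym_labelled by blast

lemma irr_sym_irreducible: "\<alpha> \<in> partitions n \<Longrightarrow> irreducible_character (sym_group n) (irr_sym \<alpha>)"
  using irr_sym_labelled by (auto simp: labelled_def)

text \<open>A common character has a nonzero row sum for \<open>\<alpha>\<close> and a nonzero
  column sum for the conjugate of \<open>\<beta>\<close>, so some sandwich is nonzero, its g is
  admissible, and the partial sums of \<open>\<alpha>\<close> are bounded by those of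
  \<open>\<beta>\<close>. Exchanging the two shapes gives equality.\<close>

lemma irr_sym_inj:
  assumes \<alpha>: "\<alpha> \<in> partitions n" and \<beta>: "\<beta> \<in> partitions n" and e: "irr_sym \<alpha> = irr_sym \<beta>"
  shows "\<alpha> = \<beta>"
proof -
  interpret S: fin_group "sym_group n" by (rule fin_group_sym)
  have dom: "(\<Sum>i<s. part \<alpha> i) \<le> (\<Sum>i<s. part \<beta> i)"
    if \<alpha>: "\<alpha> \<in> partitions n" and \<beta>: "\<beta> \<in> partitions n" and e: "irr_sym \<alpha> = irr_sym \<beta>" for \<alpha> \<beta> s
  proof -
    obtain d R where R: "irreducible_rep (sym_group n) d R"
      "irr_sym \<alpha> = (\<lambda>g\<in>carrier (sym_group n). mat_trace (R g))"
      using irr_sym_irreducible[OF \<alpha>] unfolding irreducible_character_def by blast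
    interpret sym_rep n d R by unfold_locales (rule S.irreducible_repD(1)[OF R(1)])
    have "row_sum d R \<alpha> \<noteq> 0\<^sub>m d d" using labelled_iff_nonzero[OF R \<alpha>] irr_sym_labelled[OF \<alpha>] by blast
    moreover have "col_sum d R (conj_part \<beta>) \<noteq> 0\<^sub>m d d"
      using labelled_iff_nonzero[OF R(1) R(2)[unfolded e] \<beta>] irr_sym_labelled[OF \<beta>] by blast
    ultimately obtain g where g: "g \<in> carrier (sym_group n)" "sandwich \<alpha> (conj_part \<beta>) g \<noteq> 0\<^sub>m d d"
      using S.irreducible_rep_product_nonzero[OF R(1) row_sum_carrier _ col_sum_carrier]
      unfolding sandwich_def by blast
    then have gp: "g permutes {1..n}" by (simp add: sym_group_carrier)
    have "admissible \<alpha> (conj_part \<beta>) g"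
      using sandwich_not_admissible[OF sum_list_partition[OF \<alpha>] sum_list_conj_part[OF \<beta>] gp] g(2) by blast
    from filling.dominance[OF admissible_filling[OF \<alpha> \<beta> gp this]] show ?thesis .
  qed
  have "(\<Sum>i<s. part \<alpha> i) = (\<Sum>i<s. part \<beta> i)" for s
    using dom[OF \<alpha> \<beta> e] dom[OF \<beta> \<alpha> e[symmetric]] by (simp add: antisym)
  from this[of "Suc _"] this have "part \<alpha> i = part \<beta> i" for i
    by (metis add_left_cancel sum.lessThan_Suc)
  then show ?thesis by (rule partition_eqI[OF \<alpha> \<beta>])
qed

lemma irr_sym_orthonormal:
  assumes "\<alpha> \<in> partitions n" "\<beta> \<in> partitions n"
  shows "char_inner (sym_group n) (irr_sym \<alpha>) (irr_sym \<beta>) = (if \<alpha> = \<beta> then 1 else 0)"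
proof (cases "\<alpha> = \<beta>")
  case True
  then show ?thesis
    using fin_group.irreducible_character_norm[OF fin_group_sym irr_sym_irreducible[OF assms(1)]] by simp
next
  case False
  then have "irr_sym \<alpha> \<noteq> irr_sym \<beta>" using irr_sym_inj[OF assms] by blast
  then show ?thesis using False
    fin_group.irreducible_characters_orthogonal[OF fin_group_sym irr_sym_irreducible[OF assms(1)]
      irr_sym_irreducible[OF assms(2)]] by simp
qed

lemma irr_sym_class_fun: "\<alpha> \<in> partitions n \<Longrightarrow> fin_group.class_fun (sym_group n) (irr_sym \<alpha>)"
  by (rule fin_group.irreducible_character_class_fun[OF fin_group_sym irr_sym_irreducible])

section \<open>Conjugacy in symmetric groups\<close>

definition orb :: "('a \<Rightarrow> 'a) \<Rightarrow> 'a \<Rightarrow> 'a set" where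
  "orb p x = set (support p x)"

lemma mem_orb: "permutation p \<Longrightarrow> y \<in> orb p x \<longleftrightarrow> (\<exists>i. y = (p ^^ i) x)"
  unfolding orb_def support_set by auto

lemma orb_self: "permutation p \<Longrightarrow> x \<in> orb p x"
  unfolding mem_orb by (rule exI[of _ 0]) simp

lemma orb_eq: "permutation p \<Longrightarrow> y \<in> orb p x \<Longrightarrow> orb p y = orb p x"
  using disjoint_support[of p] orb_self[of p y] unfolding disjoint_def orb_def by blast

lemma orb_subset:
  assumes "finite X" "r permutes X" "x \<in> X"
  shows "orb r x \<subseteq> X"
proof -
  have "permutation r" using assms permutation_permutes by blast
  then show ?thesis using permutes_in_image[OF permutes_funpow[OF assms(2)]] assms(3) by (auto simp: mem_orb)
qed

lemma card_orb: "permutation p \<Longrightarrow> card (orb p x) = least_power p x"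
  using distinct_card[OF cycle_of_permutation] by (force simp: orb_def)

lemma funpow_eq_iff:
  assumes "permutation p"
  shows "i \<le> j \<Longrightarrow> (p ^^ i) a = (p ^^ j) a \<longleftrightarrow> least_power p a dvd (j - i)"
proof -
  assume ij: "i \<le> j"
  have "(p ^^ j) a = (p ^^ i) ((p ^^ (j - i)) a)" using ij by (simp flip: funpow_add comp_apply[of "p ^^ i"])
  moreover have "inj (p ^^ i)" using assms permutation_bijective bij_is_inj inj_fn by blast
  ultimately have "(p ^^ i) a = (p ^^ j) a \<longleftrightarrow> (p ^^ (j - i)) a = a" by (metis inj_eq)
  then show ?thesis using least_power_dvd[OF assms] by simp
qed

text \<open>Cycles of equal length are matched by \<open>u\<close> and given base points a and b; s
  carries the i-th iterate of one base point to the i-th iterate of the other.\<close>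

lemma conjugate_if_same_orbit_sizes:
  assumes X: "finite X" and p: "p permutes X" and q: "q permutes X"
    and sizes: "\<And>c. card {B\<in>orb p ` X. card B = c} = card {B\<in>orb q ` X. card B = c}"
  obtains s where "s permutes X" "s \<circ> p = q \<circ> s"
proof -
  have pp: "permutation p" and qp: "permutation q" using p q X permutation_permutes by blast+
  obtain u where u: "bij_betw u (orb p ` X) (orb q ` X)" "\<And>B. B \<in> orb p ` X \<Longrightarrow> card (u B) = card B"
    using bij_betw_fibres[of "orb p ` X" "orb q ` X" card card] X sizes by auto
  have uB: "u (orb p x) \<in> orb q ` X" if "x \<in> X" for x using bij_betwE[OF u(1)] that by blast
  define a where "a B = (SOME x. x \<in> B)" for B :: "'a set"
  define b where "b B = (SOME x. x \<in> u B)" for B :: "'a set"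
  have a: "a (orb p x) \<in> orb p x" for x
    unfolding a_def using someI[of "\<lambda>y. y \<in> orb p x"] orb_self[OF pp] by blast
  have b: "b (orb p x) \<in> u (orb p x)" if x: "x \<in> X" for x
  proof -
    obtain y where "u (orb p x) = orb q y" using uB[OF x] by blast
    then show ?thesis unfolding b_def using someI[of "\<lambda>z. z \<in> u (orb p x)"] orb_self[OF qp] by blast
  qed
  have ub: "u (orb p x) = orb q (b (orb p x))" if x: "x \<in> X" for x
  proof -
    obtain y where y: "u (orb p x) = orb q y" using uB[OF x] by blast
    then show ?thesis using b[OF x] orb_eq[OF qp] by blast
  qed
  note orb_sub = orb_subset[OF X]
  have same_len: "least_power p (a (orb p x)) = least_power q (b (orb p x))" if "x \<in> X" for x
  proof -
    have "card (u (orb p x)) = card (orb p x)" using u(2) that by blast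
    then have "card (orb q (b (orb p x))) = card (orb p x)" using ub[OF that] by simp
    moreover have "orb p x = orb p (a (orb p x))" using orb_eq[OF pp a] by simp
    ultimately show ?thesis using card_orb[OF pp] card_orb[OF qp] by metis
  qed
  have "\<exists>i. x = (p ^^ i) (a (orb p x))" for x
    using orb_eq[OF pp a, of x] orb_self[OF pp, of x] mem_orb[OF pp] by blast
  then obtain i where i: "\<And>x. x = (p ^^ i x) (a (orb p x))" by metis
  define s where "s x = (if x \<in> X then (q ^^ i x) (b (orb p x)) else x)" for x
  \<comment> \<open>The exponent is determined only modulo the cycle length; as matched cycles have
    the same length, any exponent gives the same value.\<close>
  have key: "s x = (q ^^ j) (b (orb p x))" if x: "x \<in> X" "x = (p ^^ j) (a (orb p x))" for x j
  proof -
    have "(p ^^ i x) (a (orb p x)) = (p ^^ j) (a (orb p x))" using i[of x] x(2) by simp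
    then have "(q ^^ i x) (b (orb p x)) = (q ^^ j) (b (orb p x))"
      using funpow_eq_iff[OF pp, of "i x" j] funpow_eq_iff[OF pp, of j "i x"]
        funpow_eq_iff[OF qp, of "i x" j] funpow_eq_iff[OF qp, of j "i x"] same_len[OF x(1)]
      by (metis nle_le)
    then show ?thesis using x(1) by (simp add: s_def)
  qed
  have sX: "s x \<in> X" if x: "x \<in> X" for x
  proof -
    have "s x \<in> orb q (b (orb p x))" using x by (auto simp: s_def mem_orb[OF qp])
    moreover have "b (orb p x) \<in> X"
    proof -
      obtain y where "y \<in> X" "u (orb p x) = orb q y" using uB[OF x] by blast
      then show ?thesis using b[OF x] orb_sub[OF q] by blast
    qed
    ultimately show ?thesis using orb_sub[OF q] by blast
  qed
  have "y \<in> s ` X" if y: "y \<in> X" for y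
  proof -
    obtain z where z: "z \<in> X" "orb q y = u (orb p z)"
      using bij_betw_imp_surj_on[OF u(1)] y by (metis (no_types, lifting) imageE imageI)
    then have "y \<in> orb q (b (orb p z))" using ub[OF z(1)] orb_self[OF qp, of y] by simp
    then obtain j where j: "y = (q ^^ j) (b (orb p z))" using mem_orb[OF qp] by blast
    define x where "x = (p ^^ j) (a (orb p z))"
    have "x \<in> orb p (a (orb p z))" unfolding x_def mem_orb[OF pp] by blast
    then have x: "orb p x = orb p z" using orb_eq[OF pp] a by blast
    then have xX: "x \<in> X" using orb_sub[OF p z(1)] orb_self[OF pp, of x] by blast
    have "s x = y" using key[OF xX, of j] x j by (simp add: x_def)
    then show ?thesis using xX by blast
  qed
  then have "s ` X = X" using sX by blast
  then have "bij_betw s X X" using X by (simp add: bij_betw_def eq_card_imp_inj_on)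
  then have "s permutes X" by (rule bij_imp_permutes) (simp add: s_def)
  moreover have "s (p x) = q (s x)" for x
  proof (cases "x \<in> X")
    case True
    have "p x \<in> orb p x" unfolding mem_orb[OF pp] by (rule exI[of _ 1]) simp
    then have o: "orb p (p x) = orb p x" by (rule orb_eq[OF pp])
    have "p x \<in> X" using permutes_in_image[OF p] True by simp
    moreover have "p x = (p ^^ Suc (i x)) (a (orb p (p x)))" using i[of x] o by simp
    ultimately have "s (p x) = (q ^^ Suc (i x)) (b (orb p (p x)))" by (rule key)
    then show ?thesis using o True by (simp add: s_def)
  next
    case False
    then show ?thesis using permutes_not_in[OF p] permutes_not_in[OF q] by (simp add: s_def)
  qed
  ultimately show ?thesis using that by (auto simp: fun_eq_iff)
qed

definition cycle_type :: "nat \<Rightarrow> (nat \<Rightarrow> nat) \<Rightarrow> nat list" where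
  "cycle_type n p = rev (sorted_list_of_multiset (image_mset card (mset_set (orb p ` {1..n}))))"

lemma cycle_type_in_partitions:
  assumes "p permutes {1..n}"
  shows "cycle_type n p \<in> partitions n"
proof -
  have pp: "permutation p" using assms permutation_permutes by blast
  have "sorted_wrt (\<ge>) (cycle_type n p)"
    by (simp add: cycle_type_def sorted_wrt_rev)
  moreover have "0 \<notin> set (cycle_type n p)"
  proof
    assume "0 \<in> set (cycle_type n p)"
    then obtain x where "least_power p x = 0" by (auto simp: cycle_type_def card_orb[OF pp])
    then show False using least_power_of_permutation(2)[OF pp, of x] by simp
  qed
  moreover have "sum_list (cycle_type n p) = n"
  proof -
    have orb_sub: "orb p x \<subseteq> {1..n}" if "x \<in> {1..n}" for x
      by (rule orb_subset[OF _ assms that]) simp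
    have "sum_list (cycle_type n p) = sum_mset (mset (cycle_type n p))" by (simp only: sum_mset_sum_list)
    also have "\<dots> = (\<Sum>B\<in>orb p ` {1..n}. card B)"
      by (simp add: cycle_type_def sum_unfold_sum_mset)
    also have "\<dots> = card (\<Union> (orb p ` {1..n}))"
      by (rule card_Union_disjoint[symmetric])
        (use disjoint_support[OF pp] in \<open>auto simp: disjoint_def pairwise_def disjnt_def orb_def\<close>)
    also have "\<Union> (orb p ` {1..n}) = {1..n}" using orb_sub orb_self[OF pp] by blast
    finally show ?thesis by simp
  qed
  ultimately show ?thesis by (simp add: partitions_def)
qed

lemma cycle_type_conjugate:
  assumes p: "p permutes {1..n}" and q: "q permutes {1..n}" and e: "cycle_type n p = cycle_type n q"
  obtains s where "s permutes {1..n}" "s \<circ> p \<circ> inv' s = q"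
proof -
  have "mset (cycle_type n p) = mset (cycle_type n q)" using e by simp
  then have m: "image_mset card (mset_set (orb p ` {1..n})) = image_mset card (mset_set (orb q ` {1..n}))"
    by (simp add: cycle_type_def)
  have c: "count (image_mset card (mset_set (orb r ` {1..n}))) c = card {B\<in>orb r ` {1..n}. card B = c}" for r c
    by (simp add: count_image_mset' ) (rule arg_cong[where f = card], auto)
  have "card {B\<in>orb p ` {1..n}. card B = c} = card {B\<in>orb q ` {1..n}. card B = c}" for c
    using arg_cong[OF m, of "\<lambda>M. count M c"] c[of p c] c[of q c] by simp
  then obtain s where s: "s permutes {1..n}" "s \<circ> p = q \<circ> s"
    using conjugate_if_same_orbit_sizes[OF _ p q] by (metis finite_atLeastAtMost)
  then have "s \<circ> p \<circ> inv' s = q" using permutes_inverses(1)[OF s(1)] by (simp add: fun_eq_iff)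
  then show ?thesis using that s(1) by blast
qed

section \<open>Completeness of the labelled characters\<close>

lemma finite_partitions: "finite (partitions n)"
proof (rule finite_subset)
  show "partitions n \<subseteq> {xs. set xs \<subseteq> {..n} \<and> length xs \<le> n}"
  proof
    fix xs assume xs: "xs \<in> partitions n"
    have "length xs = (\<Sum>x\<leftarrow>xs. 1)" by (simp add: sum_list_triv)
    also have "\<dots> \<le> (\<Sum>x\<leftarrow>xs. x)"
      using xs by (intro sum_list_mono) (auto simp: partitions_def Suc_le_eq intro: gr0I)
    finally show "xs \<in> {xs. set xs \<subseteq> {..n} \<and> length xs \<le> n}"
      using xs member_le_sum_list[of _ xs] by (auto simp: partitions_def)
  qed
  show "finite {xs. set xs \<subseteq> {..n} \<and> length xs \<le> n}" by (rule finite_lists_length_le) simp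
qed

definition sym_class_fun :: "nat \<Rightarrow> ((nat \<Rightarrow> nat) \<Rightarrow> complex) \<Rightarrow> bool" where
  "sym_class_fun n f \<longleftrightarrow> (\<forall>g h. g permutes {1..n} \<longrightarrow> h permutes {1..n} \<longrightarrow> f (h \<circ> g \<circ> inv' h) = f g)"

lemma sym_class_fun_iff: "sym_class_fun n f \<longleftrightarrow> fin_group.class_fun (sym_group n) f"
  unfolding sym_class_fun_def fin_group.class_fun_def[OF fin_group_sym]
  by (auto simp: sym_group_carrier sym_group_mult inv_sym_group)

lemma sym_class_funD:
  "sym_class_fun n f \<Longrightarrow> g permutes {1..n} \<Longrightarrow> h permutes {1..n} \<Longrightarrow> f (h \<circ> g \<circ> inv' h) = f g"
  by (simp add: sym_class_fun_def)

lemma irr_sym_class: "\<alpha> \<in> partitions n \<Longrightarrow> sym_class_fun n (irr_sym \<alpha>)"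
  by (simp add: sym_class_fun_iff irr_sym_class_fun)

lemma sym_class_fun_eq:
  assumes "sym_class_fun n f" "p permutes {1..n}" "q permutes {1..n}" "cycle_type n p = cycle_type n q"
  shows "f p = f q"
  using cycle_type_conjugate[OF assms(2-4)] sym_class_funD[OF assms(1,2)] by metis

text \<open>A class function is fixed by its values on one permutation per cycle type, so a linear
  relation between class functions amounts to at most N = \<open>card (partitions n)\<close>
  equations, in N + 1 unknowns.\<close>

lemma class_functions_dependent:
  assumes F: "\<And>j. j \<le> card (partitions n) \<Longrightarrow> sym_class_fun n (F j)"
  obtains v where "\<exists>j\<le>card (partitions n). v j \<noteq> 0"
    "\<And>g. g permutes {1..n} \<Longrightarrow> (\<Sum>j\<le>card (partitions n). v j * F j g) = 0"
proof -
  define N where "N = card (partitions n)"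
  obtain e where e: "bij_betw e {0..<N} (partitions n)"
    using ex_bij_betw_nat_finite[OF finite_partitions] by (auto simp: N_def)
  \<comment> \<open>Meaningful only for cycle types that occur; its defining property is invoked
    below only for the type of a given permutation g.\<close>
  define rep where "rep i = (SOME g. g permutes {1..n} \<and> cycle_type n g = e i)" for i
  define row where "row i = vec (Suc N) (\<lambda>j. F j (rep i))" for i
  \<comment> \<open>A zero row completes the N equations in N + 1 unknowns to a square system, so
    that a vanishing determinant yields the relation.\<close>
  define M where "M = mat\<^sub>r (Suc N) (Suc N) (\<lambda>i. if i = N then 0\<^sub>v (Suc N) else row i)"
  have Mc: "M \<in> carrier_mat (Suc N) (Suc N)" by (simp add: M_def)
  have "det M = 0" unfolding M_def by (rule det_row_0) (auto simp: row_def)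
  then obtain u where u: "u \<in> carrier_vec (Suc N)" "u \<noteq> 0\<^sub>v (Suc N)" "M *\<^sub>v u = 0\<^sub>v (Suc N)"
    using det_0_iff_vec_prod_zero_field[OF Mc] by blast
  have "\<exists>j\<le>N. u $ j \<noteq> 0"
  proof (rule ccontr)
    assume "\<not> (\<exists>j\<le>N. u $ j \<noteq> 0)"
    then have "u = 0\<^sub>v (Suc N)" using u(1) by (intro eq_vecI) auto
    then show False using u(2) by simp
  qed
  moreover have "(\<Sum>j\<le>N. u $ j * F j g) = 0" if g: "g permutes {1..n}" for g
  proof -
    have "cycle_type n g \<in> e ` {0..<N}"
      using cycle_type_in_partitions[OF g] bij_betw_imp_surj_on[OF e] by simp
    then obtain i where i: "i < N" "cycle_type n g = e i" by auto
    then have r: "rep i permutes {1..n} \<and> cycle_type n (rep i) = e i"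
      unfolding rep_def using g by (intro someI_ex[of "\<lambda>g. g permutes {1..n} \<and> cycle_type n g = e i"]) auto
    have "(M *\<^sub>v u) $ i = (\<Sum>j = 0..<Suc N. M $$ (i, j) * u $ j)"
      using i by (intro mat_mult_vec_entry[OF Mc u(1)]) simp
    also have "\<dots> = (\<Sum>j = 0..<Suc N. u $ j * F j g)"
    proof (rule sum.cong[OF refl])
      fix j assume j: "j \<in> {0..<Suc N}"
      then have "M $$ (i, j) = F j (rep i)" using i by (simp add: M_def row_def)
      also have "\<dots> = F j g" using r g i j F by (intro sym_class_fun_eq) (auto simp: N_def)
      finally show "M $$ (i, j) * u $ j = u $ j * F j g" by simp
    qed
    finally show ?thesis using u(3) i by (simp add: atLeast0LessThan lessThan_Suc_atMost)
  qed
  ultimately show ?thesis using that[of "\<lambda>j. u $ j"] by (simp add: N_def)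
qed

lemma char_inner_sum:
  "char_inner G (\<lambda>g. \<Sum>i\<in>I. c i * f i g) \<psi> = (\<Sum>i\<in>I. c i * char_inner G (f i) \<psi>)"
proof -
  have "(\<Sum>g\<in>carrier G. (\<Sum>i\<in>I. c i * f i g) * cnj (\<psi> g)) = (\<Sum>i\<in>I. c i * (\<Sum>g\<in>carrier G. f i g * cnj (\<psi> g)))"
    by (subst sum_distrib_left, subst sum.swap) (simp add: sum_distrib_right mult.assoc)
  then show ?thesis
    by (simp only: char_inner_def sum_divide_distrib[where A = I] times_divide_eq_right)
qed

lemma char_inner_diff: "char_inner G (\<lambda>g. f g - f' g) \<psi> = char_inner G f \<psi> - char_inner G f' \<psi>"
  by (simp add: char_inner_def left_diff_distrib sum_subtractf diff_divide_distrib)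

text \<open>The remainder \<open>\<psi>\<close> is orthogonal to every labelled character. In a
  nontrivial relation between these characters and \<open>\<psi>\<close>, pairing with a character
  kills its coefficient, so only the coefficient of \<open>\<psi>\<close> survives and
  \<open>\<psi>\<close> vanishes.\<close>

theorem irr_sym_expansion:
  assumes \<phi>: "sym_class_fun n \<phi>" and g: "g permutes {1..n}"
  shows "\<phi> g = (\<Sum>\<alpha>\<in>partitions n. char_inner (sym_group n) \<phi> (irr_sym \<alpha>) * irr_sym \<alpha> g)"
proof -
  let ?S = "sym_group n"
  define \<psi> where "\<psi> h = \<phi> h - (\<Sum>\<alpha>\<in>partitions n. char_inner ?S \<phi> (irr_sym \<alpha>) * irr_sym \<alpha> h)" for h
  have \<psi>: "sym_class_fun n \<psi>"
    using \<phi> irr_sym_class by (simp add: sym_class_fun_def \<psi>_def)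
  have orth: "char_inner ?S \<psi> (irr_sym \<beta>) = 0" if \<beta>: "\<beta> \<in> partitions n" for \<beta>
    unfolding \<psi>_def char_inner_diff char_inner_sum
    using \<beta> by (simp add: irr_sym_orthonormal finite_partitions if_distrib cong: if_cong)
  define N where "N = card (partitions n)"
  obtain e where e: "bij_betw e {0..<N} (partitions n)"
    using ex_bij_betw_nat_finite[OF finite_partitions] by (auto simp: N_def)
  have ep: "e j \<in> partitions n" if "j < N" for j using bij_betwE[OF e] that by auto
  have einj: "e i = e j \<longleftrightarrow> i = j" if "i < N" "j < N" for i j
    using bij_betw_imp_inj_on[OF e] that by (auto dest: inj_onD)
  define F where "F j = (if j = N then \<psi> else irr_sym (e j))" for j
  have "sym_class_fun n (F j)" if "j \<le> N" for j
    using that \<psi> ep irr_sym_class by (simp add: F_def)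
  then obtain v where v: "\<exists>j\<le>N. v j \<noteq> 0"
    "\<And>g. g permutes {1..n} \<Longrightarrow> (\<Sum>j\<le>N. v j * F j g) = 0"
    using class_functions_dependent[of n F] unfolding N_def by metis
  have v0: "v i = 0" if i: "i < N" for i
  proof -
    have "0 = char_inner ?S (\<lambda>g. \<Sum>j\<le>N. v j * F j g) (irr_sym (e i))"
      using v(2) by (simp add: char_inner_def sym_group_carrier sum.neutral)
    also have "\<dots> = (\<Sum>j\<le>N. if j = i then v i else 0)"
      unfolding char_inner_sum using i ep orth einj
      by (intro sum.cong) (auto simp: F_def irr_sym_orthonormal)
    finally show ?thesis using i by simp
  qed
  then have vN: "v N \<noteq> 0" using v(1) by (metis le_neq_implies_less)
  have "(\<Sum>j\<le>N. v j * F j g) = v N * \<psi> g"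
    using v0 by (subst sum.remove[of _ N]) (auto simp: F_def intro!: sum.neutral)
  then have "\<psi> g = 0" using v(2)[OF g] vN by simp
  then show ?thesis by (simp add: \<psi>_def)
qed

section \<open>Conjugate partitions and the sign character\<close>

text \<open>The twisted matrices differ from the original ones by a factor 1 or -1, so the invariant
  subspaces are the same.\<close>

lemma sign_rep_twist:
  assumes R: "irreducible_rep (sym_group n) d R"
  shows "irreducible_rep (sym_group n) d (\<lambda>g. of_int (sign g) \<cdot>\<^sub>m R g)"
proof -
  interpret S: fin_group "sym_group n" by (rule fin_group_sym)
  let ?R = "\<lambda>g. of_int (sign g) \<cdot>\<^sub>m R g"
  note rep = S.irreducible_repD(1)[OF R]
  interpret sym_rep n d R by unfold_locales (rule rep)
  have "mrep (sym_group n) d ?R"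
    unfolding mrep_def
  proof (intro conjI ballI)
    fix g h assume "g \<in> carrier (sym_group n)" "h \<in> carrier (sym_group n)"
    then have gh: "g permutes {1..n}" "h permutes {1..n}" by (simp_all add: sym_group_carrier)
    have "sign (g \<circ> h) = sign g * sign h"
      using gh permutation_permutes by (intro sign_compose) blast+
    then show "?R (g \<otimes>\<^bsub>sym_group n\<^esub> h) = ?R g * ?R h"
      using R_comp[OF gh] R_carrier[OF gh(1)] R_carrier[OF gh(2)]
      by (simp add: sym_group_mult mult_smult_distrib[of _ d d _ d] mult_smult_assoc_mat[of _ d d _ d]
          mat_smult_smult mult.commute)
  next
    show "?R \<one>\<^bsub>sym_group n\<^esub> = 1\<^sub>m d" using R_id by (auto simp: sym_group_one sign_id)
  qed (use R_carrier in \<open>auto simp: sym_group_carrier\<close>)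
  moreover have "S.invariant R W" if W: "lin_subspace d W" and inv: "S.invariant ?R W" for W
    unfolding S.invariant_def
  proof (intro ballI)
    fix g w assume g: "g \<in> carrier (sym_group n)" and w: "w \<in> W"
    have Rg: "R g \<in> carrier_mat d d" using R_carrier g by (simp add: sym_group_carrier)
    have wd: "w \<in> carrier_vec d" using W w by (auto simp: lin_subspace_def)
    have "of_int (sign g) \<cdot>\<^sub>v (?R g *\<^sub>v w) \<in> W"
      using inv g w W by (auto simp: S.invariant_def lin_subspace_def)
    also have "of_int (sign g) \<cdot>\<^sub>v (?R g *\<^sub>v w) = R g *\<^sub>v w"
    proof (rule eq_vecI)
      fix i assume "i < dim_vec (R g *\<^sub>v w)"
      then have i: "i < d" using Rg by simp
      have "(of_int (sign g) \<cdot>\<^sub>v (?R g *\<^sub>v w)) $ i = (of_int (sign g) * of_int (sign g)) * (R g *\<^sub>v w) $ i"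
        using i Rg wd mat_mult_vec_entry[OF Rg wd i] mat_mult_vec_entry[of "?R g" d d w i]
        by (simp add: sum_distrib_left mult.assoc del: index_mult_mat_vec)
      then show "(of_int (sign g) \<cdot>\<^sub>v (?R g *\<^sub>v w)) $ i = (R g *\<^sub>v w) $ i" by (simp add: sign_sq)
    qed (use Rg in simp)
    finally show "R g *\<^sub>v w \<in> W" .
  qed
  ultimately show ?thesis using R unfolding S.irreducible_rep_iff by blast
qed

text \<open>Twisting by the sign exchanges the two nonvanishing sums that label a character: the
  plain one over the Young subgroup of the shape and the signed one over that of its conjugate. As
  conjugating shapes is an involution, the twisted character carries the conjugate label.\<close>

lemma irr_sym_conj:
  assumes \<alpha>: "\<alpha> \<in> partitions n" and g: "g permutes {1..n}"
  shows "irr_sym (conj_part \<alpha>) g = of_int (sign g) * irr_sym \<alpha> g"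
proof -
  let ?S = "carrier (sym_group n)"
  obtain d R where R: "irreducible_rep (sym_group n) d R" "irr_sym \<alpha> = (\<lambda>g\<in>?S. mat_trace (R g))"
    using irr_sym_irreducible[OF \<alpha>] unfolding irreducible_character_def by blast
  interpret sym_rep n d R
    by unfold_locales (rule fin_group.irreducible_repD(1)[OF fin_group_sym R(1)])
  define \<chi> where "\<chi> = (\<lambda>g\<in>?S. mat_trace (of_int (sign g) \<cdot>\<^sub>m R g))"
  have \<chi>: "\<chi> h = of_int (sign h) * irr_sym \<alpha> h" if "h permutes {1..n}" for h
    using that R_carrier by (simp add: \<chi>_def R(2) sym_group_carrier mat_trace_smult[of _ d])
  have irr: "irreducible_character (sym_group n) \<chi>"
    unfolding irreducible_character_def \<chi>_def using sign_rep_twist[OF R(1)] by blast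
  have \<alpha>': "conj_part \<alpha> \<in> partitions n" using \<alpha> by (rule conj_part_in_partitions)
  have perm: "y permutes {1..n}" if "y \<in> young_subgroup \<mu>" "\<mu> \<in> partitions n" for y \<mu>
    using that by (simp add: young_subgroup_iff sum_list_partition)
  have s: "of_int (sign y) * (of_int (sign y) * x) = (x :: complex)" for x and y :: "nat \<Rightarrow> nat"
    by (simp add: mult.assoc[symmetric] sign_sq)
  have 1: "(\<Sum>y\<in>young_subgroup (conj_part \<alpha>). \<chi> y) =
      (\<Sum>y\<in>young_subgroup (conj_part \<alpha>). of_int (sign y) * irr_sym \<alpha> y)"
    by (rule sum.cong[OF refl], rule \<chi>, erule perm[OF _ \<alpha>'])
  have 2: "(\<Sum>z\<in>young_subgroup \<alpha>. of_int (sign z) * \<chi> z) = (\<Sum>z\<in>young_subgroup \<alpha>. irr_sym \<alpha> z)"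
  proof (rule sum.cong[OF refl])
    fix z assume "z \<in> young_subgroup \<alpha>"
    then show "of_int (sign z) * \<chi> z = irr_sym \<alpha> z" using \<chi>[OF perm[OF _ \<alpha>]] s by metis
  qed
  have "labelled n (conj_part \<alpha>) \<chi>"
    unfolding labelled_iff_sums[OF irr \<alpha>'] conj_part_conj_part[OF \<alpha>] 1 2
    using irr_sym_labelled[OF \<alpha>] labelled_iff_sums[OF irr_sym_irreducible[OF \<alpha>] \<alpha>] by blast
  from irr_sym_eqI[OF \<alpha>' this] show ?thesis using \<chi>[OF g] by simp
qed

text \<open>The Young subgroup of a single column is trivial, and in the signed sum the sign is
  squared, so both labelling sums are positive. For b = 0 this evaluates the character of the empty
  partition, as used in \<open>skew_char_Nil\<close>.\<close>

lemma irr_sym_sign: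
  assumes g: "g permutes {1..b}"
  shows "irr_sym (replicate b 1) g = of_int (sign g)"
proof -
  interpret S: fin_group "sym_group b" by (rule fin_group_sym)
  let ?one = "replicate b (1::nat)"
  have \<alpha>: "?one \<in> partitions b" by (auto simp: partitions_def sum_list_replicate sorted_wrt_iff_nth_less)
  let ?c = "conj_part ?one"
  have c: "sum_list ?c = b" by (rule sum_list_conj_part[OF \<alpha>])
  define R where "R h = mat 1 1 (\<lambda>_. of_int (sign h) :: complex)" for h :: "nat \<Rightarrow> nat"
  have "mrep (sym_group b) 1 R"
    unfolding mrep_def
  proof (intro conjI ballI)
    fix g h assume "g \<in> carrier (sym_group b)" "h \<in> carrier (sym_group b)"
    then have "permutation g" "permutation h" by (auto simp: sym_group_carrier permutation_permutes)
    then show "R (g \<otimes>\<^bsub>sym_group b\<^esub> h) = R g * R h"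
      by (intro eq_matI) (auto simp: R_def sym_group_mult sign_compose scalar_prod_def)
  qed (auto simp: R_def sym_group_one sign_id)
  moreover have "W = {0\<^sub>v 1} \<or> W = carrier_vec 1" if W: "lin_subspace 1 W" for W
  proof (cases "W = {0\<^sub>v 1}")
    case False
    then obtain w where w: "w \<in> W" "w \<noteq> 0\<^sub>v 1" using W by (auto simp: lin_subspace_def)
    have wd: "w \<in> carrier_vec 1" using W w by (auto simp: lin_subspace_def)
    have w0: "w $ 0 \<noteq> 0"
    proof
      assume "w $ 0 = 0"
      then have "w = 0\<^sub>v 1" using wd by (intro eq_vecI) auto
      then show False using w by simp
    qed
    have "v \<in> W" if "v \<in> carrier_vec 1" for v
    proof -
      have "v = (v $ 0 / w $ 0) \<cdot>\<^sub>v w" using that wd w0 by (intro eq_vecI) auto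
      then show ?thesis using W w(1) unfolding lin_subspace_def by metis
    qed
    then show ?thesis using W by (auto simp: lin_subspace_def)
  qed simp
  ultimately have R: "irreducible_rep (sym_group b) 1 R" by (simp add: S.irreducible_rep_iff)
  define \<chi> where "\<chi> = (\<lambda>h\<in>carrier (sym_group b). mat_trace (R h))"
  have \<chi>: "\<chi> h = of_int (sign h)" if "h permutes {1..b}" for h
    using that by (simp add: \<chi>_def sym_group_carrier mat_trace_eq[of _ 1] R_def)
  have irr: "irreducible_character (sym_group b) \<chi>"
    unfolding irreducible_character_def \<chi>_def using R by blast
  have "y = id" if y: "y \<in> young_subgroup ?one" for y
  proof -
    have yp: "y permutes {1..b}" using y by (simp add: young_subgroup_iff sum_list_replicate)
    have "y x = x" if x: "x \<in> {1..b}" for x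
    proof -
      let ?F = "{z\<in>{1..b}. row_of ?one z = row_of ?one x}"
      have "card ?F \<le> 1"
        using card_row_of_fibre[of ?one "row_of ?one x"] by (simp add: sum_list_replicate part_def)
      moreover have "x \<in> ?F" using x by simp
      moreover have "y x \<in> ?F" using x y permutes_in_image[OF yp] by (auto simp: young_subgroup_iff sum_list_replicate)
      moreover have "finite ?F" by simp
      ultimately show ?thesis using card_le_Suc0_iff_eq[of ?F] unfolding One_nat_def by blast
    qed
    then show ?thesis using permutes_not_in[OF yp] by (auto simp: fun_eq_iff)
  qed
  then have "young_subgroup ?one = {id}" using young_subgroup_closed(3) by (auto simp: young_subgroup_iff permutes_id)
  then have 1: "(\<Sum>y\<in>young_subgroup ?one. \<chi> y) \<noteq> 0" using \<chi>[OF permutes_id] by (simp add: sign_id)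
  have "(\<Sum>z\<in>young_subgroup ?c. of_int (sign z) * \<chi> z) = (\<Sum>z\<in>young_subgroup ?c. 1)"
    using c by (intro sum.cong) (auto simp: \<chi> young_subgroup_iff sign_sq)
  then have 2: "(\<Sum>z\<in>young_subgroup ?c. of_int (sign z) * \<chi> z) \<noteq> 0"
    using card_young_subgroup[of ?c] by simp
  have "labelled b ?one \<chi>" unfolding labelled_iff_sums[OF irr \<alpha>] using 1 2 by simp
  from irr_sym_eqI[OF \<alpha> this] show ?thesis using \<chi>[OF g] by simp
qed

section \<open>Restriction to two-block Young subgroups and skew characters\<close>

section \<open>Juxtaposition of permutations\<close>

definition perms :: "nat \<Rightarrow> (nat \<Rightarrow> nat) set" where
  "perms n = {p. p permutes {1..n}}"

lemma mem_perms [simp]: "p \<in> perms n \<longleftrightarrow> p permutes {1..n}"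
  by (simp add: perms_def)

text \<open>The pair (x, y) of S_b x S_c inside S_(b + c). The point 0 falls under the first case,
  where a permutation of {1..b} fixes it.\<close>

definition juxt :: "nat \<Rightarrow> (nat \<Rightarrow> nat) \<Rightarrow> (nat \<Rightarrow> nat) \<Rightarrow> nat \<Rightarrow> nat" where
  "juxt b x y i = (if i \<le> b then x i else b + y (i - b))"

lemma finite_perms [simp]: "finite (perms n)"
  by (simp add: perms_def finite_permutations)

lemma card_perms: "card (perms n) = fact n"
  by (simp add: perms_def card_permutations)

lemma perms_in: "(p :: nat \<Rightarrow> nat) permutes {1..n} \<Longrightarrow> 1 \<le> p i \<and> p i \<le> n \<longleftrightarrow> 1 \<le> i \<and> i \<le> n"
  using permutes_in_image[of p "{1..n}" i] by simp

lemma perms_le: "(p :: nat \<Rightarrow> nat) permutes {1..n} \<Longrightarrow> p i \<le> n \<longleftrightarrow> i \<le> n"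
  using perms_in[of p n i] permutes_not_in[of p "{1..n}" i] by (cases "1 \<le> i \<and> i \<le> n") auto

lemma perms_0: "(p :: nat \<Rightarrow> nat) permutes {1..n} \<Longrightarrow> p 0 = 0"
  using permutes_not_in[of p "{1..n}" 0] by simp

lemma perms_0_iff: "(p :: nat \<Rightarrow> nat) permutes {1..n} \<Longrightarrow> p i = 0 \<longleftrightarrow> i = 0"
  using perms_0[of p n] injD[OF permutes_inj[of p "{1..n}"], of i 0] by auto

lemma juxt_comp:
  assumes x': "x' permutes {1..b}" and y': "y' permutes {1..c}"
  shows "juxt b x y \<circ> juxt b x' y' = juxt b (x \<circ> x') (y \<circ> y')"
proof
  fix i
  show "(juxt b x y \<circ> juxt b x' y') i = juxt b (x \<circ> x') (y \<circ> y') i"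
  proof (cases "i \<le> b")
    case True
    then show ?thesis using perms_le[OF x', of i] by (simp add: juxt_def)
  next
    case False
    then have "y' (i - b) \<noteq> 0" using perms_0_iff[OF y', of "i - b"] by simp
    then show ?thesis using False by (simp add: juxt_def)
  qed
qed

lemma juxt_id [simp]: "juxt b id id = id"
  by (auto simp: juxt_def fun_eq_iff)

lemma juxt_left: "x permutes {1..b} \<Longrightarrow> juxt b x id = x"
  by (auto simp: juxt_def fun_eq_iff permutes_not_in)

lemma juxt_0: "y permutes {1..c} \<Longrightarrow> juxt 0 id y = y"
  by (auto simp: juxt_def fun_eq_iff permutes_not_in)

lemma juxt_inv:
  assumes x: "x permutes {1..b}" and y: "y permutes {1..c}"
  shows "juxt b x y \<circ> juxt b (inv' x) (inv' y) = id" "juxt b (inv' x) (inv' y) \<circ> juxt b x y = id"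
  using juxt_comp[OF permutes_inv[OF x] permutes_inv[OF y], of x y] juxt_comp[OF x y, of "inv' x" "inv' y"]
  by (simp_all add: permutes_inv_o[OF x] permutes_inv_o[OF y])

lemma juxt_permutes:
  assumes x: "x permutes {1..b}" and y: "y permutes {1..c}"
  shows "juxt b x y permutes {1..b + c}"
proof (rule bij_imp_permutes)
  have in_x: "juxt b x y i \<in> {1..b + c}" if "x permutes {1..b}" "y permutes {1..c}" "i \<in> {1..b + c}" for x y i
  proof (cases "i \<le> b")
    case True
    then show ?thesis using perms_in[OF that(1), of i] that(3) by (simp add: juxt_def)
  next
    case False
    then show ?thesis using perms_in[OF that(2), of "i - b"] that(3) by (auto simp: juxt_def)
  qed
  show "bij_betw (juxt b x y) {1..b + c} {1..b + c}"
  proof (rule bij_betw_byWitness[where f' = "juxt b (inv' x) (inv' y)"])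
    show "\<forall>i\<in>{1..b + c}. juxt b (inv' x) (inv' y) (juxt b x y i) = i"
      using fun_cong[OF juxt_inv(2)[OF x y]] by simp
    show "\<forall>i\<in>{1..b + c}. juxt b x y (juxt b (inv' x) (inv' y) i) = i"
      using fun_cong[OF juxt_inv(1)[OF x y]] by simp
    show "juxt b x y ` {1..b + c} \<subseteq> {1..b + c}" using in_x[OF x y] by blast
    show "juxt b (inv' x) (inv' y) ` {1..b + c} \<subseteq> {1..b + c}"
      using in_x[OF permutes_inv[OF x] permutes_inv[OF y]] by blast
  qed
  show "juxt b x y i = i" if "i \<notin> {1..b + c}" for i
  proof (cases "i \<le> b")
    case True
    then show ?thesis using that permutes_not_in[OF x, of i] by (auto simp: juxt_def)
  next
    case False
    then have "i - b \<notin> {1..c}" using that by auto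
    then show ?thesis using False permutes_not_in[OF y, of "i - b"] by (simp add: juxt_def)
  qed
qed

lemma inv_juxt:
  assumes x: "x permutes {1..b}" and y: "y permutes {1..c}"
  shows "inv' (juxt b x y) = juxt b (inv' x) (inv' y)"
  using juxt_inv[OF assms] by (intro inv_unique_comp) auto

text \<open>The second factor is built up from transpositions, each of which shifts to a
  transposition of points above b; then x multiplies from the left.\<close>

lemma sign_juxt:
  assumes x: "x permutes {1..b}" and y: "y permutes {1..c}"
  shows "sign (juxt b x y) = sign x * sign y"
proof -
  have 1: "sign (juxt b id y) = sign y"
    using y finite_atLeastAtMost[of 1 c]
  proof (induction rule: permutes_induct)
    case id
    show ?case by (simp only: juxt_id)
  next
    case (swap a a' y)
    have "juxt b id (Transposition.transpose a a' \<circ> y) = Transposition.transpose (b + a) (b + a') \<circ> juxt b id y"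
    proof
      fix i
      show "juxt b id (Transposition.transpose a a' \<circ> y) i =
          (Transposition.transpose (b + a) (b + a') \<circ> juxt b id y) i"
      proof (cases "i \<le> b")
        case True
        then have "Transposition.transpose (b + a) (b + a') i = i"
          using swap.hyps(1,2) by (intro transpose_apply_other) auto
        then show ?thesis using True by (simp add: juxt_def)
      next
        case False
        have "b + Transposition.transpose a a' d = Transposition.transpose (b + a) (b + a') (b + d)" for d
          by (simp add: Transposition.transpose_def)
        then show ?thesis using False by (simp add: juxt_def)
      qed
    qed
    note E = this
    have perm: "permutation (juxt b id y)" "permutation y"
      using juxt_permutes[OF permutes_id swap.hyps(4)] swap.hyps(4) permutation_permutes by blast+
    have "sign (juxt b id (Transposition.transpose a a' \<circ> y)) = - sign (juxt b id y)"
      unfolding E sign_compose[OF permutation_swap_id perm(1)] using swap.hyps(3) by (simp add: sign_swap_id)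
    moreover have "sign (Transposition.transpose a a' \<circ> y) = - sign y"
      unfolding sign_compose[OF permutation_swap_id perm(2)] using swap.hyps(3) by (simp add: sign_swap_id)
    ultimately show ?case using swap.IH by (simp only:)
  qed
  have "juxt b x y = x \<circ> juxt b id y"
    using juxt_comp[OF permutes_id y, of b x id] by (simp add: juxt_left[OF x])
  moreover have "permutation x" "permutation (juxt b id y)"
    using x juxt_permutes[OF permutes_id y] permutation_permutes by blast+
  ultimately show ?thesis using 1 by (simp add: sign_compose)
qed

lemma young_two_iff:
  "p \<in> young_subgroup [b, c] \<longleftrightarrow>
    p permutes {1..b + c} \<and> (\<forall>i\<in>{1..b + c}. p i \<le> b \<longleftrightarrow> i \<le> b)"
proof -
  have row: "row_of [b, c] i = (if i \<le> b then 0 else 1)" if "i \<in> {1..b + c}" for i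
    using row_of_eq_iff[of i "[b, c]" "if i \<le> b then 0 else 1"] that by (auto simp: young_block_def)
  show ?thesis
  proof (cases "p permutes {1..b + c}")
    case True
    have "row_of [b, c] (p i) = row_of [b, c] i \<longleftrightarrow> (p i \<le> b \<longleftrightarrow> i \<le> b)" if "i \<in> {1..b + c}" for i
      using row[OF that] row[of "p i"] permutes_in_image[OF True, of i] that by auto
    then show ?thesis using True by (simp add: young_subgroup_iff)
  qed (simp add: young_subgroup_iff)
qed

lemma juxt_in_young:
  assumes x: "x permutes {1..b}" and y: "y permutes {1..c}"
  shows "juxt b x y \<in> young_subgroup [b, c]"
  unfolding young_two_iff
proof (intro conjI ballI)
  show "juxt b x y permutes {1..b + c}" by (rule juxt_permutes[OF assms])
  fix i assume "i \<in> {1..b + c}"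
  then show "juxt b x y i \<le> b \<longleftrightarrow> i \<le> b"
    using perms_le[OF x, of i] perms_0_iff[OF y, of "i - b"] by (auto simp: juxt_def)
qed

lemma shifted_restrict_juxt:
  assumes x: "x permutes {1..b}" and y: "y permutes {1..c}"
  shows "shifted_restrict 0 b (juxt b x y) = x" "shifted_restrict b c (juxt b x y) = y"
  using permutes_not_in[OF x] permutes_not_in[OF y]
  by (auto simp: shifted_restrict_def juxt_def fun_eq_iff)

lemma young_two_split:
  assumes p: "p \<in> young_subgroup [b, c]"
  obtains x y where "x permutes {1..b}" "y permutes {1..c}" "p = juxt b x y"
proof -
  have pp: "p permutes {1..b + c}" and le: "\<And>i. i \<in> {1..b + c} \<Longrightarrow> p i \<le> b \<longleftrightarrow> i \<le> b"
    using p by (simp_all add: young_two_iff)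
  have pinj: "p i = p j \<longleftrightarrow> i = j" for i j using permutes_inj[OF pp] by (auto dest: injD)
  have pin: "1 \<le> p i \<and> p i \<le> b + c" if "1 \<le> i" "i \<le> b + c" for i using perms_in[OF pp, of i] that by simp
  define x where "x i = (if i \<in> {1..b} then p i else i)" for i
  define y where "y i = (if i \<in> {1..c} then p (b + i) - b else i)" for i
  have "x ` {1..b} \<subseteq> {1..b}" using le pin by (auto simp: x_def)
  moreover have "inj_on x {1..b}" by (auto simp: x_def inj_on_def pinj)
  ultimately have "bij_betw x {1..b} {1..b}" by (simp add: bij_betw_def endo_inj_surj)
  then have x: "x permutes {1..b}" by (rule bij_imp_permutes) (auto simp: x_def)
  have gt: "p (b + i) > b" if "i \<in> {1..c}" for i
    using le[of "b + i"] that by auto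
  have "y ` {1..c} \<subseteq> {1..c}" 
  proof
    fix j assume "j \<in> y ` {1..c}"
    then obtain i where i: "i \<in> {1..c}" "j = p (b + i) - b" by (auto simp: y_def)
    have "p (b + i) \<le> b + c" using pin[of "b + i"] i(1) by simp
    then show "j \<in> {1..c}" using gt[OF i(1)] i(2) by auto
  qed
  moreover have "inj_on y {1..c}"
  proof (rule inj_onI)
    fix i j assume ij: "i \<in> {1..c}" "j \<in> {1..c}" "y i = y j"
    then have "p (b + i) = p (b + j)" using gt[OF ij(1)] gt[OF ij(2)] by (auto simp: y_def)
    then show "i = j" by (simp add: pinj)
  qed
  ultimately have "bij_betw y {1..c} {1..c}" by (simp add: bij_betw_def endo_inj_surj)
  then have y: "y permutes {1..c}" by (rule bij_imp_permutes) (auto simp: y_def)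
  have "p = juxt b x y"
  proof
    fix i
    show "p i = juxt b x y i"
    proof (cases "i \<in> {1..b + c}")
      case True
      then show ?thesis using gt[of "i - b"] by (auto simp: juxt_def x_def y_def)
    next
      case False
      then show ?thesis using permutes_not_in[OF pp False] permutes_not_in[OF juxt_permutes[OF x y] False] by simp
    qed
  qed
  then show ?thesis using that x y by blast
qed

lemma bij_betw_juxt: "bij_betw (\<lambda>(x, y). juxt b x y) (perms b \<times> perms c) (young_subgroup [b, c])"
proof (rule bij_betw_byWitness[where f' = "\<lambda>p. (shifted_restrict 0 b p, shifted_restrict b c p)"])
  show "(\<lambda>(x, y). juxt b x y) ` (perms b \<times> perms c) \<subseteq> young_subgroup [b, c]"
    using juxt_in_young by auto
  show "\<forall>xy\<in>perms b \<times> perms c. (shifted_restrict 0 b ((\<lambda>(x, y). juxt b x y) xy),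
      shifted_restrict b c ((\<lambda>(x, y). juxt b x y) xy)) = xy"
    using shifted_restrict_juxt by auto
  show "\<forall>p\<in>young_subgroup [b, c]. (\<lambda>(x, y). juxt b x y) (shifted_restrict 0 b p, shifted_restrict b c p) = p"
    using shifted_restrict_juxt young_two_split by (metis case_prod_conv)
  show "(\<lambda>p. (shifted_restrict 0 b p, shifted_restrict b c p)) ` young_subgroup [b, c] \<subseteq> perms b \<times> perms c"
  proof
    fix xy assume "xy \<in> (\<lambda>p. (shifted_restrict 0 b p, shifted_restrict b c p)) ` young_subgroup [b, c]"
    then obtain p where p: "p \<in> young_subgroup [b, c]" "xy = (shifted_restrict 0 b p, shifted_restrict b c p)" by blast
    obtain x y where "x permutes {1..b}" "y permutes {1..c}" "p = juxt b x y" using young_two_split[OF p(1)] .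
    then show "xy \<in> perms b \<times> perms c" using shifted_restrict_juxt p(2) by auto
  qed
qed

lemma sum_young_two:
  "(\<Sum>p\<in>young_subgroup [b, c]. f p) = (\<Sum>x\<in>perms b. \<Sum>y\<in>perms c. f (juxt b x y))"
  by (subst sum.reindex_bij_betw[OF bij_betw_juxt, symmetric]) (simp add: sum.cartesian_product case_prod_beta')

lemma card_young_two: "card (young_subgroup [b, c]) = fact b * fact c"
  using bij_betw_same_card[OF bij_betw_juxt[of b c]] by (simp only: card_cartesian_product card_perms)

section \<open>Skew characters by partial averaging\<close>

text \<open>The restriction of \<open>\<phi>\<close> to S_b x S_c, paired in the first factor with
  the character labelled by \<open>\<beta>\<close> and left as a function of the second.\<close>

definition restr :: "nat \<Rightarrow> ((nat \<Rightarrow> nat) \<Rightarrow> complex) \<Rightarrow> nat list \<Rightarrow> (nat \<Rightarrow> nat) \<Rightarrow> complex" where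
  "restr b \<phi> \<beta> y = (\<Sum>x\<in>perms b. \<phi> (juxt b x y) * cnj (irr_sym \<beta> x)) / fact b"

lemma carrier_sym: "carrier (sym_group n) = perms n"
  by (simp add: carrier_sym_group perms_def)

lemma char_inner_sym: "char_inner (sym_group n) \<phi> \<psi> = (\<Sum>g\<in>perms n. \<phi> g * cnj (\<psi> g)) / fact n"
  by (simp add: char_inner_def carrier_sym order_sym_group)

lemma sym_class_fun_juxt_left:
  assumes \<phi>: "sym_class_fun (b + c) \<phi>" and y: "y permutes {1..c}"
  shows "sym_class_fun b (\<lambda>x. \<phi> (juxt b x y))"
  unfolding sym_class_fun_def
proof (intro allI impI)
  fix x h assume x: "x permutes {1..b}" and h: "h permutes {1..b}"
  have "juxt b h id \<circ> juxt b x y \<circ> inv' (juxt b h id) = juxt b (h \<circ> x \<circ> inv' h) y"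
    using inv_juxt[OF h permutes_id[of "{1..c}"]] juxt_comp[OF x y, of h id]
      juxt_comp[OF permutes_inv[OF h] permutes_id[of "{1..c}"], of "h \<circ> x" y] by simp
  then show "\<phi> (juxt b (h \<circ> x \<circ> inv' h) y) = \<phi> (juxt b x y)"
    using sym_class_funD[OF \<phi> juxt_permutes[OF x y] juxt_permutes[OF h permutes_id]] by simp
qed

lemma sym_class_fun_juxt_right:
  assumes \<phi>: "sym_class_fun (b + c) \<phi>" and x: "x permutes {1..b}"
  shows "sym_class_fun c (\<lambda>y. \<phi> (juxt b x y))"
  unfolding sym_class_fun_def
proof (intro allI impI)
  fix y h assume y: "y permutes {1..c}" and h: "h permutes {1..c}"
  have "juxt b id h \<circ> juxt b x y \<circ> inv' (juxt b id h) = juxt b x (h \<circ> y \<circ> inv' h)"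
    using inv_juxt[OF permutes_id[of "{1..b}"] h] juxt_comp[OF x y, of id h]
      juxt_comp[OF permutes_id[of "{1..b}"] permutes_inv[OF h], of x "h \<circ> y"] by simp
  then show "\<phi> (juxt b x (h \<circ> y \<circ> inv' h)) = \<phi> (juxt b x y)"
    using sym_class_funD[OF \<phi> juxt_permutes[OF x y] juxt_permutes[OF permutes_id h]] by simp
qed

lemma sym_class_fun_restr:
  assumes "sym_class_fun (b + c) \<phi>"
  shows "sym_class_fun c (restr b \<phi> \<beta>)"
  using sym_class_fun_juxt_right[OF assms]
  by (auto simp: sym_class_fun_def restr_def intro!: sum.cong)

text \<open>Frobenius reciprocity for the two-block Young subgroup, with the pairing over the first
  factor carried out.\<close>

lemma char_inner_ind_prod:
  assumes \<phi>: "sym_class_fun (b + c) \<phi>"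
  shows "char_inner (sym_group (b + c)) \<phi> (ind_prod b c (irr_sym \<beta>) (irr_sym \<nu>)) =
    char_inner (sym_group c) (restr b \<phi> \<beta>) (irr_sym \<nu>)"
proof -
  have "char_inner (sym_group (b + c)) \<phi> (ind_prod b c (irr_sym \<beta>) (irr_sym \<nu>)) =
      (\<Sum>p\<in>young_subgroup [b, c]. \<phi> p * cnj (irr_sym \<beta> (shifted_restrict 0 b p) * irr_sym \<nu> (shifted_restrict b c p)))
        / of_nat (card (young_subgroup [b, c]))"
    unfolding ind_prod_def
    by (rule fin_group.char_inner_induced[OF fin_group_sym])
      (use \<phi> young_subgroup_subset[of "[b, c]" "b + c"] in \<open>auto simp: sym_class_fun_iff\<close>)
  also have "(\<Sum>p\<in>young_subgroup [b, c]. \<phi> p * cnj (irr_sym \<beta> (shifted_restrict 0 b p) * irr_sym \<nu> (shifted_restrict b c p)))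
      = (\<Sum>x\<in>perms b. \<Sum>y\<in>perms c. \<phi> (juxt b x y) * cnj (irr_sym \<beta> x) * cnj (irr_sym \<nu> y))"
    unfolding sum_young_two by (intro sum.cong) (auto simp: shifted_restrict_juxt)
  also have "\<dots> = (\<Sum>y\<in>perms c. fact b * restr b \<phi> \<beta> y * cnj (irr_sym \<nu> y))"
    by (subst sum.swap) (simp add: restr_def sum_distrib_right)
  finally show ?thesis
    by (simp add: card_young_two char_inner_sym mult.assoc flip: sum_distrib_left)
qed

text \<open>By reciprocity the Littlewood-Richardson coefficients are the coefficients of the class
  function \<open>restr b (irr_sym \<alpha>) \<beta>\<close> in the labelled characters, and
  completeness sums the expansion back.\<close>

lemma skew_char_eq:
  assumes \<alpha>: "\<alpha> \<in> partitions (b + c)" and \<beta>: "\<beta> \<in> partitions b" and y: "y permutes {1..c}"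
  shows "skew_char \<alpha> \<beta> y = restr b (irr_sym \<alpha>) \<beta> y"
proof -
  have "skew_char \<alpha> \<beta> y = (\<Sum>\<nu>\<in>partitions c. char_inner (sym_group c) (restr b (irr_sym \<alpha>) \<beta>) (irr_sym \<nu>) * irr_sym \<nu> y)"
    unfolding skew_char_def lr_coeff_def sum_list_partition[OF \<alpha>] sum_list_partition[OF \<beta>]
    using char_inner_ind_prod[OF irr_sym_class[OF \<alpha>]] by (intro sum.cong) (auto simp: sum_list_partition)
  also have "\<dots> = restr b (irr_sym \<alpha>) \<beta> y"
    by (rule irr_sym_expansion[OF sym_class_fun_restr[OF irr_sym_class[OF \<alpha>]] y, symmetric])
  finally show ?thesis .
qed

text \<open>Partial averaging is linear in \<open>\<phi>\<close>, so the expansion of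
  \<open>\<phi>\<close> into labelled characters can be summed up under it.\<close>

lemma char_quotient_eq:
  assumes \<phi>: "sym_class_fun (b + c) \<phi>" and \<beta>: "\<beta> \<in> partitions b" and y: "y permutes {1..c}"
  shows "char_quotient (b + c) \<phi> \<beta> y = restr b \<phi> \<beta> y"
proof -
  let ?a = "\<lambda>\<alpha>. char_inner (sym_group (b + c)) \<phi> (irr_sym \<alpha>)"
  have "char_quotient (b + c) \<phi> \<beta> y = (\<Sum>\<alpha>\<in>partitions (b + c). ?a \<alpha> * restr b (irr_sym \<alpha>) \<beta> y)"
    unfolding char_quotient_def using skew_char_eq[OF _ \<beta> y] by (intro sum.cong) auto
  also have "\<dots> = (\<Sum>\<alpha>\<in>partitions (b + c). \<Sum>x\<in>perms b. ?a \<alpha> * irr_sym \<alpha> (juxt b x y) * cnj (irr_sym \<beta> x)) / fact b"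
    by (simp add: restr_def sum_distrib_left sum_divide_distrib mult.assoc)
  also have "\<dots> = (\<Sum>x\<in>perms b. (\<Sum>\<alpha>\<in>partitions (b + c). ?a \<alpha> * irr_sym \<alpha> (juxt b x y)) * cnj (irr_sym \<beta> x)) / fact b"
    by (subst sum.swap) (simp add: sum_distrib_right)
  also have "\<dots> = restr b \<phi> \<beta> y"
    unfolding restr_def using irr_sym_expansion[OF \<phi> juxt_permutes[OF _ y], symmetric]
    by (intro arg_cong2[where f = "(/)"] sum.cong refl) simp
  finally show ?thesis .
qed

text \<open>With y fixed, the restricted character is a class function of x; its coefficients in the
  labelled characters are the skew characters. This accounts for the sum over \<open>\<beta>\<close>
  on the right-hand side of the theorem.\<close>

lemma sum_irr_skew:
  assumes \<alpha>: "\<alpha> \<in> partitions (k + c)" and x: "x permutes {1..k}" and y: "y permutes {1..c}"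
  shows "(\<Sum>\<beta>\<in>partitions k. irr_sym \<beta> x * skew_char \<alpha> \<beta> y) = irr_sym \<alpha> (juxt k x y)"
proof -
  have "irr_sym \<alpha> (juxt k x y) = (\<Sum>\<beta>\<in>partitions k.
      char_inner (sym_group k) (\<lambda>x. irr_sym \<alpha> (juxt k x y)) (irr_sym \<beta>) * irr_sym \<beta> x)"
    by (rule irr_sym_expansion[OF sym_class_fun_juxt_left[OF irr_sym_class[OF \<alpha>] y] x])
  also have "\<dots> = (\<Sum>\<beta>\<in>partitions k. irr_sym \<beta> x * skew_char \<alpha> \<beta> y)"
    using skew_char_eq[OF \<alpha> _ y] by (intro sum.cong) (auto simp: char_inner_sym restr_def)
  finally show ?thesis by simp
qed

text \<open>The sign of x arises from both characters and cancels, that of y only from the one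
  labelled by \<open>\<alpha>\<close>. This is where the conjugate partitions of the theorem come
  from.\<close>

lemma skew_char_conj:
  assumes \<alpha>: "\<alpha> \<in> partitions (k + c)" and \<beta>: "\<beta> \<in> partitions k" and y: "y permutes {1..c}"
  shows "skew_char (conj_part \<alpha>) (conj_part \<beta>) y = of_int (sign y) * skew_char \<alpha> \<beta> y"
proof -
  have "irr_sym (conj_part \<alpha>) (juxt k x y) * cnj (irr_sym (conj_part \<beta>) x) =
      of_int (sign y) * (irr_sym \<alpha> (juxt k x y) * cnj (irr_sym \<beta> x))" if x: "x permutes {1..k}" for x
  proof -
    have "irr_sym (conj_part \<alpha>) (juxt k x y) * cnj (irr_sym (conj_part \<beta>) x) =
        (of_int (sign x) * of_int (sign x)) * (of_int (sign y) * (irr_sym \<alpha> (juxt k x y) * cnj (irr_sym \<beta> x)))"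
      unfolding irr_sym_conj[OF \<alpha> juxt_permutes[OF x y]] irr_sym_conj[OF \<beta> x] sign_juxt[OF x y] by simp
    then show ?thesis by (simp add: sign_sq)
  qed
  then show ?thesis
    unfolding skew_char_eq[OF conj_part_in_partitions[OF \<alpha>] conj_part_in_partitions[OF \<beta>] y]
      skew_char_eq[OF \<alpha> \<beta> y] restr_def
    by (simp add: sum_distrib_left)
qed

lemma skew_char_Nil:
  assumes \<alpha>: "\<alpha> \<in> partitions n" and y: "y permutes {1..n}"
  shows "skew_char \<alpha> [] y = irr_sym \<alpha> y"
proof -
  have "skew_char \<alpha> [] y = restr 0 (irr_sym \<alpha>) [] y"
    using \<alpha> y by (intro skew_char_eq[of _ 0 n]) (auto simp: partitions_def)
  then show ?thesis
    using irr_sym_sign[of id 0] juxt_0[OF y] card_perms[of 0] by (simp add: restr_def sign_id permutes_id)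
qed

section \<open>Wreath products and sums over labellings\<close>

section \<open>Labellings\<close>

text \<open>A labelling attaches labels to the points of \<open>{1..N}\<close>, the number of points with label \<open>j\<close>
  being \<open>c j\<close>. Set partitions into \<open>n\<close> blocks are encoded by the labellings of the blocks.
  The value \<open>0\<close> outside \<open>{1..N}\<close> makes the equations between labellings below equations between
  total functions.\<close>

definition lab :: "nat \<Rightarrow> (nat \<Rightarrow> nat) \<Rightarrow> (nat \<Rightarrow> nat) set" where
  "lab N c = {l. (\<forall>i. i \<notin> {1..N} \<longrightarrow> l i = 0) \<and> (\<forall>j. card {i\<in>{1..N}. l i = j} = c j)}"

lemma labD:
  assumes "l \<in> lab N c"
  shows "i \<notin> {1..N} \<Longrightarrow> l i = 0" "card {i\<in>{1..N}. l i = j} = c j"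
  using assms by (auto simp: lab_def)

lemma lab_nonzero:
  assumes "l \<in> lab N c" "i \<in> {1..N}"
  shows "c (l i) \<noteq> 0"
proof
  assume "c (l i) = 0"
  then have "card {i'\<in>{1..N}. l i' = l i} = 0" using labD(2)[OF assms(1)] by simp
  then show False using assms(2) by auto
qed

lemma lab_comp_perm:
  assumes l: "l \<in> lab N c" and p: "p permutes {1..N}"
  shows "l \<circ> p \<in> lab N c"
proof -
  have "bij_betw p {i\<in>{1..N}. (l \<circ> p) i = j} {i\<in>{1..N}. l i = j}" for j
  proof (rule bij_betw_byWitness[where f' = "inv' p"])
    show "p ` {i\<in>{1..N}. (l \<circ> p) i = j} \<subseteq> {i\<in>{1..N}. l i = j}"
      using permutes_in_image[OF p] by fastforce
    show "inv' p ` {i\<in>{1..N}. l i = j} \<subseteq> {i\<in>{1..N}. (l \<circ> p) i = j}"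
      using permutes_inv_in[OF p] permutes_inverses(1)[OF p] by auto
  qed (auto simp: permutes_inverses[OF p])
  from bij_betw_same_card[OF this] have "card {i\<in>{1..N}. (l \<circ> p) i = j} = c j" for j
    using labD(2)[OF l, of j] by simp
  then show ?thesis using labD(1)[OF l] permutes_not_in[OF p] by (simp add: lab_def)
qed

lemma lab_transitive:
  assumes l: "l \<in> lab N c" and l': "l' \<in> lab N c"
  obtains p where "p permutes {1..N}" "l \<circ> p = l'"
proof -
  obtain p where p: "p permutes {1..N}" "\<And>i. i \<in> {1..N} \<Longrightarrow> l (p i) = l' i"
    using permutes_fibres[of "{1..N}" l' l] labD(2)[OF l] labD(2)[OF l'] by auto
  have "l (p i) = l' i" for i
    using p(2) labD(1)[OF l] labD(1)[OF l'] permutes_not_in[OF p(1)] by (cases "i \<in> {1..N}") auto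
  then show ?thesis using that p(1) by (auto simp: fun_eq_iff)
qed

lemma finite_lab: "finite (lab N c)"
proof (cases "lab N c = {}")
  case False
  then obtain l where l: "l \<in> lab N c" by blast
  have "lab N c \<subseteq> (\<lambda>p. l \<circ> p) ` perms N" 
  proof
    fix l' assume "l' \<in> lab N c"
    then obtain p where "p permutes {1..N}" "l \<circ> p = l'" using lab_transitive[OF l] by blast
    then show "l' \<in> (\<lambda>p. l \<circ> p) ` perms N" by auto
  qed
  then show ?thesis by (rule finite_subset) simp
qed simp

definition lab_stab :: "nat \<Rightarrow> (nat \<Rightarrow> nat) \<Rightarrow> (nat \<Rightarrow> nat) set" where
  "lab_stab N l = {u\<in>perms N. l \<circ> u = l}"

lemma card_lab_stab_pos: "card (lab_stab N l) \<noteq> 0"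
proof -
  have "id \<in> lab_stab N l" by (simp add: lab_stab_def permutes_id)
  moreover have "finite (lab_stab N l)"
    by (rule finite_subset[OF _ finite_perms[of N]]) (auto simp: lab_stab_def)
  ultimately show ?thesis by auto
qed

text \<open>The permutations taking one labelling to another form a coset of the stabiliser.\<close>

lemma card_lab_fibre:
  assumes l: "l \<in> lab N c" and l': "l' \<in> lab N c"
  shows "card {u\<in>perms N. l \<circ> u = l'} = card (lab_stab N l)"
proof -
  obtain p where p: "p permutes {1..N}" "l \<circ> p = l'" using lab_transitive[OF l l'] .
  have lp: "l' \<circ> inv' p = l" using p(2)[symmetric] permutes_inverses(1)[OF p(1)] by (auto simp: fun_eq_iff)
  have "bij_betw (\<lambda>u. u \<circ> p) (lab_stab N l) {u\<in>perms N. l \<circ> u = l'}"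
  proof (rule bij_betw_byWitness[where f' = "\<lambda>u. u \<circ> inv' p"])
    show "(\<lambda>u. u \<circ> p) ` lab_stab N l \<subseteq> {u\<in>perms N. l \<circ> u = l'}"
      using p permutes_compose[OF p(1)] by (auto simp: lab_stab_def comp_assoc[symmetric])
    show "(\<lambda>u. u \<circ> inv' p) ` {u\<in>perms N. l \<circ> u = l'} \<subseteq> lab_stab N l"
      using lp permutes_compose[OF permutes_inv[OF p(1)]] by (auto simp: lab_stab_def comp_assoc[symmetric])
  qed (auto simp: fun_eq_iff permutes_inverses[OF p(1)])
  from bij_betw_same_card[OF this] show ?thesis by simp
qed

lemma sum_perms_inv: "(\<Sum>u\<in>perms N. f (inv' u)) = (\<Sum>u\<in>perms N. f u)"
proof (rule sum.reindex_bij_betw)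
  show "bij_betw inv' (perms N) (perms N)"
    by (rule bij_betw_byWitness[where f' = inv']) (auto simp: permutes_inv permutes_inv_inv)
qed

text \<open>All labellings with the prescribed fibre sizes form one orbit, and each is reached by as
  many permutations as the stabiliser has elements.\<close>

lemma sum_lab:
  fixes G :: "(nat \<Rightarrow> nat) \<Rightarrow> complex"
  assumes l: "l \<in> lab N c"
  shows "(\<Sum>u\<in>perms N. G (l \<circ> u)) = of_nat (card (lab_stab N l)) * (\<Sum>l'\<in>lab N c. G l')"
proof -
  have "(\<Sum>u\<in>perms N. G (l \<circ> u)) = (\<Sum>l'\<in>lab N c. \<Sum>u\<in>{u\<in>perms N. l \<circ> u = l'}. G (l \<circ> u))"
    by (rule sum.group[symmetric]) (auto simp: finite_lab lab_comp_perm[OF l])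
  also have "\<dots> = (\<Sum>l'\<in>lab N c. of_nat (card (lab_stab N l)) * G l')"
    using card_lab_fibre[OF l] by (intro sum.cong) auto
  finally show ?thesis by (simp add: sum_distrib_left)
qed

text \<open>Fibre size 0 outside {1..n} forces the labels of all points into {1..n}.\<close>

definition const_fib :: "nat \<Rightarrow> nat \<Rightarrow> nat \<Rightarrow> nat" where
  "const_fib m n j = (if j \<in> {1..n} then m else 0)"

lemma lab_perm_comp:
  assumes l: "l \<in> lab N (const_fib m n)" and t: "t permutes {1..n}"
  shows "t \<circ> l \<in> lab N (const_fib m n)"
proof -
  have e: "t a = j \<longleftrightarrow> a = inv' t j" for a j
    using permutes_inverses[OF t] by metis
  have "card {i\<in>{1..N}. (t \<circ> l) i = j} = const_fib m n j" for j
  proof -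
    have "card {i\<in>{1..N}. (t \<circ> l) i = j} = const_fib m n (inv' t j)"
      using labD(2)[OF l, of "inv' t j"] by (simp add: e)
    also have "\<dots> = const_fib m n j"
      using permutes_in_image[OF permutes_inv[OF t], of j] unfolding const_fib_def by simp
    finally show ?thesis .
  qed
  then show ?thesis using labD(1)[OF l] perms_0[OF t] by (simp add: lab_def)
qed

section \<open>Wreath products and labellings\<close>

text \<open>The base point of the orbit: points and labels are both counted from 1, and the fibres
  are the blocks that the wreath product permutes.\<close>

definition block_lab :: "nat \<Rightarrow> nat \<Rightarrow> nat \<Rightarrow> nat" where
  "block_lab m n i = (if i \<in> {1..m * n} then (i - 1) div m + 1 else 0)"

lemma wreath_block_eq:
  assumes m: "m \<ge> 1" and j: "j \<in> {1..n}"
  shows "wreath_block m j = {i\<in>{1..m * n}. block_lab m n i = j}"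
proof -
  obtain j' where j': "j = Suc j'" "j' < n" using j by (cases j) auto
  have le: "m * Suc j' \<le> m * n" using j' by (intro mult_le_mono2) simp
  have "i \<in> wreath_block m j \<longleftrightarrow> i \<in> {1..m * n} \<and> (i - 1) div m + 1 = j" for i
  proof (cases i)
    case (Suc i')
    have "i' div m = j' \<longleftrightarrow> m * j' \<le> i' \<and> i' < m * Suc j'"
      using m div_nat_eqI[of m j' i'] by (auto simp: dividend_less_times_div mult.commute)
    then show ?thesis using Suc j' le times_div_less_eq_dividend[of m i']
      by (auto simp: wreath_block_def less_Suc_eq_le)
  qed (simp add: wreath_block_def)
  then show ?thesis by (auto simp: block_lab_def)
qed

lemma card_wreath_block: "j \<ge> 1 \<Longrightarrow> card (wreath_block m j) = m"
  by (cases j) (simp_all add: wreath_block_def)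

lemma block_lab_in: "i \<in> {1..m * n} \<Longrightarrow> block_lab m n i \<in> {1..n}"
proof -
  assume i: "i \<in> {1..m * n}"
  then have "(i - 1) div m < n" by (intro less_mult_imp_div_less) (auto simp: mult.commute)
  then show ?thesis using i by (auto simp: block_lab_def)
qed

lemma block_lab_lab:
  assumes "m \<ge> 1"
  shows "block_lab m n \<in> lab (m * n) (const_fib m n)"
proof -
  have "card {i\<in>{1..m * n}. block_lab m n i = j} = const_fib m n j" for j
  proof (cases "j \<in> {1..n}")
    case True
    then show ?thesis using wreath_block_eq[OF assms True] card_wreath_block[of j m] by (simp add: const_fib_def)
  next
    case False
    then have e: "{i\<in>{1..m * n}. block_lab m n i = j} = {}" using block_lab_in by blast
    show ?thesis unfolding e using False by (auto simp: const_fib_def)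
  qed
  then show ?thesis by (auto simp: lab_def block_lab_def)
qed

lemma wreath_top_eq:
  assumes m: "m \<ge> 1" and p: "p permutes {1..m * n}" and t: "t permutes {1..n}"
    and e: "block_lab m n \<circ> p = t \<circ> block_lab m n"
  shows "p \<in> wreath_product m n" "wreath_top m n p = t"
proof -
  have im: "p ` wreath_block m i = wreath_block m (t i)" if i: "i \<in> {1..n}" for i
  proof (rule card_subset_eq)
    have ti: "t i \<in> {1..n}" using permutes_in_image[OF t] i by blast
    show "p ` wreath_block m i \<subseteq> wreath_block m (t i)"
      unfolding wreath_block_eq[OF m i] wreath_block_eq[OF m ti]
      using permutes_in_image[OF p] fun_cong[OF e] by auto
    show "card (p ` wreath_block m i) = card (wreath_block m (t i))"
      using i ti inj_on_subset[OF permutes_inj[OF p] subset_UNIV] by (subst card_image) (auto simp: card_wreath_block)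
  qed (simp add: wreath_block_def)
  have tin: "t i \<in> {1..n}" if "i \<in> {1..n}" for i using permutes_in_image[OF t] that by blast
  show "p \<in> wreath_product m n" using p im tin by (auto simp: wreath_product_def sym_group_carrier)
  have uniq: "j = j'" if "j \<in> {1..n}" "j' \<in> {1..n}" "wreath_block m j = wreath_block m j'" for j j'
  proof -
    have "wreath_block m j \<noteq> {}" using card_wreath_block[of j m] that(1) m by auto
    then obtain i where "i \<in> wreath_block m j" by blast
    then show ?thesis using wreath_block_eq[OF m that(1)] wreath_block_eq[OF m that(2)] that(3) by auto
  qed
  show "wreath_top m n p = t"
  proof
    fix i
    show "wreath_top m n p i = t i"
    proof (cases "i \<in> {1..n}")
      case True
      have "(THE j. j \<in> {1..n} \<and> p ` wreath_block m i = wreath_block m j) = t i"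
        using im[OF True] tin[OF True] uniq by (intro the_equality) auto
      then show ?thesis using True by (simp add: wreath_top_def)
    next
      case False
      then show ?thesis using permutes_not_in[OF t False] by (simp only: wreath_top_def if_False)
    qed
  qed
qed

text \<open>The blocks partition the points, so the image of a block is seen from any of its points.
  The induced map on {1..n} is surjective because every point has a preimage, hence a
  permutation.\<close>

lemma wreath_product_top_exists:
  assumes m: "m \<ge> 1" and p: "p \<in> wreath_product m n"
  obtains t where "t permutes {1..n}" "block_lab m n \<circ> p = t \<circ> block_lab m n"
proof -
  have pp: "p permutes {1..m * n}" using p by (simp add: wreath_product_def sym_group_carrier)
  have "\<forall>i\<in>{1..n}. \<exists>j. j \<in> {1..n} \<and> p ` wreath_block m i = wreath_block m j"
    using p unfolding wreath_product_def by blast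
  from bchoice[OF this] obtain f where
    f: "\<And>i. i \<in> {1..n} \<Longrightarrow> f i \<in> {1..n} \<and> p ` wreath_block m i = wreath_block m (f i)" by blast
  define t where "t i = (if i \<in> {1..n} then f i else i)" for i
  have key: "block_lab m n (p x) = t (block_lab m n x)" if x: "x \<in> {1..m * n}" for x
  proof -
    have b: "block_lab m n x \<in> {1..n}" by (rule block_lab_in[OF x])
    then have "x \<in> wreath_block m (block_lab m n x)" using wreath_block_eq[OF m b] x by blast
    then have "p x \<in> wreath_block m (f (block_lab m n x))" using f[OF b] by blast
    then show ?thesis using wreath_block_eq[OF m, of "f (block_lab m n x)" n] f[OF b] b by (auto simp: t_def)
  qed
  have "{1..n} \<subseteq> t ` {1..n}"
  proof
    fix j assume j: "j \<in> {1..n}"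
    have "wreath_block m j \<noteq> {}" using card_wreath_block[of j m] j m by auto
    then obtain y where y: "y \<in> {1..m * n}" "block_lab m n y = j" using wreath_block_eq[OF m j] by blast
    have x: "inv' p y \<in> {1..m * n}" using permutes_inv_in[OF pp y(1)] .
    then have "j = t (block_lab m n (inv' p y))" using key[OF x] y(2) permutes_inverses(1)[OF pp] by simp
    then show "j \<in> t ` {1..n}" using block_lab_in[OF x] by blast
  qed
  moreover have "t ` {1..n} \<subseteq> {1..n}" using f by (auto simp: t_def)
  ultimately have "t ` {1..n} = {1..n}" by blast
  then have "bij_betw t {1..n} {1..n}" by (simp add: bij_betw_def eq_card_imp_inj_on)
  then have t: "t permutes {1..n}" by (rule bij_imp_permutes) (auto simp: t_def)
  have "block_lab m n (p x) = t (block_lab m n x)" for x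
  proof (cases "x \<in> {1..m * n}")
    case False
    then show ?thesis using permutes_not_in[OF pp False] perms_0[OF t] by (auto simp: block_lab_def)
  qed (rule key)
  then show ?thesis using that t by (auto simp: fun_eq_iff)
qed

text \<open>For m \<ge> 1 every label is used, so a labelling admits at most one t: the inner sum
  evaluates \<open>F\<close> at the permutation of labels induced by g, or is 0 if g induces
  none.\<close>

definition lab_sum :: "nat \<Rightarrow> nat \<Rightarrow> nat \<Rightarrow> ((nat \<Rightarrow> nat) \<Rightarrow> complex) \<Rightarrow> (nat \<Rightarrow> nat) \<Rightarrow> complex" where
  "lab_sum N m n F g = (\<Sum>l\<in>lab N (const_fib m n). \<Sum>t\<in>perms n. if l \<circ> g = t \<circ> l then F t else 0)"

lemma block_lab_surj: "m \<ge> 1 \<Longrightarrow> j \<in> {1..n} \<Longrightarrow> \<exists>i\<in>{1..m * n}. block_lab m n i = j"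
  using wreath_block_eq[of m j n] card_wreath_block[of j m] by (cases "wreath_block m j = {}") auto

lemma block_lab_unique:
  assumes "m \<ge> 1" "t permutes {1..n}" "t' permutes {1..n}" "t \<circ> block_lab m n = t' \<circ> block_lab m n"
  shows "t = t'"
proof
  fix j
  show "t j = t' j"
  proof (cases "j \<in> {1..n}")
    case True
    then show ?thesis using block_lab_surj[OF assms(1) True] fun_cong[OF assms(4)] by auto
  next
    case False
    then show ?thesis using permutes_not_in[OF assms(2)] permutes_not_in[OF assms(3)] by metis
  qed
qed

text \<open>Membership in the wreath product and the value of the quotient map are both expressed by
  one equation between labellings, which at most one t satisfies.\<close>

lemma wreath_sum:
  fixes F :: "(nat \<Rightarrow> nat) \<Rightarrow> complex"
  assumes m: "m \<ge> 1" and p: "p permutes {1..m * n}"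
  shows "(if p \<in> wreath_product m n then F (wreath_top m n p) else 0) =
    (\<Sum>t\<in>perms n. if block_lab m n \<circ> p = t \<circ> block_lab m n then F t else 0)"
proof (cases "p \<in> wreath_product m n")
  case True
  obtain t where t: "t permutes {1..n}" "block_lab m n \<circ> p = t \<circ> block_lab m n"
    using wreath_product_top_exists[OF m True] .
  have "(\<Sum>t'\<in>perms n. if block_lab m n \<circ> p = t' \<circ> block_lab m n then F t' else 0) =
      (\<Sum>t'\<in>perms n. if t' = t then F t else 0)"
    using block_lab_unique[OF m] t by (intro sum.cong) auto
  then show ?thesis using True t wreath_top_eq(2)[OF m p t] by simp
next
  case False
  then have "block_lab m n \<circ> p \<noteq> t \<circ> block_lab m n" if "t permutes {1..n}" for t
    using wreath_top_eq(1)[OF m p that] by blast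
  then show ?thesis using False by (simp add: sum.neutral)
qed

text \<open>The case of the constant function 1. The order is left as stabiliser times n! because
  the same stabiliser factor arises from \<open>sum_lab\<close> and cancels in
  \<open>rho_eq\<close>.\<close>

lemma card_wreath_product:
  assumes m: "m \<ge> 1"
  shows "of_nat (card (wreath_product m n)) = (of_nat (card (lab_stab (m * n) (block_lab m n))) * fact n :: complex)"
proof -
  let ?l = "block_lab m n"
  note l = block_lab_lab[OF m, of n]
  have sub: "wreath_product m n \<subseteq> perms (m * n)" by (auto simp: wreath_product_def sym_group_carrier)
  have "of_nat (card (wreath_product m n)) = (\<Sum>p\<in>perms (m * n). if p \<in> wreath_product m n then 1 else (0::complex))"
    using Int_absorb1[OF sub] by (simp add: sum.If_cases)
  also have "\<dots> = (\<Sum>p\<in>perms (m * n). \<Sum>t\<in>perms n. if ?l \<circ> p = t \<circ> ?l then 1 else 0)"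
    using wreath_sum[OF m, where F = "\<lambda>_. 1"] by (intro sum.cong) auto
  also have "\<dots> = of_nat (card (lab_stab (m * n) ?l)) * (\<Sum>l'\<in>lab (m * n) (const_fib m n). \<Sum>t\<in>perms n. if l' = t \<circ> ?l then 1 else 0)"
    by (rule sum_lab[OF l, where G = "\<lambda>l'. \<Sum>t\<in>perms n. if l' = t \<circ> ?l then 1 else 0"])
  also have "(\<Sum>l'\<in>lab (m * n) (const_fib m n). \<Sum>t\<in>perms n. if l' = t \<circ> ?l then 1 else (0::complex)) = (\<Sum>t\<in>perms n. 1)"
    using lab_perm_comp[OF l] by (subst sum.swap) (auto intro!: sum.cong simp: finite_lab)
  finally show ?thesis by (simp add: card_perms)
qed

text \<open>Conjugating g by u and comparing with the blocks amounts to keeping g and moving the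
  base labelling by the inverse of u; over all u this runs through all labellings equally
  often.\<close>

lemma rho_eq:
  assumes m: "m \<ge> 1" and n: "n = sum_list \<alpha> - sum_list \<beta>" and g: "g permutes {1..m * n}"
  shows "rho m \<alpha> \<beta> g = lab_sum (m * n) m n (skew_char \<alpha> \<beta>) g / fact n"
proof -
  let ?l = "block_lab m n" and ?F = "skew_char \<alpha> \<beta>"
  note l = block_lab_lab[OF m, of n]
  let ?G = "\<lambda>l. \<Sum>t\<in>perms n. if l \<circ> g = t \<circ> l then ?F t else 0"
  have "rho m \<alpha> \<beta> g = (\<Sum>u\<in>perms (m * n). if inv' u \<circ> g \<circ> u \<in> wreath_product m n
      then ?F (wreath_top m n (inv' u \<circ> g \<circ> u)) else 0) / of_nat (card (wreath_product m n))"
    unfolding rho_def induced_def Let_def n[symmetric] carrier_sym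
    by (intro arg_cong2[where f = "(/)"] sum.cong refl) (simp add: sym_group_mult inv_sym_group)
  also have "(\<Sum>u\<in>perms (m * n). if inv' u \<circ> g \<circ> u \<in> wreath_product m n
      then ?F (wreath_top m n (inv' u \<circ> g \<circ> u)) else 0) = (\<Sum>u\<in>perms (m * n). ?G (?l \<circ> inv' u))"
  proof (rule sum.cong[OF refl])
    fix u assume "u \<in> perms (m * n)"
    then have u: "u permutes {1..m * n}" by simp
    have eq: "?l \<circ> (inv' u \<circ> g \<circ> u) = t \<circ> ?l \<longleftrightarrow> ?l \<circ> inv' u \<circ> g = t \<circ> (?l \<circ> inv' u)" for t
    proof
      assume "?l \<circ> (inv' u \<circ> g \<circ> u) = t \<circ> ?l"
      from arg_cong[OF this, of "\<lambda>f. f \<circ> inv' u"] show "?l \<circ> inv' u \<circ> g = t \<circ> (?l \<circ> inv' u)"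
        using permutes_inverses[OF u] by (auto simp: fun_eq_iff)
    next
      assume "?l \<circ> inv' u \<circ> g = t \<circ> (?l \<circ> inv' u)"
      from arg_cong[OF this, of "\<lambda>f. f \<circ> u"] show "?l \<circ> (inv' u \<circ> g \<circ> u) = t \<circ> ?l"
        using permutes_inverses[OF u] by (auto simp: fun_eq_iff)
    qed
    have "inv' u \<circ> g \<circ> u permutes {1..m * n}" using u g by (intro permutes_compose permutes_inv)
    from wreath_sum[OF m this, of ?F]
    show "(if inv' u \<circ> g \<circ> u \<in> wreath_product m n then ?F (wreath_top m n (inv' u \<circ> g \<circ> u)) else 0) =
        ?G (?l \<circ> inv' u)"
      unfolding eq .
  qed
  also have "\<dots> = (\<Sum>u\<in>perms (m * n). ?G (?l \<circ> u))" by (rule sum_perms_inv)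
  also have "\<dots> = of_nat (card (lab_stab (m * n) ?l)) * lab_sum (m * n) m n ?F g"
    unfolding lab_sum_def by (rule sum_lab[OF l])
  finally show ?thesis
    using card_wreath_product[OF m, of n] card_lab_stab_pos[of "m * n" ?l] by simp
qed

section \<open>Both sides as sums over labellings with two fibre sizes\<close>

section \<open>Labellings with two fibre sizes\<close>

text \<open>The labels in \<open>{1..k}\<close> stand for the blocks without extra points and those in
  \<open>{k + 1..k + b}\<close> for the blocks that contain one extra point, which is not counted.\<close>

definition fib2 :: "nat \<Rightarrow> nat \<Rightarrow> nat \<Rightarrow> nat \<Rightarrow> nat" where
  "fib2 m k b j = (if j \<in> {1..k} then m else if j \<in> {k + 1..k + b} then m - 1 else 0)"

text \<open>The summand in which the two sides of the theorem meet; x acts on the labels k + 1, ...,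
  k + b.\<close>

definition twisted_sum ::
    "nat \<Rightarrow> nat \<Rightarrow> ((nat \<Rightarrow> nat) \<Rightarrow> complex) \<Rightarrow> (nat \<Rightarrow> nat) \<Rightarrow> (nat \<Rightarrow> nat) \<Rightarrow> complex" where
  "twisted_sum k b \<chi> q p = (\<Sum>t\<in>perms k. \<Sum>x\<in>perms b.
     if q \<circ> p = juxt k t x \<circ> q then of_int (sign x) * \<chi> (juxt k t x) else 0)"

lemma bij_perms_left: "h permutes {1..n} \<Longrightarrow> bij_betw (\<lambda>x. h \<circ> x) (perms n) (perms n)"
  using fin_group.bij_left_mult[OF fin_group_sym, of h n] by (simp add: carrier_sym sym_group_mult)

lemma bij_perms_conj: "h permutes {1..n} \<Longrightarrow> bij_betw (\<lambda>x. h \<circ> x \<circ> inv' h) (perms n) (perms n)"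
  using fin_group.bij_conj[OF fin_group_sym, of h n] by (simp add: carrier_sym sym_group_mult inv_sym_group)

lemma comp_perm_cancel:
  assumes "h permutes S"
  shows "f \<circ> h = f' \<circ> h \<longleftrightarrow> f = f'" "h \<circ> u = h \<circ> u' \<longleftrightarrow> u = u'"
proof -
  show "f \<circ> h = f' \<circ> h \<longleftrightarrow> f = f'"
    using permutes_inverses(1)[OF assms] by (metis comp_apply ext)
  show "h \<circ> u = h \<circ> u' \<longleftrightarrow> u = u'"
    using permutes_inverses(2)[OF assms] by (metis comp_apply ext)
qed

lemma card_split_shift:
  fixes b M :: nat
  shows "card {i\<in>{1..b + M}. P i} = card {i\<in>{1..b}. P i} + card {i\<in>{1..M}. P (b + i)}"
proof -
  have "{i\<in>{1..b + M}. P i} = {i\<in>{1..b}. P i} \<union> (\<lambda>i. b + i) ` {i\<in>{1..M}. P (b + i)}"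
  proof (intro Set.set_eqI iffI)
    fix i assume i: "i \<in> {i\<in>{1..b + M}. P i}"
    show "i \<in> {i\<in>{1..b}. P i} \<union> (\<lambda>i. b + i) ` {i\<in>{1..M}. P (b + i)}"
    proof (cases "i \<le> b")
      case False
      then have "i = b + (i - b)" "i - b \<in> {1..M}" using i by auto
      then show ?thesis using i by (intro UnI2 image_eqI[of _ _ "i - b"]) auto
    qed (use i in auto)
  qed auto
  moreover have "card ({i\<in>{1..b}. P i} \<union> (\<lambda>i. b + i) ` {i\<in>{1..M}. P (b + i)}) =
      card {i\<in>{1..b}. P i} + card ((\<lambda>i. b + i) ` {i\<in>{1..M}. P (b + i)})"
    by (rule card_Un_disjoint) auto
  ultimately show ?thesis by (simp add: card_image)
qed

lemma perms_fixing_tail: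
  fixes p :: "nat \<Rightarrow> nat"
  assumes p: "p permutes {1..k + b}" and f: "\<And>i. i \<in> {1..b} \<Longrightarrow> p (k + i) = k + i"
  shows "p permutes {1..k}"
proof (rule permutes_superset[OF p])
  fix x assume "x \<in> {1..k + b} - {1..k}"
  then have "x - k \<in> {1..b}" "k + (x - k) = x" by auto
  then show "p x = x" using f[of "x - k"] by simp
qed

lemma perms_mono: "p permutes {1..k} \<Longrightarrow> p permutes {1..k + b :: nat}"
  by (rule permutes_subset) auto

section \<open>Division by the sign character\<close>

locale averaging =
  fixes m k b M :: nat and \<chi> :: "(nat \<Rightarrow> nat) \<Rightarrow> complex" and g :: "nat \<Rightarrow> nat"
  assumes m: "m \<ge> 1" and \<chi>: "sym_class_fun (k + b) \<chi>" and g: "g permutes {1..M}"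
begin

abbreviation "L \<equiv> lab (b + M) (const_fib m (k + b))"
abbreviation "Q \<equiv> lab M (fib2 m k b)"

definition signed_count :: "(nat \<Rightarrow> nat) \<Rightarrow> complex" where
  "signed_count l = (\<Sum>x\<in>perms b. \<Sum>t\<in>perms (k + b).
     if l \<circ> juxt b x g = t \<circ> l then of_int (sign x) * \<chi> t else 0)"

lemma sum_signed_count:
  "(\<Sum>x\<in>perms b. of_int (sign x) * lab_sum (b + M) m (k + b) \<chi> (juxt b x g)) = (\<Sum>l\<in>L. signed_count l)"
  unfolding lab_sum_def signed_count_def
  by (subst sum.swap) (auto simp: sum_distrib_left intro!: sum.cong)

text \<open>Swapping two points of \<open>{1..b}\<close> with the same label changes the sign of a summand only.\<close>

lemma signed_count_not_inj:
  assumes l: "\<not> inj_on l {1..b}"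
  shows "signed_count l = 0"
proof -
  obtain i j where ij: "i \<in> {1..b}" "j \<in> {1..b}" "i \<noteq> j" "l i = l j" using l by (auto simp: inj_on_def)
  define s where "s = Transposition.transpose i j"
  have s: "s permutes {1..b}" unfolding s_def using ij by (intro permutes_swap_id) auto
  have ls: "l \<circ> s = l" using ij by (auto simp: s_def fun_eq_iff Transposition.transpose_def)
  let ?f = "\<lambda>x. \<Sum>t\<in>perms (k + b). if l \<circ> juxt b x g = t \<circ> l then of_int (sign x) * \<chi> t else 0"
  have "signed_count l = (\<Sum>x\<in>perms b. ?f (s \<circ> x))"
    unfolding signed_count_def by (rule sum.reindex_bij_betw[OF bij_perms_left[OF s], symmetric])
  also have "\<dots> = (\<Sum>x\<in>perms b. - ?f x)"
  proof (rule sum.cong[OF refl])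
    fix x assume "x \<in> perms b"
    then have x: "x permutes {1..b}" by simp
    have "juxt b (s \<circ> x) g = s \<circ> juxt b x g"
      using juxt_comp[OF x g, of s id] by (simp add: juxt_left[OF s])
    then have "l \<circ> juxt b (s \<circ> x) g = l \<circ> juxt b x g" using ls by (metis comp_assoc)
    moreover have "sign (s \<circ> x) = - sign x"
    proof -
      have "permutation x" using x permutation_permutes by blast
      then show ?thesis using ij(3) unfolding s_def
        by (simp add: sign_compose[OF permutation_swap_id] sign_swap_id)
    qed
    ultimately show "?f (s \<circ> x) = - ?f x" by (simp add: sum_negf[symmetric] if_distrib cong: if_cong)
  qed
  also have "\<dots> = - signed_count l" by (simp add: signed_count_def sum_negf)
  finally show ?thesis by simp
qed

text \<open>Conjugating t by s turns the condition for \<open>s \<circ> l\<close> into that for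
  \<open>l\<close>, and the class function \<open>\<chi>\<close> keeps its value.\<close>

lemma signed_count_relabel:
  assumes s: "s permutes {1..k + b}"
  shows "signed_count (s \<circ> l) = signed_count l"
  unfolding signed_count_def
proof (rule sum.cong[OF refl])
  fix x
  let ?J = "juxt b x g"
  have "(\<Sum>t\<in>perms (k + b). if (s \<circ> l) \<circ> ?J = t \<circ> (s \<circ> l) then of_int (sign x) * \<chi> t else 0) =
      (\<Sum>t\<in>perms (k + b). if (s \<circ> l) \<circ> ?J = (s \<circ> t \<circ> inv' s) \<circ> (s \<circ> l) then of_int (sign x) * \<chi> (s \<circ> t \<circ> inv' s) else 0)"
    by (rule sum.reindex_bij_betw[OF bij_perms_conj[OF s], symmetric])
  also have "\<dots> = (\<Sum>t\<in>perms (k + b). if l \<circ> ?J = t \<circ> l then of_int (sign x) * \<chi> t else 0)"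
  proof (rule sum.cong[OF refl])
    fix t assume "t \<in> perms (k + b)"
    then have t: "t permutes {1..k + b}" by simp
    have "(s \<circ> t \<circ> inv' s) \<circ> (s \<circ> l) = s \<circ> (t \<circ> l)" using permutes_inverses(2)[OF s] by (auto simp: fun_eq_iff)
    then have "(s \<circ> l) \<circ> ?J = (s \<circ> t \<circ> inv' s) \<circ> (s \<circ> l) \<longleftrightarrow> l \<circ> ?J = t \<circ> l"
      using comp_perm_cancel(2)[OF s] by (simp add: comp_assoc)
    then show "(if (s \<circ> l) \<circ> ?J = (s \<circ> t \<circ> inv' s) \<circ> (s \<circ> l) then of_int (sign x) * \<chi> (s \<circ> t \<circ> inv' s) else 0) =
        (if l \<circ> ?J = t \<circ> l then of_int (sign x) * \<chi> t else 0)"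
      using sym_class_funD[OF \<chi> t s] by simp
  qed
  finally show "(\<Sum>t\<in>perms (k + b). if (s \<circ> l) \<circ> ?J = t \<circ> (s \<circ> l) then of_int (sign x) * \<chi> t else 0) =
      (\<Sum>t\<in>perms (k + b). if l \<circ> ?J = t \<circ> l then of_int (sign x) * \<chi> t else 0)" .
qed

text \<open>\<open>B\<close> consists of normal forms for \<open>A\<close> under relabelling: the
  extra point i carries the label k + i.\<close>

abbreviation "A \<equiv> {l\<in>L. inj_on l {1..b}}"
abbreviation "B \<equiv> {l\<in>L. \<forall>i\<in>{1..b}. l i = k + i}"

lemma L_range: "l \<in> L \<Longrightarrow> i \<in> {1..b + M} \<Longrightarrow> l i \<in> {1..k + b}"
  using lab_nonzero by (fastforce simp: const_fib_def split: if_splits)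

text \<open>The extra points leave k labels untaken; these become the images of 1, ..., k under an
  arbitrary bijection.\<close>

lemma extend_to_perm:
  assumes l: "l \<in> A"
  obtains s where "s permutes {1..k + b}" "\<And>i. i \<in> {1..b} \<Longrightarrow> s (k + i) = l i"
proof -
  have im: "l ` {1..b} \<subseteq> {1..k + b}"
  proof
    fix j assume "j \<in> l ` {1..b}"
    then obtain i where "i \<in> {1..b}" "j = l i" by blast
    then show "j \<in> {1..k + b}" using L_range[of l i] l by simp
  qed
  have "card ({1..k + b} - l ` {1..b}) = card {1..k}"
    using l im by (subst card_Diff_subset) (auto simp: card_image)
  then obtain h where h: "bij_betw h {1..k} ({1..k + b} - l ` {1..b})"
    using finite_same_card_bij[of "{1..k}" "{1..k + b} - l ` {1..b}"] by auto
  define s where "s i = (if i \<in> {1..k} then h i else if i \<in> {k + 1..k + b} then l (i - k) else i)" for i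
  have 1: "bij_betw s {1..k} ({1..k + b} - l ` {1..b})"
    using h by (rule bij_betw_cong[THEN iffD1, rotated]) (simp add: s_def)
  have "bij_betw (\<lambda>i. i - k) {k + 1..k + b} {1..b}"
    by (rule bij_betw_byWitness[where f' = "\<lambda>i. i + k"]) auto
  moreover have "bij_betw l {1..b} (l ` {1..b})" using l by (simp add: bij_betw_def)
  ultimately have "bij_betw (l \<circ> (\<lambda>i. i - k)) {k + 1..k + b} (l ` {1..b})" by (rule bij_betw_trans)
  then have 2: "bij_betw s {k + 1..k + b} (l ` {1..b})"
    by (rule bij_betw_cong[THEN iffD1, rotated]) (auto simp: s_def)
  have "bij_betw s ({1..k} \<union> {k + 1..k + b}) (({1..k + b} - l ` {1..b}) \<union> l ` {1..b})"
    by (rule bij_betw_combine[OF 1 2]) auto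
  moreover have "{1..k} \<union> {k + 1..k + b} = {1..k + b}" by auto
  moreover have "({1..k + b} - l ` {1..b}) \<union> l ` {1..b} = {1..k + b}" using im by blast
  ultimately have "bij_betw s {1..k + b} {1..k + b}" by simp
  then have "s permutes {1..k + b}" by (rule bij_imp_permutes) (auto simp: s_def)
  then show ?thesis using that by (auto simp: s_def)
qed

text \<open>The first component determines the second and must send k + i to \<open>l i\<close> for
  every extra point i. Two such relabellings differ by a permutation of {1..k}, so dividing by one
  solution \<open>s0\<close> identifies them with \<open>perms k\<close>.\<close>

lemma card_relabellings:
  assumes l: "l \<in> A"
  shows "card {(s, l')\<in>perms (k + b) \<times> B. s \<circ> l' = l} = fact k"
proof -
  obtain s0 where s0: "s0 permutes {1..k + b}" "\<And>i. i \<in> {1..b} \<Longrightarrow> s0 (k + i) = l i"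
    using extend_to_perm[OF l] by metis
  note inv0 = permutes_inverses[OF s0(1)]
  have "bij_betw (\<lambda>(s, l'). inv' s0 \<circ> s) {(s, l')\<in>perms (k + b) \<times> B. s \<circ> l' = l} (perms k)"
  proof (rule bij_betw_byWitness[where f' = "\<lambda>t. (s0 \<circ> t, inv' (s0 \<circ> t) \<circ> l)"])
    show "\<forall>a\<in>{(s, l')\<in>perms (k + b) \<times> B. s \<circ> l' = l}.
        (s0 \<circ> (case a of (s, l') \<Rightarrow> inv' s0 \<circ> s), inv' (s0 \<circ> (case a of (s, l') \<Rightarrow> inv' s0 \<circ> s)) \<circ> l) = a"
    proof
      fix a assume "a \<in> {(s, l')\<in>perms (k + b) \<times> B. s \<circ> l' = l}"
      then obtain s l' where a: "a = (s, l')" "s \<circ> l' = l" and s: "s permutes {1..k + b}" by auto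
      have "s0 \<circ> (inv' s0 \<circ> s) = s" using inv0 by (simp add: fun_eq_iff)
      moreover have "inv' s \<circ> (s \<circ> l') = l'" using permutes_inverses[OF s] by (simp add: fun_eq_iff)
      ultimately show "(s0 \<circ> (case a of (s, l') \<Rightarrow> inv' s0 \<circ> s),
          inv' (s0 \<circ> (case a of (s, l') \<Rightarrow> inv' s0 \<circ> s)) \<circ> l) = a"
        using a by simp
    qed
    show "\<forall>t\<in>perms k. (case (s0 \<circ> t, inv' (s0 \<circ> t) \<circ> l) of (s, l') \<Rightarrow> inv' s0 \<circ> s) = t"
      using inv0 by (simp add: fun_eq_iff)
    show "(\<lambda>(s, l'). inv' s0 \<circ> s) ` {(s, l')\<in>perms (k + b) \<times> B. s \<circ> l' = l} \<subseteq> perms k"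
    proof
      fix t assume "t \<in> (\<lambda>(s, l'). inv' s0 \<circ> s) ` {(s, l')\<in>perms (k + b) \<times> B. s \<circ> l' = l}"
      then obtain s l' where s: "s \<in> perms (k + b)" and l': "\<forall>i\<in>{1..b}. l' i = k + i"
        and e: "l = s \<circ> l'" and t: "t = inv' s0 \<circ> s" by auto
      have "inv' s0 \<circ> s permutes {1..k}"
      proof (rule perms_fixing_tail)
        show "inv' s0 \<circ> s permutes {1..k + b}" using s s0(1) by (auto intro: permutes_compose permutes_inv)
        fix i assume i: "i \<in> {1..b}"
        then have "s (k + i) = s0 (k + i)" using s0(2)[OF i] l' e by simp
        then show "(inv' s0 \<circ> s) (k + i) = k + i" using inv0 by simp
      qed
      then show "t \<in> perms k" using t by simp
    qed
    show "(\<lambda>t. (s0 \<circ> t, inv' (s0 \<circ> t) \<circ> l)) ` perms k \<subseteq> {(s, l')\<in>perms (k + b) \<times> B. s \<circ> l' = l}"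
    proof
      fix sl assume "sl \<in> (\<lambda>t. (s0 \<circ> t, inv' (s0 \<circ> t) \<circ> l)) ` perms k"
      then obtain t where sl: "sl = (s0 \<circ> t, inv' (s0 \<circ> t) \<circ> l)" and t: "t permutes {1..k}" by auto
      have s: "s0 \<circ> t permutes {1..k + b}" by (rule permutes_compose[OF perms_mono[OF t] s0(1)])
      have "inv' (s0 \<circ> t) \<circ> l \<in> L" using lab_perm_comp[OF _ permutes_inv[OF s]] l by simp
      moreover have "inv' (s0 \<circ> t) (l i) = k + i" if "i \<in> {1..b}" for i
      proof -
        have "t (k + i) = k + i" using permutes_not_in[OF t, of "k + i"] that by simp
        then have "(s0 \<circ> t) (k + i) = l i" using s0(2)[OF that] by simp
        then show ?thesis using permutes_inverses(2)[OF s] by metis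
      qed
      moreover have "s0 \<circ> t \<circ> (inv' (s0 \<circ> t) \<circ> l) = l" using permutes_inverses(1)[OF s] by (simp add: fun_eq_iff)
      ultimately show "sl \<in> {(s, l')\<in>perms (k + b) \<times> B. s \<circ> l' = l}"
        unfolding sl using s by simp
    qed
  qed
  from bij_betw_same_card[OF this] show ?thesis by (simp add: card_perms)
qed

text \<open>Double counting of pairs of a relabelling s and a labelling in \<open>B\<close>: there
  are (k + b)! of them over each element of \<open>B\<close> and k! over each element of
  \<open>A\<close>, and relabelling leaves the summand unchanged.\<close>

lemma sum_injective_labellings: "fact k * (\<Sum>l\<in>A. signed_count l) = fact (k + b) * (\<Sum>l\<in>B. signed_count l)"
proof -
  have finL: "finite L" by (rule finite_lab)
  have "fact (k + b) * (\<Sum>l\<in>B. signed_count l) = (\<Sum>s\<in>perms (k + b). \<Sum>l\<in>B. signed_count (s \<circ> l))"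
    by (simp add: signed_count_relabel card_perms)
  also have "\<dots> = (\<Sum>(s, l)\<in>perms (k + b) \<times> B. signed_count (s \<circ> l))" by (simp add: sum.cartesian_product)
  also have "\<dots> = (\<Sum>l\<in>A. \<Sum>(s, l')\<in>{sl\<in>perms (k + b) \<times> B. (\<lambda>(s, l'). s \<circ> l') sl = l}. signed_count (s \<circ> l'))"
  proof (rule sum.group[symmetric])
    show "(\<lambda>(s, l'). s \<circ> l') ` (perms (k + b) \<times> B) \<subseteq> A"
    proof clarify
      fix s l' assume s: "s \<in> perms (k + b)" and l': "l' \<in> L" "\<forall>i\<in>{1..b}. l' i = k + i"
      have "inj s" using s permutes_inj by auto
      have "inj_on (s \<circ> l') {1..b}"
      proof (rule inj_onI)
        fix x y assume xy: "x \<in> {1..b}" "y \<in> {1..b}" "(s \<circ> l') x = (s \<circ> l') y"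
        then have "l' x = l' y" using injD[OF \<open>inj s\<close>] by simp
        then show "x = y" using l'(2) xy by simp
      qed
      then show "s \<circ> l' \<in> L \<and> inj_on (s \<circ> l') {1..b}" using lab_perm_comp[OF l'(1)] s by simp
    qed
  qed (use finL in auto)
  also have "\<dots> = (\<Sum>l\<in>A. fact k * signed_count l)"
  proof (rule sum.cong[OF refl])
    fix l assume l: "l \<in> A"
    have "(\<Sum>(s, l')\<in>{sl\<in>perms (k + b) \<times> B. (\<lambda>(s, l'). s \<circ> l') sl = l}. signed_count (s \<circ> l')) =
        (\<Sum>sl\<in>{(s, l')\<in>perms (k + b) \<times> B. s \<circ> l' = l}. signed_count l)"
      by (rule sum.cong) auto
    then show "(\<Sum>(s, l')\<in>{sl\<in>perms (k + b) \<times> B. (\<lambda>(s, l'). s \<circ> l') sl = l}. signed_count (s \<circ> l')) =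
        fact k * signed_count l"
      using card_relabellings[OF l] by simp
  qed
  finally show ?thesis by (simp add: sum_distrib_left)
qed

text \<open>Extra point j carries the label k + j, so t is forced to act on the last b labels as x
  acts on the extra points. Only juxtapositions \<open>juxt k t x\<close> remain in the sum.\<close>

lemma signed_count_standard:
  assumes l: "l \<in> B"
  shows "signed_count l = (\<Sum>x\<in>perms b. \<Sum>t\<in>perms k.
    if l \<circ> juxt b x g = juxt k t x \<circ> l then of_int (sign x) * \<chi> (juxt k t x) else 0)"
  unfolding signed_count_def
proof (rule sum.cong[OF refl])
  fix x assume "x \<in> perms b"
  then have x: "x permutes {1..b}" by simp
  let ?f = "\<lambda>t. if l \<circ> juxt b x g = t \<circ> l then of_int (sign x) * \<chi> t else 0"
  let ?I = "(\<lambda>t. juxt k t x) ` perms k"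
  have inj: "inj_on (\<lambda>t. juxt k t x) (perms k)"
  proof (rule inj_onI)
    fix t t' assume "t \<in> perms k" "t' \<in> perms k" "juxt k t x = juxt k t' x"
    then show "t = t'" using shifted_restrict_juxt(1)[OF _ x] by (metis mem_perms)
  qed
  have "?f t = 0" if t: "t \<in> perms (k + b) - ?I" for t
  proof (rule ccontr)
    assume "?f t \<noteq> 0"
    then have e: "l \<circ> juxt b x g = t \<circ> l" by (auto split: if_splits)
    have tp: "t permutes {1..k + b}" using t by simp
    \<comment> \<open>Undoing x on the last b labels leaves a permutation that fixes them.\<close>
    define t' where "t' = t \<circ> juxt k id (inv' x)"
    have "t' permutes {1..k}"
    proof (rule perms_fixing_tail)
      show "t' permutes {1..k + b}" unfolding t'_def
        by (rule permutes_compose[OF juxt_permutes[OF permutes_id permutes_inv[OF x]] tp])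
      fix i assume i: "i \<in> {1..b}"
      define j where "j = inv' x i"
      have j: "j \<in> {1..b}" unfolding j_def by (rule permutes_inv_in[OF x i])
      have xj: "x j = i" unfolding j_def using permutes_inverses(1)[OF x] .
      have "t (l j) = l (juxt b x g j)" using fun_cong[OF e, of j] by simp
      then have "t (k + j) = k + i" using l j xj i by (simp add: juxt_def)
      then show "t' (k + i) = k + i" using i by (simp add: t'_def juxt_def j_def[symmetric])
    qed
    moreover have "t = juxt k t' x"
    proof -
      have "juxt k id (inv' x) \<circ> juxt k id x = id"
        using juxt_comp[OF permutes_id x, of k id "inv' x"] by (simp add: permutes_inv_o[OF x])
      then have "t = t' \<circ> juxt k id x" unfolding t'_def by (simp add: comp_assoc)
      also have "\<dots> = juxt k t' x"
        using juxt_comp[OF permutes_id x, of k t' id] juxt_left[OF \<open>t' permutes {1..k}\<close>] by simp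
      finally show ?thesis .
    qed
    ultimately show False using t by auto
  qed
  moreover have "?I \<subseteq> perms (k + b)" using juxt_permutes[OF _ x] by auto
  ultimately have "(\<Sum>t\<in>perms (k + b). ?f t) = (\<Sum>t\<in>?I. ?f t)"
    by (intro sum.mono_neutral_right) auto
  also have "\<dots> = (\<Sum>t\<in>perms k. ?f (juxt k t x))" by (simp add: sum.reindex[OF inj])
  finally show "(\<Sum>t\<in>perms (k + b). ?f t) = (\<Sum>t\<in>perms k. ?f (juxt k t x))" .
qed

text \<open>Puts the extra points back: they become the points 1, ..., b, and the others are shifted
  by b. The point 0 is treated apart because labellings vanish there.\<close>

definition glue :: "(nat \<Rightarrow> nat) \<Rightarrow> nat \<Rightarrow> nat" where
  "glue q i = (if i = 0 then 0 else if i \<le> b then k + i else q (i - b))"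

definition unglue :: "(nat \<Rightarrow> nat) \<Rightarrow> nat \<Rightarrow> nat" where
  "unglue l i = (if i = 0 then 0 else l (b + i))"

lemma card_tail_fibre: "card {i\<in>{1..b}. k + i = j} = (if j \<in> {k + 1..k + b} then 1 else 0)"
proof (cases "j \<in> {k + 1..k + b}")
  case True
  then have "{i\<in>{1..b}. k + i = j} = {j - k}" by auto
  then show ?thesis using True by simp
next
  case False
  then have e: "{i\<in>{1..b}. k + i = j} = {}" by auto
  show ?thesis unfolding e using False by simp
qed

text \<open>Each of the labels k + 1, ..., k + b gains exactly one point, which turns the fibre size
  m - 1 into m; here m \<ge> 1 excludes truncated subtraction.\<close>

lemma bij_glue: "bij_betw glue Q B"
proof (rule bij_betw_byWitness[where f' = unglue])
  show "\<forall>q\<in>Q. unglue (glue q) = q"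
    using labD(1)[of _ M "fib2 m k b" 0] by (auto simp: glue_def unglue_def fun_eq_iff)
  show "\<forall>l\<in>B. glue (unglue l) = l"
    using labD(1)[of _ "b + M" "const_fib m (k + b)" 0] by (auto simp: glue_def unglue_def fun_eq_iff)
  show "glue ` Q \<subseteq> B"
  proof
    fix l assume "l \<in> glue ` Q"
    then obtain q where q: "q \<in> Q" "l = glue q" by blast
    have "card {i\<in>{1..b + M}. l i = j} = const_fib m (k + b) j" for j
    proof -
      have "{i\<in>{1..b}. l i = j} = {i\<in>{1..b}. k + i = j}" using q(2) by (auto simp: glue_def)
      moreover have "{i\<in>{1..M}. l (b + i) = j} = {i\<in>{1..M}. q i = j}" using q(2) by (auto simp: glue_def)
      ultimately have "card {i\<in>{1..b + M}. l i = j} = (if j \<in> {k + 1..k + b} then 1 else 0) + fib2 m k b j"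
        unfolding card_split_shift using card_tail_fibre labD(2)[OF q(1)] by simp
      then show ?thesis using m by (auto simp: fib2_def const_fib_def)
    qed
    moreover have "l i = 0" if "i \<notin> {1..b + M}" for i
    proof (cases "i = 0")
      case False
      then have "i - b \<notin> {1..M}" "\<not> i \<le> b" using that by auto
      then show ?thesis using labD(1)[OF q(1)] q(2) by (simp add: glue_def)
    qed (simp add: q(2) glue_def)
    ultimately have "l \<in> L" by (simp add: lab_def)
    then show "l \<in> B" using q(2) by (auto simp: glue_def)
  qed
  show "unglue ` B \<subseteq> Q"
  proof
    fix q assume "q \<in> unglue ` B"
    then obtain l where l: "l \<in> L" "\<And>i. i \<in> {1..b} \<Longrightarrow> l i = k + i" "q = unglue l" by blast
    have "card {i\<in>{1..M}. q i = j} = fib2 m k b j" for j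
    proof -
      have "{i\<in>{1..b}. l i = j} = {i\<in>{1..b}. k + i = j}" using l(2) by auto
      moreover have "{i\<in>{1..M}. l (b + i) = j} = {i\<in>{1..M}. q i = j}" using l(3) by (auto simp: unglue_def)
      ultimately have "const_fib m (k + b) j = (if j \<in> {k + 1..k + b} then 1 else 0) + card {i\<in>{1..M}. q i = j}"
        using card_split_shift[of b M "\<lambda>i. l i = j"] card_tail_fibre labD(2)[OF l(1)] by simp
      then show ?thesis by (auto simp: fib2_def const_fib_def split: if_splits)
    qed
    moreover have "q i = 0" if "i \<notin> {1..M}" for i
      using that labD(1)[OF l(1), of "b + i"] l(3) by (auto simp: unglue_def)
    ultimately show "q \<in> Q" by (simp add: lab_def)
  qed
qed

text \<open>At an extra point i both sides equal k + x i, so the equation is a condition on the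
  remaining points only.\<close>

lemma glue_equivariant:
  assumes q: "q \<in> Q" and x: "x permutes {1..b}" and t: "t permutes {1..k}"
  shows "glue q \<circ> juxt b x g = juxt k t x \<circ> glue q \<longleftrightarrow> q \<circ> g = juxt k t x \<circ> q"
proof
  assume e: "glue q \<circ> juxt b x g = juxt k t x \<circ> glue q"
  show "q \<circ> g = juxt k t x \<circ> q"
  proof
    fix i
    show "(q \<circ> g) i = (juxt k t x \<circ> q) i"
    proof (cases "i = 0")
      case True
      then show ?thesis using labD(1)[OF q, of 0] perms_0[OF g] perms_0[OF t] by (simp add: juxt_def)
    next
      case False
      then have "g i \<noteq> 0" using perms_0_iff[OF g] by simp
      then show ?thesis using fun_cong[OF e, of "b + i"] False by (simp add: glue_def juxt_def[of b])
    qed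
  qed
next
  assume e: "q \<circ> g = juxt k t x \<circ> q"
  show "glue q \<circ> juxt b x g = juxt k t x \<circ> glue q"
  proof
    fix i
    consider "i = 0" | "i \<in> {1..b}" | "i > b" by fastforce
    then show "(glue q \<circ> juxt b x g) i = (juxt k t x \<circ> glue q) i"
    proof cases
      case 1
      then show ?thesis using perms_0[OF x] perms_0[OF t] by (simp add: glue_def juxt_def)
    next
      case 2
      have "x i \<in> {1..b}" using permutes_in_image[OF x] 2 by blast
      then show ?thesis using 2 by (simp add: glue_def juxt_def)
    next
      case 3
      have "g (i - b) \<noteq> 0" using perms_0_iff[OF g, of "i - b"] 3 by simp
      then show ?thesis using 3 fun_cong[OF e, of "i - b"] by (simp add: glue_def juxt_def[of b])
    qed
  qed
qed

lemma signed_lab_sum: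
  "fact k * (\<Sum>x\<in>perms b. of_int (sign x) * lab_sum (b + M) m (k + b) \<chi> (juxt b x g)) =
    fact (k + b) * (\<Sum>q\<in>Q. twisted_sum k b \<chi> q g)"
proof -
  have "(\<Sum>l\<in>L. signed_count l) = (\<Sum>l\<in>A. signed_count l)"
    using signed_count_not_inj finite_lab by (intro sum.mono_neutral_right) auto
  then have "fact k * (\<Sum>x\<in>perms b. of_int (sign x) * lab_sum (b + M) m (k + b) \<chi> (juxt b x g)) =
      fact (k + b) * (\<Sum>l\<in>B. signed_count l)"
    unfolding sum_signed_count using sum_injective_labellings by simp
  also have "(\<Sum>l\<in>B. signed_count l) = (\<Sum>q\<in>Q. signed_count (glue q))"
    by (rule sum.reindex_bij_betw[OF bij_glue, symmetric])
  also have "\<dots> = (\<Sum>q\<in>Q. twisted_sum k b \<chi> q g)"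
  proof (rule sum.cong[OF refl])
    fix q assume q: "q \<in> Q"
    have "glue q \<in> B" using bij_betwE[OF bij_glue] q by blast
    then have "signed_count (glue q) = (\<Sum>x\<in>perms b. \<Sum>t\<in>perms k.
        if glue q \<circ> juxt b x g = juxt k t x \<circ> glue q then of_int (sign x) * \<chi> (juxt k t x) else 0)"
      by (rule signed_count_standard)
    also have "\<dots> = (\<Sum>x\<in>perms b. \<Sum>t\<in>perms k.
        if q \<circ> g = juxt k t x \<circ> q then of_int (sign x) * \<chi> (juxt k t x) else 0)"
      using glue_equivariant[OF q] by (intro sum.cong) auto
    also have "\<dots> = twisted_sum k b \<chi> q g" unfolding twisted_sum_def by (rule sum.swap)
    finally show "signed_count (glue q) = twisted_sum k b \<chi> q g" .
  qed
  finally show ?thesis .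
qed

end

section \<open>Induction products of inflated characters\<close>

lemma fib2_pos: "fib2 m k b j \<noteq> 0 \<Longrightarrow> j \<in> {1..k + b}"
  by (auto simp: fib2_def split: if_splits)

text \<open>The bound m \<ge> 2 keeps m - 1 positive, so that the results on wreath products apply
  to the second factor as well.\<close>

locale two_sided =
  fixes m k b N1 N2 :: nat
  assumes m: "m \<ge> 2" and N1: "N1 = m * k" and N2: "N2 = (m - 1) * b"
begin

abbreviation "Q \<equiv> lab (N1 + N2) (fib2 m k b)"
abbreviation "L1 \<equiv> lab N1 (const_fib m k)"
abbreviation "L2 \<equiv> lab N2 (const_fib (m - 1) b)"
abbreviation "Y \<equiv> young_subgroup [N1, N2]"

text \<open>Labellings that split into one labelling for each factor; the two-block Young subgroup
  permutes them among themselves.\<close>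

definition Q_std :: "(nat \<Rightarrow> nat) set" where
  "Q_std = {q\<in>Q. \<forall>i\<in>{1..N1 + N2}. q i \<le> k \<longleftrightarrow> i \<le> N1}"

text \<open>The upper bound \<open>N1 + N2\<close> matters: beyond it \<open>k + l2 (i - N1)\<close>
  would be k, while a labelling has to be 0 there.\<close>

definition pair_lab :: "(nat \<Rightarrow> nat) \<times> (nat \<Rightarrow> nat) \<Rightarrow> nat \<Rightarrow> nat" where
  "pair_lab = (\<lambda>(l1, l2) i. if i \<le> N1 then l1 i else if i \<le> N1 + N2 then k + l2 (i - N1) else 0)"

definition unpair_lab :: "(nat \<Rightarrow> nat) \<Rightarrow> (nat \<Rightarrow> nat) \<times> (nat \<Rightarrow> nat)" where
  "unpair_lab q = (\<lambda>i. if i \<le> N1 then q i else 0, \<lambda>i. if i = 0 then 0 else q (N1 + i) - k)"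

lemma L1_range: "l \<in> L1 \<Longrightarrow> i \<in> {1..N1} \<Longrightarrow> l i \<in> {1..k}"
  using lab_nonzero by (fastforce simp: const_fib_def split: if_splits)

lemma L2_range: "l \<in> L2 \<Longrightarrow> i \<in> {1..N2} \<Longrightarrow> l i \<in> {1..b}"
  using lab_nonzero by (fastforce simp: const_fib_def split: if_splits)

lemma pair_lab_std:
  assumes l1: "l1 \<in> L1" and l2: "l2 \<in> L2"
  shows "pair_lab (l1, l2) \<in> Q_std"
proof -
  let ?q = "pair_lab (l1, l2)"
  have q1: "?q i = l1 i" if "i \<le> N1" for i using that by (simp add: pair_lab_def)
  have q2: "?q (N1 + i) = k + l2 i" if "i \<in> {1..N2}" for i using that by (simp add: pair_lab_def)
  have "card {i\<in>{1..N1 + N2}. ?q i = j} = fib2 m k b j" for j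
  proof -
    have 1: "{i\<in>{1..N1}. ?q i = j} = {i\<in>{1..N1}. l1 i = j}" using q1 by auto
    have 2: "{i\<in>{1..N2}. ?q (N1 + i) = j} = {i\<in>{1..N2}. k + l2 i = j}" using q2 by auto
    have 3: "card {i\<in>{1..N2}. k + l2 i = j} = (if j \<in> {k + 1..k + b} then m - 1 else 0)"
    proof (cases "j \<le> k")
      case True
      have e: "{i\<in>{1..N2}. k + l2 i = j} = {}" using L2_range[OF l2] True by fastforce
      show ?thesis unfolding e using True by simp
    next
      case False
      then obtain j' where j: "j = k + j'" "j' \<noteq> 0"
        by (intro that[of "j - k"]) auto
      have e: "{i\<in>{1..N2}. k + l2 i = j} = {i\<in>{1..N2}. l2 i = j'}" by (simp add: j(1))
      have "card {i\<in>{1..N2}. k + l2 i = j} = const_fib (m - 1) b j'"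
        unfolding e by (rule labD(2)[OF l2])
      then show ?thesis using j unfolding const_fib_def by (simp only:) auto
    qed
    show ?thesis unfolding card_split_shift 1 2 3 labD(2)[OF l1] by (auto simp: const_fib_def fib2_def)
  qed
  moreover have "?q i = 0" if "i \<notin> {1..N1 + N2}" for i
    using that labD(1)[OF l1, of i] by (cases i) (auto simp: pair_lab_def)
  moreover have "?q i \<le> k \<longleftrightarrow> i \<le> N1" if "i \<in> {1..N1 + N2}" for i
  proof (cases "i \<le> N1")
    case True
    then show ?thesis using L1_range[OF l1, of i] q1 that by auto
  next
    case False
    define i' where "i' = i - N1"
    have i': "i' \<in> {1..N2}" "i = N1 + i'" using that False by (auto simp: i'_def)
    show ?thesis using L2_range[OF l2 i'(1)] q2[OF i'(1)] False unfolding i'(2) by simp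
  qed
  ultimately show ?thesis by (simp add: Q_std_def lab_def)
qed

lemma unpair_lab_in:
  assumes q: "q \<in> Q_std"
  shows "fst (unpair_lab q) \<in> L1" "snd (unpair_lab q) \<in> L2"
proof -
  have qQ: "q \<in> Q" and le: "\<And>i. i \<in> {1..N1 + N2} \<Longrightarrow> q i \<le> k \<longleftrightarrow> i \<le> N1"
    using q by (simp_all add: Q_std_def)
  have pos: "q i \<in> {1..k + b}" if "i \<in> {1..N1 + N2}" for i
    using fib2_pos[OF lab_nonzero[OF qQ that]] .
  have split: "fib2 m k b j = card {i\<in>{1..N1}. q i = j} + card {i\<in>{1..N2}. q (N1 + i) = j}" for j
    unfolding labD(2)[OF qQ, symmetric] by (rule card_split_shift)
  have "card {i\<in>{1..N1}. fst (unpair_lab q) i = j} = const_fib m k j" for j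
  proof -
    have e1: "{i\<in>{1..N1}. fst (unpair_lab q) i = j} = {i\<in>{1..N1}. q i = j}" by (auto simp: unpair_lab_def)
    show ?thesis
    proof (cases "j \<in> {1..k}")
      case True
      have e2: "{i\<in>{1..N2}. q (N1 + i) = j} = {}" using le True by fastforce
      show ?thesis using split[of j] True unfolding e1 e2 by (simp add: fib2_def const_fib_def)
    next
      case False
      have e2: "{i\<in>{1..N1}. q i = j} = {}" using le pos False by fastforce
      show ?thesis unfolding e1 e2 using False by (auto simp: const_fib_def)
    qed
  qed
  moreover have "fst (unpair_lab q) i = 0" if "i \<notin> {1..N1}" for i
    using that labD(1)[OF qQ, of i] by (cases i) (auto simp: unpair_lab_def)
  ultimately show "fst (unpair_lab q) \<in> L1" by (simp add: lab_def)
  have gt: "q (N1 + i) > k" if "i \<in> {1..N2}" for i using le[of "N1 + i"] that by auto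
  have "card {i\<in>{1..N2}. snd (unpair_lab q) i = j} = const_fib (m - 1) b j" for j
  proof (cases "j = 0")
    case True
    have e: "{i\<in>{1..N2}. snd (unpair_lab q) i = j} = {}" using gt True by (fastforce simp: unpair_lab_def)
    show ?thesis unfolding e using True by (simp add: const_fib_def)
  next
    case False
    have e1: "{i\<in>{1..N2}. snd (unpair_lab q) i = j} = {i\<in>{1..N2}. q (N1 + i) = k + j}"
    proof -
      have "snd (unpair_lab q) i = j \<longleftrightarrow> q (N1 + i) = k + j" if "i \<in> {1..N2}" for i
        using gt[OF that] that by (auto simp: unpair_lab_def)
      then show ?thesis by blast
    qed
    have e2: "{i\<in>{1..N1}. q i = k + j} = {}" using le False by fastforce
    show ?thesis using split[of "k + j"] False unfolding e1 e2 by (auto simp: fib2_def const_fib_def)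
  qed
  moreover have "snd (unpair_lab q) i = 0" if "i \<notin> {1..N2}" for i
    using that labD(1)[OF qQ, of "N1 + i"] by (auto simp: unpair_lab_def)
  ultimately show "snd (unpair_lab q) \<in> L2" by (simp add: lab_def)
qed

lemma bij_pair_lab: "bij_betw pair_lab (L1 \<times> L2) Q_std"
proof (rule bij_betw_byWitness[where f' = unpair_lab])
  show "\<forall>l\<in>L1 \<times> L2. unpair_lab (pair_lab l) = l"
  proof clarify
    fix l1 l2 assume l: "l1 \<in> L1" "l2 \<in> L2"
    have "(if i \<le> N1 then pair_lab (l1, l2) i else 0) = l1 i" for i
      using labD(1)[OF l(1), of i] by (auto simp: pair_lab_def)
    moreover have "(if i = 0 then 0 else pair_lab (l1, l2) (N1 + i) - k) = l2 i" for i
      using labD(1)[OF l(2), of i] by (auto simp: pair_lab_def)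
    ultimately show "unpair_lab (pair_lab (l1, l2)) = (l1, l2)" by (simp add: unpair_lab_def fun_eq_iff)
  qed
  show "\<forall>q\<in>Q_std. pair_lab (unpair_lab q) = q"
  proof
    fix q assume q: "q \<in> Q_std"
    then have qQ: "q \<in> Q" and le: "\<And>i. i \<in> {1..N1 + N2} \<Longrightarrow> q i \<le> k \<longleftrightarrow> i \<le> N1"
      by (simp_all add: Q_std_def)
    show "pair_lab (unpair_lab q) = q"
    proof
      fix i
      show "pair_lab (unpair_lab q) i = q i"
        using le[of i] labD(1)[OF qQ, of i] by (auto simp: pair_lab_def unpair_lab_def)
    qed
  qed
  show "pair_lab ` (L1 \<times> L2) \<subseteq> Q_std" using pair_lab_std by auto
  show "unpair_lab ` Q_std \<subseteq> L1 \<times> L2" using unpair_lab_in unfolding mem_Times_iff image_subset_iff by blast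
qed

lemma pair_lab_equivariant:
  assumes l: "l1 \<in> L1" "l2 \<in> L2" and p: "p1 permutes {1..N1}" "p2 permutes {1..N2}"
    and t: "t permutes {1..k}" and x: "x permutes {1..b}"
  shows "pair_lab (l1, l2) \<circ> juxt N1 p1 p2 = juxt k t x \<circ> pair_lab (l1, l2) \<longleftrightarrow>
    l1 \<circ> p1 = t \<circ> l1 \<and> l2 \<circ> p2 = x \<circ> l2"
proof -
  let ?q = "pair_lab (l1, l2)"
  have l10: "l1 i = 0" if "i \<notin> {1..N1}" for i using labD(1)[OF l(1) that] .
  have l20: "l2 i = 0" if "i \<notin> {1..N2}" for i using labD(1)[OF l(2) that] .
  have A: "(?q \<circ> juxt N1 p1 p2) i = l1 (p1 i) \<and> (juxt k t x \<circ> ?q) i = t (l1 i)" if i: "i \<in> {1..N1}" for i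
  proof -
    have "p1 i \<in> {1..N1}" using permutes_in_image[OF p(1)] i by blast
    then show ?thesis using i L1_range[OF l(1) i] by (simp add: pair_lab_def juxt_def)
  qed
  have B: "(?q \<circ> juxt N1 p1 p2) (N1 + i) = k + l2 (p2 i) \<and> (juxt k t x \<circ> ?q) (N1 + i) = k + x (l2 i)"
    if i: "i \<in> {1..N2}" for i
  proof -
    have "p2 i \<in> {1..N2}" using permutes_in_image[OF p(2)] i by blast
    then show ?thesis using i L2_range[OF l(2) i] by (simp add: pair_lab_def juxt_def)
  qed
  have C: "(?q \<circ> juxt N1 p1 p2) i = (juxt k t x \<circ> ?q) i" if i: "i \<notin> {1..N1 + N2}" for i
  proof -
    have "juxt N1 p1 p2 i = i" using permutes_not_in[OF juxt_permutes[OF p] i] .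
    moreover have "?q i = 0" using i l10[of i] by (cases i) (auto simp: pair_lab_def)
    ultimately show ?thesis using perms_0[OF t] by (simp add: juxt_def)
  qed
  show ?thesis
  proof
    assume e: "?q \<circ> juxt N1 p1 p2 = juxt k t x \<circ> ?q"
    have "l1 (p1 i) = t (l1 i)" for i
    proof (cases "i \<in> {1..N1}")
      case True
      then show ?thesis using A[OF True] fun_cong[OF e, of i] by simp
    next
      case False
      then show ?thesis using l10[OF False] permutes_not_in[OF p(1) False] perms_0[OF t] by simp
    qed
    moreover have "l2 (p2 i) = x (l2 i)" for i
    proof (cases "i \<in> {1..N2}")
      case True
      then show ?thesis using B[OF True] fun_cong[OF e, of "N1 + i"] by simp
    next
      case False
      then show ?thesis using l20[OF False] permutes_not_in[OF p(2) False] perms_0[OF x] by simp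
    qed
    ultimately show "l1 \<circ> p1 = t \<circ> l1 \<and> l2 \<circ> p2 = x \<circ> l2" by (auto simp: fun_eq_iff)
  next
    assume e: "l1 \<circ> p1 = t \<circ> l1 \<and> l2 \<circ> p2 = x \<circ> l2"
    then have e1: "l1 (p1 i) = t (l1 i)" and e2: "l2 (p2 i) = x (l2 i)" for i by (auto dest: fun_cong)
    show "?q \<circ> juxt N1 p1 p2 = juxt k t x \<circ> ?q"
    proof
      fix i
      consider "i \<in> {1..N1}" | "i \<in> {1..N1 + N2}" "i > N1" | "i \<notin> {1..N1 + N2}" by fastforce
      then show "(?q \<circ> juxt N1 p1 p2) i = (juxt k t x \<circ> ?q) i"
      proof cases
        case 1
        then show ?thesis using A e1 by simp
      next
        case 2
        then have "i - N1 \<in> {1..N2}" "N1 + (i - N1) = i" by auto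
        then show ?thesis using B[of "i - N1"] e2 by simp
      qed (rule C)
    qed
  qed
qed

lemma product_lab_sums:
  assumes p: "p1 permutes {1..N1}" "p2 permutes {1..N2}"
  shows "(\<Sum>l1\<in>L1. \<Sum>t\<in>perms k. if l1 \<circ> p1 = t \<circ> l1 then
      (\<Sum>l2\<in>L2. \<Sum>x\<in>perms b. if l2 \<circ> p2 = x \<circ> l2 then of_int (sign x) * \<chi> (juxt k t x) else 0) else 0) =
    (\<Sum>q\<in>Q_std. twisted_sum k b \<chi> q (juxt N1 p1 p2))"
proof -
  let ?c = "\<lambda>t x. of_int (sign x) * \<chi> (juxt k t x)"
  have "(\<Sum>q\<in>Q_std. twisted_sum k b \<chi> q (juxt N1 p1 p2)) =
      (\<Sum>l\<in>L1 \<times> L2. twisted_sum k b \<chi> (pair_lab l) (juxt N1 p1 p2))"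
    by (rule sum.reindex_bij_betw[OF bij_pair_lab, symmetric])
  also have "\<dots> = (\<Sum>l1\<in>L1. \<Sum>l2\<in>L2. twisted_sum k b \<chi> (pair_lab (l1, l2)) (juxt N1 p1 p2))"
    by (simp add: sum.cartesian_product case_prod_beta')
  also have "\<dots> = (\<Sum>l1\<in>L1. \<Sum>l2\<in>L2. \<Sum>t\<in>perms k. \<Sum>x\<in>perms b.
      if l1 \<circ> p1 = t \<circ> l1 then (if l2 \<circ> p2 = x \<circ> l2 then ?c t x else 0) else 0)"
    unfolding twisted_sum_def using pair_lab_equivariant[OF _ _ p] by (intro sum.cong refl) simp
  also have "\<dots> = (\<Sum>l1\<in>L1. \<Sum>t\<in>perms k. \<Sum>l2\<in>L2. \<Sum>x\<in>perms b.
      if l1 \<circ> p1 = t \<circ> l1 then (if l2 \<circ> p2 = x \<circ> l2 then ?c t x else 0) else 0)"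
    by (rule sum.cong[OF refl], rule sum.swap)
  also have "\<dots> = (\<Sum>l1\<in>L1. \<Sum>t\<in>perms k. if l1 \<circ> p1 = t \<circ> l1 then
      (\<Sum>l2\<in>L2. \<Sum>x\<in>perms b. if l2 \<circ> p2 = x \<circ> l2 then ?c t x else 0) else 0)"
    by (intro sum.cong refl) auto
  finally show ?thesis by simp
qed

text \<open>A permutation compatible with a standard labelling through \<open>juxt k t x\<close>
  preserves the set of points with label at most k, that is {1..\<open>N1\<close>}, and so lies in
  \<open>Y\<close>.\<close>

lemma twisted_sum_zero:
  assumes q: "q \<in> Q_std" and p: "p permutes {1..N1 + N2}" "p \<notin> Y"
  shows "twisted_sum k b \<chi> q p = 0"
  unfolding twisted_sum_def
proof (intro sum.neutral ballI)
  fix t x assume tx: "t \<in> perms k" "x \<in> perms b"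
  have le: "\<And>i. i \<in> {1..N1 + N2} \<Longrightarrow> q i \<le> k \<longleftrightarrow> i \<le> N1" using q by (simp add: Q_std_def)
  have "q \<circ> p \<noteq> juxt k t x \<circ> q"
  proof
    assume e: "q \<circ> p = juxt k t x \<circ> q"
    have "p i \<le> N1 \<longleftrightarrow> i \<le> N1" if i: "i \<in> {1..N1 + N2}" for i
    proof -
      have pi: "p i \<in> {1..N1 + N2}" using permutes_in_image[OF p(1)] i by blast
      have "q (p i) = juxt k t x (q i)" using fun_cong[OF e, of i] by simp
      moreover have "juxt k t x j \<le> k \<longleftrightarrow> j \<le> k" for j
        using perms_le[of t k j] perms_0_iff[of x b "j - k"] tx by (auto simp: juxt_def)
      ultimately show ?thesis using le[OF i] le[OF pi] by simp
    qed
    then show False using p by (simp add: young_two_iff)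
  qed
  then show "(if q \<circ> p = juxt k t x \<circ> q then of_int (sign x) * \<chi> (juxt k t x) else 0) = 0" by simp
qed

lemma twisted_sum_conj:
  assumes w: "w permutes S"
  shows "twisted_sum k b \<chi> (q \<circ> w) (inv' w \<circ> g \<circ> w) = twisted_sum k b \<chi> q g"
proof -
  have "(q \<circ> w) \<circ> (inv' w \<circ> g \<circ> w) = u \<circ> (q \<circ> w) \<longleftrightarrow> q \<circ> g = u \<circ> q" for u
  proof -
    have "(q \<circ> w) \<circ> (inv' w \<circ> g \<circ> w) = (q \<circ> g) \<circ> w" using permutes_inverses(1)[OF w] by (simp add: fun_eq_iff)
    then show ?thesis using comp_perm_cancel(1)[OF w, of "q \<circ> g" "u \<circ> q"] by (simp add: comp_assoc)
  qed
  then show ?thesis by (simp only: twisted_sum_def)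
qed

lemma Q_std_nonempty: "Q_std \<noteq> {}"
proof -
  have "block_lab m k \<in> L1" "block_lab (m - 1) b \<in> L2"
    using block_lab_lab[of m k] block_lab_lab[of "m - 1" b] m by (simp_all add: N1 N2)
  then show ?thesis using pair_lab_std by blast
qed

text \<open>All labellings in \<open>Q\<close> form one orbit, and a permutation keeps a standard
  labelling standard exactly if it lies in \<open>Y\<close>; so the w in question form a coset of
  \<open>Y\<close>.\<close>

lemma card_standardisations:
  assumes q: "q \<in> Q"
  shows "card {w\<in>perms (N1 + N2). q \<circ> w \<in> Q_std} = card Y"
proof -
  obtain q0 where q0: "q0 \<in> Q_std" using Q_std_nonempty by blast
  then have q0Q: "q0 \<in> Q" and le: "\<And>i. i \<in> {1..N1 + N2} \<Longrightarrow> q0 i \<le> k \<longleftrightarrow> i \<le> N1"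
    by (simp_all add: Q_std_def)
  obtain w0 where w0: "w0 permutes {1..N1 + N2}" "q \<circ> w0 = q0" using lab_transitive[OF q q0Q] .
  have iff: "q0 \<circ> v \<in> Q_std \<longleftrightarrow> v \<in> Y" if v: "v permutes {1..N1 + N2}" for v
  proof -
    have "(q0 \<circ> v) i \<le> k \<longleftrightarrow> v i \<le> N1" if "i \<in> {1..N1 + N2}" for i
      using le[of "v i"] permutes_in_image[OF v] that by simp
    then show ?thesis using lab_comp_perm[OF q0Q v] v by (simp add: Q_std_def young_two_iff)
  qed
  have "bij_betw (\<lambda>v. w0 \<circ> v) Y {w\<in>perms (N1 + N2). q \<circ> w \<in> Q_std}"
  proof (rule bij_betw_byWitness[where f' = "\<lambda>w. inv' w0 \<circ> w"])
    show "(\<lambda>v. w0 \<circ> v) ` Y \<subseteq> {w\<in>perms (N1 + N2). q \<circ> w \<in> Q_std}"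
    proof
      fix w assume "w \<in> (\<lambda>v. w0 \<circ> v) ` Y"
      then obtain v where v: "v \<in> Y" "w = w0 \<circ> v" by blast
      then have vp: "v permutes {1..N1 + N2}" by (simp add: young_two_iff)
      have "q \<circ> w = q0 \<circ> v" using v(2) w0(2) by (simp add: comp_assoc[symmetric])
      then show "w \<in> {w\<in>perms (N1 + N2). q \<circ> w \<in> Q_std}"
        using v iff[OF vp] permutes_compose[OF vp w0(1)] by simp
    qed
    show "(\<lambda>w. inv' w0 \<circ> w) ` {w\<in>perms (N1 + N2). q \<circ> w \<in> Q_std} \<subseteq> Y"
    proof
      fix v assume "v \<in> (\<lambda>w. inv' w0 \<circ> w) ` {w\<in>perms (N1 + N2). q \<circ> w \<in> Q_std}"
      then obtain w where w: "w permutes {1..N1 + N2}" "q \<circ> w \<in> Q_std" "v = inv' w0 \<circ> w" by auto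
      have vp: "v permutes {1..N1 + N2}" unfolding w(3) by (rule permutes_compose[OF w(1) permutes_inv[OF w0(1)]])
      have "q0 \<circ> v = q \<circ> w" unfolding w(3) w0(2)[symmetric] using permutes_inverses(1)[OF w0(1)]
        by (simp add: fun_eq_iff)
      then show "v \<in> Y" using iff[OF vp] w(2) by simp
    qed
  qed (simp_all add: fun_eq_iff permutes_inverses[OF w0(1)])
  from bij_betw_same_card[OF this] show ?thesis by simp
qed

text \<open>Induction from \<open>Y\<close> turns the sum over standard labellings into the sum over
  all of them: conjugating g by w is traded for replacing q by \<open>q \<circ> w\<close>, and each
  q becomes standard for \<open>card Y\<close> choices of w.\<close>

lemma sum_conjugates:
  assumes g: "g permutes {1..N1 + N2}"
  shows "(\<Sum>w\<in>perms (N1 + N2). if inv' w \<circ> g \<circ> w \<in> Y then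
      (\<Sum>q\<in>Q_std. twisted_sum k b \<chi> q (inv' w \<circ> g \<circ> w)) else 0) =
    of_nat (card Y) * (\<Sum>q\<in>Q. twisted_sum k b \<chi> q g)"
proof -
  have finQ: "finite Q" by (rule finite_lab)
  have "(\<Sum>w\<in>perms (N1 + N2). if inv' w \<circ> g \<circ> w \<in> Y then
      (\<Sum>q\<in>Q_std. twisted_sum k b \<chi> q (inv' w \<circ> g \<circ> w)) else 0) =
      (\<Sum>w\<in>perms (N1 + N2). \<Sum>q\<in>Q. if q \<circ> w \<in> Q_std then twisted_sum k b \<chi> q g else 0)"
  proof (rule sum.cong[OF refl])
    fix w assume "w \<in> perms (N1 + N2)"
    then have w: "w permutes {1..N1 + N2}" by simp
    have gw: "inv' w \<circ> g \<circ> w permutes {1..N1 + N2}" using w g by (intro permutes_compose permutes_inv)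
    have b: "bij_betw (\<lambda>q. q \<circ> w) {q\<in>Q. q \<circ> w \<in> Q_std} Q_std"
    proof (rule bij_betw_byWitness[where f' = "\<lambda>q. q \<circ> inv' w"])
      show "(\<lambda>q. q \<circ> inv' w) ` Q_std \<subseteq> {q\<in>Q. q \<circ> w \<in> Q_std}"
      proof
        fix q assume "q \<in> (\<lambda>q. q \<circ> inv' w) ` Q_std"
        then obtain q' where q': "q' \<in> Q_std" "q = q' \<circ> inv' w" by blast
        have "q \<circ> w = q'" unfolding q'(2) using permutes_inverses(2)[OF w] by (simp add: fun_eq_iff)
        moreover have "q \<in> Q" unfolding q'(2) using lab_comp_perm[OF _ permutes_inv[OF w]] q'(1) by (simp add: Q_std_def)
        ultimately show "q \<in> {q\<in>Q. q \<circ> w \<in> Q_std}" using q'(1) by simp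
      qed
    qed (auto simp: fun_eq_iff permutes_inverses[OF w])
    have "(if inv' w \<circ> g \<circ> w \<in> Y then (\<Sum>q\<in>Q_std. twisted_sum k b \<chi> q (inv' w \<circ> g \<circ> w)) else 0) =
        (\<Sum>q\<in>Q_std. twisted_sum k b \<chi> q (inv' w \<circ> g \<circ> w))"
      using twisted_sum_zero[OF _ gw] by (simp add: sum.neutral)
    also have "\<dots> = (\<Sum>q\<in>{q\<in>Q. q \<circ> w \<in> Q_std}. twisted_sum k b \<chi> (q \<circ> w) (inv' w \<circ> g \<circ> w))"
      by (rule sum.reindex_bij_betw[OF b, symmetric])
    also have "\<dots> = (\<Sum>q\<in>{q\<in>Q. q \<circ> w \<in> Q_std}. twisted_sum k b \<chi> q g)"
      by (simp only: twisted_sum_conj[OF w])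
    also have "\<dots> = (\<Sum>q\<in>Q. if q \<circ> w \<in> Q_std then twisted_sum k b \<chi> q g else 0)"
      by (rule sum.inter_filter[OF finQ])
    finally show "(if inv' w \<circ> g \<circ> w \<in> Y then (\<Sum>q\<in>Q_std. twisted_sum k b \<chi> q (inv' w \<circ> g \<circ> w)) else 0) =
        (\<Sum>q\<in>Q. if q \<circ> w \<in> Q_std then twisted_sum k b \<chi> q g else 0)" .
  qed
  also have "\<dots> = (\<Sum>q\<in>Q. \<Sum>w\<in>perms (N1 + N2). if q \<circ> w \<in> Q_std then twisted_sum k b \<chi> q g else 0)"
    by (rule sum.swap)
  also have "\<dots> = (\<Sum>q\<in>Q. of_nat (card Y) * twisted_sum k b \<chi> q g)"
  proof (rule sum.cong[OF refl])
    fix q assume q: "q \<in> Q"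
    have "(\<Sum>w\<in>perms (N1 + N2). if q \<circ> w \<in> Q_std then twisted_sum k b \<chi> q g else 0) =
        (\<Sum>w\<in>{w\<in>perms (N1 + N2). q \<circ> w \<in> Q_std}. twisted_sum k b \<chi> q g)"
      by (rule sum.inter_filter[OF finite_perms, symmetric])
    then show "(\<Sum>w\<in>perms (N1 + N2). if q \<circ> w \<in> Q_std then twisted_sum k b \<chi> q g else 0) =
        of_nat (card Y) * twisted_sum k b \<chi> q g"
      using card_standardisations[OF q] by simp
  qed
  finally show ?thesis by (simp add: sum_distrib_left)
qed

end

section \<open>The quotient formula\<close>

lemma lab_sum_class:
  assumes g: "g permutes {1..N}" and h: "h permutes {1..N}"
  shows "lab_sum N m n F (h \<circ> g \<circ> inv' h) = lab_sum N m n F g"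
proof -
  let ?L = "lab N (const_fib m n)"
  let ?G = "\<lambda>l g. \<Sum>t\<in>perms n. if l \<circ> g = t \<circ> l then F t else 0"
  have b: "bij_betw (\<lambda>l. l \<circ> inv' h) ?L ?L"
    by (rule bij_betw_byWitness[where f' = "\<lambda>l. l \<circ> h"])
      (auto simp: fun_eq_iff permutes_inverses[OF h] intro: lab_comp_perm permutes_inv h)
  have "lab_sum N m n F (h \<circ> g \<circ> inv' h) = (\<Sum>l\<in>?L. ?G (l \<circ> inv' h) (h \<circ> g \<circ> inv' h))"
    unfolding lab_sum_def by (rule sum.reindex_bij_betw[OF b, symmetric])
  also have "\<dots> = lab_sum N m n F g"
    unfolding lab_sum_def
  proof (intro sum.cong refl)
    fix l t :: "nat \<Rightarrow> nat"
    have "(l \<circ> inv' h) \<circ> (h \<circ> g \<circ> inv' h) = (l \<circ> g) \<circ> inv' h"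
      using permutes_inverses(2)[OF h] by (simp add: fun_eq_iff)
    then have "(l \<circ> inv' h) \<circ> (h \<circ> g \<circ> inv' h) = t \<circ> (l \<circ> inv' h) \<longleftrightarrow> l \<circ> g = t \<circ> l"
      using comp_perm_cancel(1)[OF permutes_inv[OF h], of "l \<circ> g" "t \<circ> l"] by (simp add: comp_assoc)
    then show "(if (l \<circ> inv' h) \<circ> (h \<circ> g \<circ> inv' h) = t \<circ> (l \<circ> inv' h) then F t else 0) =
        (if l \<circ> g = t \<circ> l then F t else 0)" by simp
  qed
  finally show ?thesis .
qed

lemma lab_sum_cong: "(\<And>t. t permutes {1..n} \<Longrightarrow> F t = F' t) \<Longrightarrow> lab_sum N m n F g = lab_sum N m n F' g"
  unfolding lab_sum_def by (intro sum.cong refl) auto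

lemma rho_single:
  assumes "m \<ge> 1" "\<alpha> \<in> partitions n" "g permutes {1..m * n}"
  shows "rho m \<alpha> [] g = lab_sum (m * n) m n (irr_sym \<alpha>) g / fact n"
  using rho_eq[OF assms(1), of n \<alpha> "[]" g] assms lab_sum_cong[OF skew_char_Nil[OF assms(2)]]
  by (simp add: sum_list_partition)

text \<open>The factor (k + b)! / k! from \<open>signed_lab_sum\<close> meets the 1 / (k + b)! of
  the inflated character and the 1 / b! of the average, leaving 1 / (k! b!).\<close>

lemma quotient_side:
  assumes m: "m \<ge> 1" and \<alpha>: "\<alpha> \<in> partitions (k + b)" and M: "b + M = m * (k + b)" and g: "g permutes {1..M}"
  shows "char_quotient (b + M) (rho m \<alpha> []) (replicate b 1) g =
    (\<Sum>q\<in>lab M (fib2 m k b). twisted_sum k b (irr_sym \<alpha>) q g) / (fact k * fact b)"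
proof -
  interpret averaging m k b M "irr_sym \<alpha>" g
    by unfold_locales (use m irr_sym_class[OF \<alpha>] g in auto)
  have rho: "rho m \<alpha> [] p = lab_sum (b + M) m (k + b) (irr_sym \<alpha>) p / fact (k + b)"
    if "p permutes {1..b + M}" for p
    using rho_single[OF m \<alpha>, of p] that by (simp add: M)
  have class_rho: "sym_class_fun (b + M) (rho m \<alpha> [])"
    unfolding sym_class_fun_def
  proof (intro allI impI)
    fix p h assume p: "p permutes {1..b + M}" and h: "h permutes {1..b + M}"
    then have "h \<circ> p \<circ> inv' h permutes {1..b + M}" by (intro permutes_compose permutes_inv)
    then show "rho m \<alpha> [] (h \<circ> p \<circ> inv' h) = rho m \<alpha> [] p" using rho p lab_sum_class[OF p h] by simp
  qed
  have part: "replicate b 1 \<in> partitions b"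
    by (auto simp: partitions_def sum_list_replicate sorted_wrt_iff_nth_less)
  have "char_quotient (b + M) (rho m \<alpha> []) (replicate b 1) g = restr b (rho m \<alpha> []) (replicate b 1) g"
    by (rule char_quotient_eq[OF class_rho part g])
  also have "\<dots> = (\<Sum>x\<in>perms b. of_int (sign x) * lab_sum (b + M) m (k + b) (irr_sym \<alpha>) (juxt b x g)) /
      (fact (k + b) * fact b)"
  proof -
    have "rho m \<alpha> [] (juxt b x g) * cnj (irr_sym (replicate b 1) x) =
        of_int (sign x) * lab_sum (b + M) m (k + b) (irr_sym \<alpha>) (juxt b x g) / fact (k + b)"
      if "x \<in> perms b" for x
    proof -
      have x: "x permutes {1..b}" using that by simp
      show ?thesis unfolding irr_sym_sign[OF x] rho[OF juxt_permutes[OF x g]] by simp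
    qed
    then have "(\<Sum>x\<in>perms b. rho m \<alpha> [] (juxt b x g) * cnj (irr_sym (replicate b 1) x)) =
        (\<Sum>x\<in>perms b. of_int (sign x) * lab_sum (b + M) m (k + b) (irr_sym \<alpha>) (juxt b x g)) / fact (k + b)"
      unfolding sum_divide_distrib by (rule sum.cong[OF refl])
    then show ?thesis unfolding restr_def by simp
  qed
  also have "\<dots> = fact k * (\<Sum>x\<in>perms b. of_int (sign x) * lab_sum (b + M) m (k + b) (irr_sym \<alpha>) (juxt b x g)) /
      (fact k * fact (k + b) * fact b)" by simp
  also have "\<dots> = (\<Sum>q\<in>Q. twisted_sum k b (irr_sym \<alpha>) q g) / (fact k * fact b)"
    unfolding signed_lab_sum by simp
  finally show ?thesis .
qed

text \<open>Here k! and b! are the normalisations of the two inflated characters. The sum over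
  \<open>\<beta>\<close> is evaluated pointwise on \<open>Y\<close> before inducing, so that a
  single induced sum remains.\<close>

lemma product_side:
  assumes m: "m \<ge> 2" and \<alpha>: "\<alpha> \<in> partitions (k + b)" and g: "g permutes {1..m * k + (m - 1) * b}"
  shows "(\<Sum>\<beta>\<in>partitions k. ind_prod (m * k) ((m - 1) * b)
      (rho m \<beta> []) (rho (m - 1) (conj_part \<alpha>) (conj_part \<beta>)) g) =
    (\<Sum>q\<in>lab (m * k + (m - 1) * b) (fib2 m k b). twisted_sum k b (irr_sym \<alpha>) q g) / (fact k * fact b)"
proof -
  define N1 N2 where "N1 = m * k" and "N2 = (m - 1) * b"
  interpret two_sided m k b N1 N2
    by unfold_locales (use m in \<open>simp_all add: N1_def N2_def\<close>)
  let ?\<chi> = "irr_sym \<alpha>"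
  have g: "g permutes {1..N1 + N2}" using g by (simp add: N1_def N2_def)
  let ?R1 = "\<lambda>\<beta>. rho m \<beta> []" and ?R2 = "\<lambda>\<beta>. rho (m - 1) (conj_part \<alpha>) (conj_part \<beta>)"
  have R1: "?R1 \<beta> p = lab_sum N1 m k (irr_sym \<beta>) p / fact k"
    if "\<beta> \<in> partitions k" "p permutes {1..N1}" for \<beta> p
    using rho_single[of m \<beta> k p] that m by (simp add: N1_def)
  have R2: "?R2 \<beta> p = lab_sum N2 (m - 1) b (\<lambda>x. of_int (sign x) * skew_char \<alpha> \<beta> x) p / fact b"
    if \<beta>: "\<beta> \<in> partitions k" and p: "p permutes {1..N2}" for \<beta> p
  proof -
    have "b = sum_list (conj_part \<alpha>) - sum_list (conj_part \<beta>)"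
      by (simp add: sum_list_conj_part[OF \<alpha>] sum_list_conj_part[OF \<beta>])
    then show ?thesis
      using rho_eq[of "m - 1" b "conj_part \<alpha>" "conj_part \<beta>" p] p m lab_sum_cong[OF skew_char_conj[OF \<alpha> \<beta>]]
      by (simp add: N2_def)
  qed
  have prod: "(\<Sum>\<beta>\<in>partitions k. ?R1 \<beta> (shifted_restrict 0 N1 p) * ?R2 \<beta> (shifted_restrict N1 N2 p)) =
      (\<Sum>q\<in>Q_std. twisted_sum k b ?\<chi> q p) / (fact k * fact b)" if pY: "p \<in> Y" for p
  proof -
    obtain p1 p2 where p: "p1 permutes {1..N1}" "p2 permutes {1..N2}" "p = juxt N1 p1 p2"
      using young_two_split[OF pY] .
    have "(\<Sum>\<beta>\<in>partitions k. ?R1 \<beta> (shifted_restrict 0 N1 p) * ?R2 \<beta> (shifted_restrict N1 N2 p)) =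
        (\<Sum>\<beta>\<in>partitions k. lab_sum N1 m k (irr_sym \<beta>) p1 *
          lab_sum N2 (m - 1) b (\<lambda>x. of_int (sign x) * skew_char \<alpha> \<beta> x) p2) / (fact k * fact b)"
      unfolding p(3) shifted_restrict_juxt[OF p(1,2)] using R1[OF _ p(1)] R2[OF _ p(2)]
      by (simp add: sum_divide_distrib cong: sum.cong)
    also have "(\<Sum>\<beta>\<in>partitions k. lab_sum N1 m k (irr_sym \<beta>) p1 *
          lab_sum N2 (m - 1) b (\<lambda>x. of_int (sign x) * skew_char \<alpha> \<beta> x) p2) =
        (\<Sum>\<beta>\<in>partitions k. \<Sum>l1\<in>L1. \<Sum>t\<in>perms k. \<Sum>l2\<in>L2. \<Sum>x\<in>perms b.
          if l1 \<circ> p1 = t \<circ> l1 then (if l2 \<circ> p2 = x \<circ> l2 then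
            of_int (sign x) * (irr_sym \<beta> t * skew_char \<alpha> \<beta> x) else 0) else 0)"
      unfolding lab_sum_def sum_distrib_right
      unfolding sum_distrib_left
      by (intro sum.cong refl) auto
    \<comment> \<open>The sum over \<open>\<beta>\<close> is moved innermost, where t and x are
      fixed and \<open>sum_irr_skew\<close> applies.\<close>
    also have "\<dots> = (\<Sum>l1\<in>L1. \<Sum>t\<in>perms k. \<Sum>l2\<in>L2. \<Sum>x\<in>perms b. \<Sum>\<beta>\<in>partitions k.
          if l1 \<circ> p1 = t \<circ> l1 then (if l2 \<circ> p2 = x \<circ> l2 then
            of_int (sign x) * (irr_sym \<beta> t * skew_char \<alpha> \<beta> x) else 0) else 0)"
      by (subst sum.swap, rule sum.cong[OF refl], subst sum.swap, rule sum.cong[OF refl],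
          subst sum.swap, rule sum.cong[OF refl], rule sum.swap)
    also have "\<dots> = (\<Sum>l1\<in>L1. \<Sum>t\<in>perms k. if l1 \<circ> p1 = t \<circ> l1 then
      (\<Sum>l2\<in>L2. \<Sum>x\<in>perms b. if l2 \<circ> p2 = x \<circ> l2 then of_int (sign x) * ?\<chi> (juxt k t x) else 0) else 0)"
    proof (intro sum.cong refl)
      fix l1 t assume "t \<in> perms k"
      then have t: "t permutes {1..k}" by simp
      have "(\<Sum>\<beta>\<in>partitions k. of_int (sign x) * (irr_sym \<beta> t * skew_char \<alpha> \<beta> x)) =
          of_int (sign x) * ?\<chi> (juxt k t x)" if "x \<in> perms b" for x
        using sum_irr_skew[OF \<alpha> t, of x] that by (simp flip: sum_distrib_left)
      then show "(\<Sum>l2\<in>L2. \<Sum>x\<in>perms b. \<Sum>\<beta>\<in>partitions k.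
          if l1 \<circ> p1 = t \<circ> l1 then (if l2 \<circ> p2 = x \<circ> l2 then
            of_int (sign x) * (irr_sym \<beta> t * skew_char \<alpha> \<beta> x) else 0) else 0) =
        (if l1 \<circ> p1 = t \<circ> l1 then
          (\<Sum>l2\<in>L2. \<Sum>x\<in>perms b. if l2 \<circ> p2 = x \<circ> l2 then of_int (sign x) * ?\<chi> (juxt k t x) else 0) else 0)"
        by (auto intro!: sum.cong)
    qed
    also have "\<dots> = (\<Sum>q\<in>Q_std. twisted_sum k b ?\<chi> q p)"
      unfolding p(3) by (rule product_lab_sums[OF p(1,2)])
    finally show ?thesis .
  qed
  have "(\<Sum>\<beta>\<in>partitions k. ind_prod N1 N2 (?R1 \<beta>) (?R2 \<beta>) g) =
      (\<Sum>\<beta>\<in>partitions k. \<Sum>w\<in>perms (N1 + N2). if inv' w \<circ> g \<circ> w \<in> Y then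
        ?R1 \<beta> (shifted_restrict 0 N1 (inv' w \<circ> g \<circ> w)) * ?R2 \<beta> (shifted_restrict N1 N2 (inv' w \<circ> g \<circ> w))
        else 0) / of_nat (card Y)"
    unfolding ind_prod_def induced_def carrier_sym Let_def sum_divide_distrib[symmetric]
    by (intro arg_cong2[where f = "(/)"] sum.cong refl) (simp add: sym_group_mult inv_sym_group)
  also have "(\<Sum>\<beta>\<in>partitions k. \<Sum>w\<in>perms (N1 + N2). if inv' w \<circ> g \<circ> w \<in> Y then
        ?R1 \<beta> (shifted_restrict 0 N1 (inv' w \<circ> g \<circ> w)) * ?R2 \<beta> (shifted_restrict N1 N2 (inv' w \<circ> g \<circ> w))
        else 0) =
      (\<Sum>w\<in>perms (N1 + N2). if inv' w \<circ> g \<circ> w \<in> Y then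
        (\<Sum>q\<in>Q_std. twisted_sum k b ?\<chi> q (inv' w \<circ> g \<circ> w)) / (fact k * fact b) else 0)"
  proof (subst sum.swap, rule sum.cong[OF refl])
    fix w
    show "(\<Sum>\<beta>\<in>partitions k. if inv' w \<circ> g \<circ> w \<in> Y then
        ?R1 \<beta> (shifted_restrict 0 N1 (inv' w \<circ> g \<circ> w)) * ?R2 \<beta> (shifted_restrict N1 N2 (inv' w \<circ> g \<circ> w))
        else 0) = (if inv' w \<circ> g \<circ> w \<in> Y then
        (\<Sum>q\<in>Q_std. twisted_sum k b ?\<chi> q (inv' w \<circ> g \<circ> w)) / (fact k * fact b) else 0)"
    proof (cases "inv' w \<circ> g \<circ> w \<in> Y")
      case True
      then show ?thesis by (simp only: if_True prod[OF True])
    next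
      case False
      then show ?thesis by (simp only: if_False sum.neutral_const)
    qed
  qed
  also have "\<dots> = (\<Sum>w\<in>perms (N1 + N2). if inv' w \<circ> g \<circ> w \<in> Y then
        (\<Sum>q\<in>Q_std. twisted_sum k b ?\<chi> q (inv' w \<circ> g \<circ> w)) else 0) / (fact k * fact b)"
    by (subst sum_divide_distrib[where A = "perms (N1 + N2)"]) (intro sum.cong refl, simp)
  also have "\<dots> = of_nat (card Y) * (\<Sum>q\<in>Q. twisted_sum k b ?\<chi> q g) / (fact k * fact b)"
    unfolding sum_conjugates[OF g] ..
  finally show ?thesis
    using card_young_subgroup[of "[N1, N2]"] by (simp add: N1_def N2_def)
qed

theorem theoremB:
  fixes m n k :: nat and lam :: "nat list"
  assumes "m \<ge> 2" and "n \<ge> 1" and "k \<in> {0..n - 1}" and "lam \<in> partitions n"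
  shows "\<forall>g \<in> carrier (sym_group (m * n - (n - k))).
    char_quotient (m * n) (rho m lam []) (replicate (n - k) 1) g =
    (\<Sum>\<beta>\<in>partitions k.
       ind_prod (m * k) ((m - 1) * (n - k))
         (rho m \<beta> []) (rho (m - 1) (conj_part lam) (conj_part \<beta>)) g)"
proof
  define b where "b = n - k"
  define M where "M = m * k + (m - 1) * b"
  have n: "n = k + b" using assms(2,3) by (auto simp: b_def)
  obtain m' where m': "m = Suc m'" using assms(1) by (cases m) auto
  \<comment> \<open>The degrees agree: m n points without the b extra ones are m k + (m - 1) b
    points.\<close>
  have mn: "b + M = m * (k + b)" by (simp add: M_def m' algebra_simps)
  then have M: "m * n - (n - k) = M" using n by simp
  fix g assume "g \<in> carrier (sym_group (m * n - (n - k)))"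
  then have g: "g permutes {1..M}" unfolding M by (simp add: sym_group_carrier)
  have lam: "lam \<in> partitions (k + b)" using assms(4) n by simp
  show "char_quotient (m * n) (rho m lam []) (replicate (n - k) 1) g =
    (\<Sum>\<beta>\<in>partitions k.
       ind_prod (m * k) ((m - 1) * (n - k))
         (rho m \<beta> []) (rho (m - 1) (conj_part lam) (conj_part \<beta>)) g)"
    using quotient_side[OF _ lam mn g] product_side[OF assms(1) lam g[unfolded M_def]] assms(1) mn
    by (simp add: n M_def)
qed

end
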